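(* Let $k\ge 0$ be an integer, let $X$ be a non-empty compact triangulable metric space with $H_k(X)\neq 0$, let $\Phi\subseteq C^0(X,\mathbb{R})$ contain all constant functions, and let $G$ be a subgroup of $\mathrm{Homeo}(X)$ such that $\varphi\circ g\in\Phi$ for all $\varphi\in\Phi$, $g\in G$. Let $\mathcal{F}$ be a non-empty subset of $\mathcal{F}(\Phi,G)$, the set of all non-expansive $G$-operators $\Phi\to\Phi$. Then $D^{\mathcal{F},k}_{match}$ is a strongly $G$-invariant pseudo-metric on $\Phi$.
   Context: "Compact triangulable" means homeomorphic to the geometric realization of a finite simplicial complex. $\mathrm{Homeo}(X)$ is the group of all homeomorphisms of $X$ onto itself. $C^0(X,\mathbb{R})$ is the set of continuous functions $X\to\mathbb{R}$ with the sup-norm $\|\cdot\|_\infty$, and $\Phi$ carries the induced topology. $\mathcal{F}(\Phi,G)$ is the set of all maps $F:\Phi\to\Phi$ (not necessarily linear) such that $F(\varphi\circ g)=F(\varphi)\circ g$ for all $\varphi\in\Phi$, $g\in G$, and $\|F(\varphi_1)-F(\varphi_2)\|_\infty\le\|\varphi_1-\varphi_2\|_\infty$ for all $\varphi_1,\varphi_2\in\Phi$. A pseudo-metric is a (finite, real-valued) function satisfying all axioms of a metric except that distinct points may have distance $0$. A pseudo-metric $\bar d$ on $\Phi$ is strongly $G$-invariant if $\bar d(\varphi_1,\varphi_2)=\bar d(\varphi_1\circ g,\varphi_2)=\bar d(\varphi_1,\varphi_2\circ g)=\bar d(\varphi_1\circ g,\varphi_2\circ g)$ for every $\varphi_1,\varphi_2\in\Phi$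 and $g\in G$. Persistent homology: $H_k$ is singular homology in degree $k$ with coefficients in a fixed field. For continuous $\varphi:X\to\mathbb{R}$ put $X_t=\varphi^{-1}((-\infty,t])$. For real $u<v$, $r_k(\varphi)(u,v)$ is the rank of the map $H_k(X_u)\to H_k(X_v)$ induced by inclusion; $r_k(\varphi)$ is the $k$-th persistent Betti number function. The persistence diagram of $r_k(\varphi)$ is the multiset consisting of: (i) each point $(u,v)$ with $u<v<\infty$, with multiplicity $\lim_{\varepsilon\to0^+}\big[r_k(\varphi)(u+\varepsilon,v-\varepsilon)-r_k(\varphi)(u-\varepsilon,v-\varepsilon)-r_k(\varphi)(u+\varepsilon,v+\varepsilon)+r_k(\varphi)(u-\varepsilon,v+\varepsilon)\big]$; (ii) each point $(u,\infty)$, $u\in\mathbb{R}$, with multiplicity $\lim_{\varepsilon\to0^+}\big[r_k(\varphi)(u+\varepsilon,w)-r_k(\varphi)(u-\varepsilon,w)\big]$ for any $w>\max(u,\max_X\varphi)$; (iii) each diagonal point $(t,t)$, $t\in\mathbb{R}$, with countably infinite multiplicity. $d_{match}(r_k(\varphi_1),r_k(\varphi_2))$ is the bottleneck distance between the two persistence diagrams: the infimum, over all bijections between the two multisets, of the supremum of the max-norm distances $\max\{|u-u'|,|v-v'|\}$ between matched points, with the conventions $|\infty-\infty|=0$ and $|\infty-a|=\infty$ for $a\in\mathbb{R}$. Finally, $D^{\mathcal{F},k}_{match}(\varphi_1,\varphi_2)=\sup_{F\in\mathcal{F}}d_{match}\big(r_k(F(\varphi_1)),r_k(F(\varphi_2))\big)$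 for $\varphi_1,\varphi_2\in\Phi$. *)

theory Defs
  imports
    "HOL-Analysis.Analysis"
    "HOL-Homology.Homology"
    "Jordan_Normal_Form.VS_Connect"
begin

section \<open>Singular homology with coefficients in a field\<close>

text \<open>
  \<^theory>\<open>HOL-Homology.Homology\<close> has integer coefficients only. The chains below are finite formal
  combinations of that theory's singular simplices with coefficients in a field \<open>'k\<close>; the boundary
  operator is the one of \<^const>\<open>chain_boundary\<close>, with zero boundary in degree 0 (unreduced homology).
\<close>

type_synonym ('a, 'k) field_chain = "((nat \<Rightarrow> real) \<Rightarrow> 'a) \<Rightarrow>\<^sub>0 'k"

definition chain_space :: "nat \<Rightarrow> 'a topology \<Rightarrow> ('k::field, ('a, 'k) field_chain) module"
  where "chain_space p X =
    \<lparr>carrier = {c. Poly_Mapping.keys c \<subseteq> singular_simplex_set p X},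
     mult = undefined, one = undefined, zero = 0, add = (+),
     smult = (\<lambda>a. Poly_Mapping.map ((*) a))\<rparr>"

definition field_boundary :: "nat \<Rightarrow> ('a, 'k::field) field_chain \<Rightarrow> ('a, 'k) field_chain"
  where "field_boundary p c =
    (if p = 0 then 0
     else \<Sum>f\<in>Poly_Mapping.keys c. \<Sum>i\<le>p.
            Poly_Mapping.single (singular_face p i f) ((-1) ^ i * Poly_Mapping.lookup c f))"

definition cycles :: "nat \<Rightarrow> 'a topology \<Rightarrow> ('a, 'k::field) field_chain set"
  where "cycles p X = {c \<in> carrier (chain_space p X). field_boundary p c = 0}"

definition boundaries :: "nat \<Rightarrow> 'a topology \<Rightarrow> ('a, 'k::field) field_chain set"
  where "boundaries p X = field_boundary (Suc p) ` carrier (chain_space (Suc p) X)"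

text \<open>
  Elements of a quotient module are cosets. In the scalar multiplication \<open>N\<close> is added again because
  \<open>a \<cdot> (v + N)\<close>, computed elementwise, is only \<open>{0}\<close> when \<open>a = 0\<close>.
\<close>

definition quotient_module :: "('k, 'v, 'm) module_scheme \<Rightarrow> 'v set \<Rightarrow> ('k, 'v set) module"
  where "quotient_module M N =
    \<lparr>carrier = a_rcosets\<^bsub>M\<^esub> N,
     mult = undefined, one = undefined, zero = N, add = set_add M,
     smult = (\<lambda>a S. ((\<lambda>v. a \<odot>\<^bsub>M\<^esub> v) ` S) <+>\<^bsub>M\<^esub> N)\<rparr>"

definition homology_space ::
    "nat \<Rightarrow> 'a topology \<Rightarrow> ('k::field, ('a, 'k) field_chain set) module"
  where "homology_space p X =
    quotient_module ((chain_space p X)\<lparr>carrier := cycles p X\<rparr>) (boundaries p X)"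

text \<open>
  For a subspace \<open>A\<close> of \<open>B\<close>, a chain in \<open>A\<close> is literally a chain in \<open>B\<close>, and the map induced by the
  inclusion sends the class \<open>z + boundaries p A\<close> to \<open>z + boundaries p B\<close>. As \<open>boundaries p A\<close> is
  contained in \<open>boundaries p B\<close>, that is the elementwise sum of the first coset with \<open>boundaries p B\<close>.
\<close>

definition inclusion_hom ::
    "nat \<Rightarrow> 'a topology \<Rightarrow> ('a, 'k::field) field_chain set \<Rightarrow> ('a, 'k) field_chain set"
  where "inclusion_hom p B h = h <+>\<^bsub>chain_space p B\<^esub> boundaries p B"

section \<open>Persistent Betti numbers and persistence diagrams\<close>

definition sublevel :: "('a::topological_space \<Rightarrow>\<^sub>C real) \<Rightarrow> real \<Rightarrow> 'a topology"
  where "sublevel \<phi> t = top_of_set {x. apply_bcontfun \<phi> x \<le> t}"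

text \<open>The argument of type \<^typ>\<open>'k itself\<close> names the coefficient field.\<close>

definition persistent_betti ::
    "'k::field itself \<Rightarrow> nat \<Rightarrow> ('a::topological_space \<Rightarrow>\<^sub>C real) \<Rightarrow> real \<Rightarrow> real \<Rightarrow> nat"
  where "persistent_betti K k \<phi> u v =
    vectorspace.dim (class_ring :: 'k ring)
      ((homology_space k (sublevel \<phi> v))
        \<lparr>carrier := inclusion_hom k (sublevel \<phi> v) ` carrier (homology_space k (sublevel \<phi> u))\<rparr>)"

definition finite_multiplicity ::
    "'k::field itself \<Rightarrow> nat \<Rightarrow> ('a::topological_space \<Rightarrow>\<^sub>C real) \<Rightarrow> real \<Rightarrow> real \<Rightarrow> nat"
  where "finite_multiplicity K k \<phi> u v =
    (let r = (\<lambda>s t. int (persistent_betti K k \<phi> s t)) in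
      THE m. ((\<lambda>\<epsilon>. r (u + \<epsilon>) (v - \<epsilon>) - r (u - \<epsilon>) (v - \<epsilon>)
                  - r (u + \<epsilon>) (v + \<epsilon>) + r (u - \<epsilon>) (v + \<epsilon>)) \<longlongrightarrow> int m) (at_right 0))"

definition infinite_multiplicity ::
    "'k::field itself \<Rightarrow> nat \<Rightarrow> ('a::topological_space \<Rightarrow>\<^sub>C real) \<Rightarrow> real \<Rightarrow> nat"
  where "infinite_multiplicity K k \<phi> u =
    (let r = (\<lambda>s t. int (persistent_betti K k \<phi> s t)) in
      THE m. \<forall>w > max u (SUP x. apply_bcontfun \<phi> x).
               ((\<lambda>\<epsilon>. r (u + \<epsilon>) w - r (u - \<epsilon>) w) \<longlongrightarrow> int m) (at_right 0))"

text \<open>A diagram is a multiset in the extended plane, given by its multiplicity function.\<close>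

type_synonym diagram = "real \<times> ereal \<Rightarrow> enat"

definition persistence_diagram ::
    "'k::field itself \<Rightarrow> nat \<Rightarrow> ('a::topological_space \<Rightarrow>\<^sub>C real) \<Rightarrow> diagram"
  where "persistence_diagram K k \<phi> = (\<lambda>(u, v).
    if v = ereal u then \<infinity>
    else if v = \<infinity> then enat (infinite_multiplicity K k \<phi> u)
    else if ereal u < v then enat (finite_multiplicity K k \<phi> u (real_of_ereal v))
    else 0)"

section \<open>The bottleneck distance\<close>

text \<open>The elements of a multiset, the copies of a point being numbered from 0.\<close>

definition occurrences :: "('p \<Rightarrow> enat) \<Rightarrow> ('p \<times> nat) set"
  where "occurrences D = {(p, i). enat i < D p}"

text \<open>The case distinction encodes \<open>|\<infinity> - \<infinity>| = 0\<close>; in \<^typ>\<open>ereal\<close> one has \<open>\<infinity> - \<infinity> = \<infinity>\<close>.\<close>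

definition point_dist :: "real \<times> ereal \<Rightarrow> real \<times> ereal \<Rightarrow> ereal"
  where "point_dist = (\<lambda>(u, v) (u', v').
    max (ereal \<bar>u - u'\<bar>) (if v = v' then 0 else \<bar>v - v'\<bar>))"

definition bottleneck_dist :: "diagram \<Rightarrow> diagram \<Rightarrow> ereal"
  where "bottleneck_dist D D' =
    (INF \<sigma>\<in>{\<sigma>. bij_betw \<sigma> (occurrences D) (occurrences D')}.
       SUP q\<in>occurrences D. point_dist (fst q) (fst (\<sigma> q)))"

definition d_match ::
    "'k::field itself \<Rightarrow> nat \<Rightarrow> ('a::topological_space \<Rightarrow>\<^sub>C real) \<Rightarrow> ('a \<Rightarrow>\<^sub>C real) \<Rightarrow> ereal"
  where "d_match K k \<phi>\<^sub>1 \<phi>\<^sub>2 =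
    bottleneck_dist (persistence_diagram K k \<phi>\<^sub>1) (persistence_diagram K k \<phi>\<^sub>2)"

section \<open>Non-expansive group-equivariant operators\<close>

definition homeo_group :: "('a::topological_space \<Rightarrow> 'a) monoid"
  where "homeo_group =
    \<lparr>carrier = {g. homeomorphic_map euclidean euclidean g}, mult = (\<circ>), one = id\<rparr>"

text \<open>
  For a compact type \<open>'a\<close> every continuous function is bounded, so that \<open>'a \<Rightarrow>\<^sub>C real\<close> consists of all
  continuous real functions; its metric is that of the sup-norm.
\<close>

definition bcontfun_comp ::
    "('a::topological_space \<Rightarrow>\<^sub>C real) \<Rightarrow> ('a \<Rightarrow> 'a) \<Rightarrow> ('a \<Rightarrow>\<^sub>C real)"  (infixl \<open>\<circ>\<^sub>C\<close> 55)
  where "\<phi> \<circ>\<^sub>C g = Bcontfun (apply_bcontfun \<phi> \<circ> g)"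

lemma apply_bcontfun_comp:
  assumes "continuous_on UNIV g"
  shows "apply_bcontfun (\<phi> \<circ>\<^sub>C g) = apply_bcontfun \<phi> \<circ> g"
proof -
  have "continuous_on UNIV (apply_bcontfun \<phi> \<circ> g)"
    using assms by (intro continuous_on_compose) auto
  moreover have "bounded (range (apply_bcontfun \<phi> \<circ> g))"
    by (rule bounded_subset[OF bounded_apply_bcontfun[of \<phi>]]) auto
  ultimately show ?thesis
    unfolding bcontfun_comp_def by (intro Bcontfun_inverse) (auto simp: bcontfun_def)
qed

definition nonexpansive_operators ::
    "('a::topological_space \<Rightarrow>\<^sub>C real) set \<Rightarrow> ('a \<Rightarrow> 'a) set \<Rightarrow> (('a \<Rightarrow>\<^sub>C real) \<Rightarrow> ('a \<Rightarrow>\<^sub>C real)) set"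
  where "nonexpansive_operators \<Phi> G = {F \<in> \<Phi> \<rightarrow>\<^sub>E \<Phi>.
    (\<forall>\<phi>\<in>\<Phi>. \<forall>g\<in>G. F (\<phi> \<circ>\<^sub>C g) = F \<phi> \<circ>\<^sub>C g) \<and>
    (\<forall>\<phi>\<^sub>1\<in>\<Phi>. \<forall>\<phi>\<^sub>2\<in>\<Phi>. dist (F \<phi>\<^sub>1) (F \<phi>\<^sub>2) \<le> dist \<phi>\<^sub>1 \<phi>\<^sub>2)}"

definition D_match ::
    "'k::field itself \<Rightarrow> nat \<Rightarrow> (('a::topological_space \<Rightarrow>\<^sub>C real) \<Rightarrow> ('a \<Rightarrow>\<^sub>C real)) set \<Rightarrow>
     ('a \<Rightarrow>\<^sub>C real) \<Rightarrow> ('a \<Rightarrow>\<^sub>C real) \<Rightarrow> ereal"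
  where "D_match K k \<F> \<phi>\<^sub>1 \<phi>\<^sub>2 = (SUP F\<in>\<F>. d_match K k (F \<phi>\<^sub>1) (F \<phi>\<^sub>2))"

section \<open>Strongly invariant pseudo-metrics\<close>

text \<open>
  \<^const>\<open>D_match\<close> is an extended real by construction; that a pseudo-metric is real-valued is therefore
  part of the definition.
\<close>

definition pseudo_metric_on :: "'s set \<Rightarrow> ('s \<Rightarrow> 's \<Rightarrow> ereal) \<Rightarrow> bool"
  where "pseudo_metric_on S d \<longleftrightarrow>
    (\<forall>x\<in>S. \<forall>y\<in>S. 0 \<le> d x y \<and> d x y < \<infinity>) \<and>
    (\<forall>x\<in>S. d x x = 0) \<and>
    (\<forall>x\<in>S. \<forall>y\<in>S. d x y = d y x) \<and>
    (\<forall>x\<in>S. \<forall>y\<in>S. \<forall>z\<in>S. d x z \<le> d x y + d y z)"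

definition strongly_invariant ::
    "('a::topological_space \<Rightarrow>\<^sub>C real) set \<Rightarrow> ('a \<Rightarrow> 'a) set \<Rightarrow>
     (('a \<Rightarrow>\<^sub>C real) \<Rightarrow> ('a \<Rightarrow>\<^sub>C real) \<Rightarrow> ereal) \<Rightarrow> bool"
  where "strongly_invariant \<Phi> G d \<longleftrightarrow> (\<forall>\<phi>\<^sub>1\<in>\<Phi>. \<forall>\<phi>\<^sub>2\<in>\<Phi>. \<forall>g\<in>G.
    d \<phi>\<^sub>1 \<phi>\<^sub>2 = d (\<phi>\<^sub>1 \<circ>\<^sub>C g) \<phi>\<^sub>2 \<and>
    d \<phi>\<^sub>1 \<phi>\<^sub>2 = d \<phi>\<^sub>1 (\<phi>\<^sub>2 \<circ>\<^sub>C g) \<and>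
    d \<phi>\<^sub>1 \<phi>\<^sub>2 = d (\<phi>\<^sub>1 \<circ>\<^sub>C g) (\<phi>\<^sub>2 \<circ>\<^sub>C g))"

end

theory Submission
  imports Defs
begin

text \<open>
  Everything except finiteness is formal: the bottleneck distance is an extended pseudo-metric,
  because bijections of diagrams can be inverted and composed, and persistence diagrams do not see
  homeomorphisms.

  For finiteness a weak form of stability suffices: if the distance of \<open>\<phi>\<close> and \<open>\<psi>\<close> is less than
  \<open>\<epsilon>\<close>, then their diagrams have bottleneck distance at most \<open>6 \<epsilon>\<close>. For levels \<open>t\<^sub>j = \<alpha> + j \<epsilon>\<close> the sets
  \<open>{\<phi> \<le> t\<^sub>j}\<close> for even \<open>j\<close> and \<open>{\<psi> \<le> t\<^sub>j}\<close> for odd \<open>j\<close> form a single increasing chain. The rank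
  differences of this chain count the points of both diagrams in the cells of two grids of mesh
  \<open>2 \<epsilon>\<close>, shifted against each other by \<open>\<epsilon>\<close>, so the points away from the diagonal can be matched
  cell by cell; \<open>\<alpha>\<close> is chosen such that no point lies on a grid line.

  The ranks involved are finite: the space embeds into a Euclidean space as a neighbourhood
  retract, so after subdivision each simplex of a cycle can be replaced by an affine one with vertices in a
  finite net, without leaving a slightly larger sublevel set.
\<close>

section \<open>Counting the points of a persistence diagram\<close>

text \<open>A sublevel set of a continuous function can have infinite-dimensional homology; only the
  passage to a strictly higher level has finite rank. This shapes the proof: the module dimension is
  a \<open>LEAST\<close> and the multiplicities are \<open>THE\<close> values of limits, so nothing
  can be computed from them before finiteness is known, and the interleaved chain needs
  \<open>dist \<phi> \<psi> < \<epsilon>\<close> strictly, to leave a gap between consecutive sets.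
  The bound is wanted only up to a constant. As operators are non-expansive, one bound in terms of
  \<open>dist \<phi> \<psi>\<close> serves all of them, and the supremum is finite. Infinitely many
  points may accumulate at the diagonal, so the two diagrams are not matched by one bijection at
  once. Points with death minus birth at least \<open>6 * \<epsilon>\<close> are injected into the
  other diagram, the others are sent to spare copies of diagonal points. This is done in both
  directions, and a Cantor-Bernstein argument joins the two injections; every pair that it matches
  is already matched by one of them, so the bound survives.\<close>

lemma open_interval_avoiding_finite:
  fixes x y :: real
  assumes "x < y" "finite S"
  obtains e where "x < e" "e < y" "e \<notin> S"
proof -
  have "infinite ({x<..<y} - S)"
    using assms by (intro Diff_infinite_finite) (auto simp: infinite_Ioo)
  then obtain e where "e \<in> {x<..<y} - S"
    by (metis finite.emptyI ex_in_conv)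
  then show ?thesis using that by auto
qed

text \<open>Two distinct points differ in a coordinate. A line between them that avoids the finitely
  many coordinates in use splits both the set and the rectangle, and each half has lost a point.
  This is the induction for statements that are additive over rectangles.\<close>

lemma plane_split_induct [consumes 4, case_names empty singleton birth death]:
  fixes S :: "(real \<times> real) set"
  assumes "finite S" "S \<subseteq> {a<..<b} \<times> {c<..<d}" "a \<le> b" "c \<le> d"
    and empty: "\<And>a b c d. \<lbrakk>a \<le> b; c \<le> d\<rbrakk> \<Longrightarrow> P {} a b c d"
    and singleton: "\<And>u v a b c d. \<lbrakk>a < u; u < b; c < v; v < d\<rbrakk> \<Longrightarrow> P {(u, v)} a b c d"
    and birth: "\<And>S1 S2 a e b c d. \<lbrakk>finite S1; finite S2; S1 \<subseteq> {a<..<e} \<times> {c<..<d}; S2 \<subseteq> {e<..<b} \<times> {c<..<d};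
      a < e; e < b; c \<le> d; P S1 a e c d; P S2 e b c d\<rbrakk> \<Longrightarrow> P (S1 \<union> S2) a b c d"
    and death: "\<And>S1 S2 a b c e d. \<lbrakk>finite S1; finite S2; S1 \<subseteq> {a<..<b} \<times> {c<..<e}; S2 \<subseteq> {a<..<b} \<times> {e<..<d};
      c < e; e < d; a \<le> b; P S1 a b c e; P S2 a b e d\<rbrakk> \<Longrightarrow> P (S1 \<union> S2) a b c d"
  shows "P S a b c d"
  using assms(1-4)
proof (induction "card S" arbitrary: S a b c d rule: less_induct)
  case less
  have smaller: "S1 = {x\<in>S. Q x} \<Longrightarrow> p \<in> S \<Longrightarrow> \<not> Q p \<Longrightarrow> card S1 < card S" for S1 Q p
    using less.prems(1) by (auto intro!: psubset_card_mono)
  consider "S = {}" | u v where "S = {(u, v)}" | p q where "p \<in> S" "q \<in> S" "fst p < fst q"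
    | p q where "p \<in> S" "q \<in> S" "snd p < snd q"
  proof (cases "\<exists>p. S \<subseteq> {p}")
    case True
    then show ?thesis using that by (metis subset_singletonD surj_pair)
  next
    case False
    then obtain p q where "p \<in> S" "q \<in> S" "p \<noteq> q" by blast
    then show ?thesis using that(3,4) by (metis linorder_neqE_linordered_idom prod_eqI)
  qed
  then show ?case
  proof cases
    case 1
    then show ?thesis using less.prems empty by simp
  next
    case 2
    then show ?thesis using less.prems singleton by simp
  next
    case (3 p q)
    obtain e where e: "fst p < e" "e < fst q" "e \<notin> fst ` S"
      using open_interval_avoiding_finite[OF 3(3), of "fst ` S"] less.prems(1) by blast
    define S1 where "S1 = {x\<in>S. fst x < e}"
    define S2 where "S2 = {x\<in>S. e < fst x}"
    have S: "S = S1 \<union> S2" using e(3) unfolding S1_def S2_def by (force simp: image_iff)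
    have ab: "a < e" "e < b" using 3 e less.prems(2) by force+
    have sub: "S1 \<subseteq> {a<..<e} \<times> {c<..<d}" "S2 \<subseteq> {e<..<b} \<times> {c<..<d}" "finite S1" "finite S2"
      using less.prems(1,2) by (auto simp: S1_def S2_def)
    have "card S1 < card S" "card S2 < card S"
      using smaller[OF S1_def 3(2)] smaller[OF S2_def 3(1)] e by auto
    then have "P S1 a e c d" "P S2 e b c d"
      using sub ab less.prems(4) by (auto intro!: less.hyps)
    then show ?thesis unfolding S using sub ab less.prems(4) by (intro birth)
  next
    case (4 p q)
    obtain e where e: "snd p < e" "e < snd q" "e \<notin> snd ` S"
      using open_interval_avoiding_finite[OF 4(3), of "snd ` S"] less.prems(1) by blast
    define S1 where "S1 = {x\<in>S. snd x < e}"
    define S2 where "S2 = {x\<in>S. e < snd x}"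
    have S: "S = S1 \<union> S2" using e(3) unfolding S1_def S2_def by (force simp: image_iff)
    have cd: "c < e" "e < d" using 4 e less.prems(2) by force+
    have sub: "S1 \<subseteq> {a<..<b} \<times> {c<..<e}" "S2 \<subseteq> {a<..<b} \<times> {e<..<d}" "finite S1" "finite S2"
      using less.prems(1,2) by (auto simp: S1_def S2_def)
    have "card S1 < card S" "card S2 < card S"
      using smaller[OF S1_def 4(2)] smaller[OF S2_def 4(1)] e by auto
    then have "P S1 a b c e" "P S2 a b e d"
      using sub cd less.prems(3) by (auto intro!: less.hyps)
    then show ?thesis unfolding S using sub cd less.prems(3) by (intro death)
  qed
qed

text \<open>If \<open>r u v\<close> is the rank from level \<open>u\<close> to level
  \<open>v\<close>, the alternating sum counts the classes born between \<open>a\<close> and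
  \<open>b\<close> that die between \<open>c\<close> and \<open>d\<close>. No semicontinuity is
  assumed: integrality and this inequality are enough to localise the counts at points. The
  condition \<open>b < c\<close> keeps the rectangle off the diagonal.\<close>

locale persistence_rank =
  fixes r :: "real \<Rightarrow> real \<Rightarrow> int"
  assumes box_nonneg': "\<lbrakk>a \<le> b; b < c; c \<le> d\<rbrakk> \<Longrightarrow> 0 \<le> r b c - r a c - r b d + r a d"
begin

definition box :: "real \<Rightarrow> real \<Rightarrow> real \<Rightarrow> real \<Rightarrow> int"
  where "box a b c d = r b c - r a c - r b d + r a d"

text \<open>The number of points in a square around \<open>(u, v)\<close> decreases with the square, so its limit is its
  least value.\<close>

definition mult :: "real \<Rightarrow> real \<Rightarrow> nat"
  where "mult u v = (LEAST n. \<exists>s>0. 2 * s < v - u \<and> box (u - s) (u + s) (v - s) (v + s) = int n)"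

definition points :: "(real \<times> real) set"
  where "points = {(u, v). u < v \<and> 0 < mult u v}"

definition point_copies :: "((real \<times> real) \<times> nat) set"
  where "point_copies = {((u, v), i). u < v \<and> i < mult u v}"

lemma box_nonneg: "\<lbrakk>a \<le> b; b < c; c \<le> d\<rbrakk> \<Longrightarrow> 0 \<le> box a b c d"
  unfolding box_def by (rule box_nonneg')

lemma box_split_birth: "box a b c d = box a e c d + box e b c d"
  by (simp add: box_def)

lemma box_split_death: "box a b c d = box a b c e + box a b e d"
  by (simp add: box_def)

text \<open>By additivity the larger rectangle is the smaller one plus four pieces. All of them stay
  above the diagonal because \<open>b' < c'\<close>, so their counts are nonnegative.\<close>

lemma box_mono:
  assumes "a' \<le> a" "a \<le> b" "b \<le> b'" "b' < c'" "c' \<le> c" "c \<le> d" "d \<le> d'"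
  shows "box a b c d \<le> box a' b' c' d'"
proof -
  have "box a' b' c' d' = box a' a c' d' + box a b c' d' + box b b' c' d'"
    by (simp add: box_def)
  moreover have "box a b c' d' = box a b c' c + box a b c d + box a b d d'"
    by (simp add: box_def)
  moreover have "0 \<le> box a' a c' d'" "0 \<le> box b b' c' d'" "0 \<le> box a b c' c" "0 \<le> box a b d d'"
    using assms by (auto intro!: box_nonneg)
  ultimately show ?thesis by linarith
qed

lemma mult_small_squares:
  assumes "u < v"
  obtains s where "0 < s" "2 * s < v - u"
    "\<And>t. \<lbrakk>0 < t; t \<le> s\<rbrakk> \<Longrightarrow> box (u - t) (u + t) (v - t) (v + t) = int (mult u v)"
proof -
  define P where "P n \<longleftrightarrow> (\<exists>s>0. 2 * s < v - u \<and> box (u - s) (u + s) (v - s) (v + s) = int n)" for n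
  define s0 where "s0 = (v - u) / 3"
  have "0 < s0" "2 * s0 < v - u" using assms by (auto simp: s0_def)
  moreover have "0 \<le> box (u - s0) (u + s0) (v - s0) (v + s0)"
    using calculation by (intro box_nonneg) auto
  ultimately have "P (nat (box (u - s0) (u + s0) (v - s0) (v + s0)))"
    unfolding P_def by auto
  then have "P (mult u v)"
    unfolding mult_def P_def[symmetric] by (rule LeastI)
  then obtain s where s: "0 < s" "2 * s < v - u" "box (u - s) (u + s) (v - s) (v + s) = int (mult u v)"
    unfolding P_def by blast
  show ?thesis
  proof
    show "0 < s" "2 * s < v - u" by fact+
    fix t :: real assume t: "0 < t" "t \<le> s"
    have "box (u - t) (u + t) (v - t) (v + t) \<le> box (u - s) (u + s) (v - s) (v + s)"
      using s t by (intro box_mono) auto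
    moreover have nn: "0 \<le> box (u - t) (u + t) (v - t) (v + t)"
      using s t by (intro box_nonneg) auto
    \<comment> \<open>Monotonicity bounds the count of the smaller square from above, leastness of
      \<open>mult\<close> from below.\<close>
    moreover have "mult u v \<le> nat (box (u - t) (u + t) (v - t) (v + t))"
      unfolding mult_def by (rule Least_le) (use s t nn in auto)
    ultimately show "box (u - t) (u + t) (v - t) (v + t) = int (mult u v)"
      using s(3) by linarith
  qed
qed

lemma mult_le_box:
  assumes "a < u" "u < b" "b < c" "c < v" "v < d"
  shows "int (mult u v) \<le> box a b c d"
proof -
  have "u < v" using assms by simp
  then obtain s where s: "0 < s" "2 * s < v - u"
    "\<And>t. \<lbrakk>0 < t; t \<le> s\<rbrakk> \<Longrightarrow> box (u - t) (u + t) (v - t) (v + t) = int (mult u v)"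
    using mult_small_squares by blast
  define t where "t = Min {s, u - a, b - u, v - c, d - v}"
  have t: "0 < t" "t \<le> s" "t \<le> u - a" "t \<le> b - u" "t \<le> v - c" "t \<le> d - v"
    using assms s(1) by (auto simp: t_def)
  have "int (mult u v) = box (u - t) (u + t) (v - t) (v + t)"
    using s(3) t by simp
  also have "\<dots> \<le> box a b c d"
    using t assms by (intro box_mono) auto
  finally show ?thesis .
qed

lemma sum_mult_le_box:
  assumes "finite S" "S \<subseteq> {a<..<b} \<times> {c<..<d}" "a \<le> b" "c \<le> d" "b < c"
  shows "int (\<Sum>p\<in>S. mult (fst p) (snd p)) \<le> box a b c d"
  using assms
proof (induction rule: plane_split_induct)
  case (empty a b c d)
  then show ?case by (auto intro: box_nonneg)
next
  case (singleton u v a b c d)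
  then show ?case by (auto intro: mult_le_box)
next
  case (birth S1 S2 a e b c d)
  have "S1 \<inter> S2 = {}" using birth(3,4) by force
  then show ?case using birth by (simp add: sum.union_disjoint box_split_birth[of a b c d e])
next
  case (death S1 S2 a b c e d)
  have "S1 \<inter> S2 = {}" using death(3,4) by force
  then show ?case using death by (simp add: sum.union_disjoint box_split_death[of a b c d e])
qed

text \<open>Compactness of the closed rectangle: every point has a square with count 0. Bisection in
  the death coordinate yields a strip of count 0 around each vertical segment, and bisection in the
  birth coordinate then combines the strips.\<close>

lemma box_eq_0:
  assumes "a \<le> b" "b < c" "c \<le> d" and zero: "\<And>u v. \<lbrakk>a \<le> u; u \<le> b; c \<le> v; v \<le> d\<rbrakk> \<Longrightarrow> mult u v = 0"
  shows "box a b c d = 0"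
proof -
  have "a \<le> a \<and> b \<le> b \<longrightarrow> box a b c d = 0"
  proof (rule Bolzano[where P="\<lambda>x y. a \<le> x \<and> y \<le> b \<longrightarrow> box x y c d = 0"])
    show "a \<le> b" by fact
  next
    fix x y z assume "a \<le> x \<and> y \<le> b \<longrightarrow> box x y c d = 0" "a \<le> y \<and> z \<le> b \<longrightarrow> box y z c d = 0"
      "x \<le> y" "y \<le> z"
    then show "a \<le> x \<and> z \<le> b \<longrightarrow> box x z c d = 0" using box_split_birth[of x z c d y] by auto
  next
    fix u assume u: "a \<le> u" "u \<le> b"
    \<comment> \<open>Strips of half-width at most \<open>g\<close> around \<open>u \<le> b\<close>
      stay left of \<open>c\<close>, hence above the diagonal.\<close>
    define g where "g = (c - b) / 2"
    have g: "0 < g" "u + g < c" using u assms by (auto simp: g_def field_simps)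
    have "c \<le> c \<and> d \<le> d \<longrightarrow> (\<exists>s>0. s \<le> g \<and> box (u - s) (u + s) c d = 0)"
    proof (rule Bolzano[where P="\<lambda>x y. c \<le> x \<and> y \<le> d \<longrightarrow> (\<exists>s>0. s \<le> g \<and> box (u - s) (u + s) x y = 0)"])
      show "c \<le> d" by fact
    next
      fix x y z assume xy: "c \<le> x \<and> y \<le> d \<longrightarrow> (\<exists>s>0. s \<le> g \<and> box (u - s) (u + s) x y = 0)"
        and yz: "c \<le> y \<and> z \<le> d \<longrightarrow> (\<exists>s>0. s \<le> g \<and> box (u - s) (u + s) y z = 0)"
        and le: "x \<le> y" "y \<le> z"
      show "c \<le> x \<and> z \<le> d \<longrightarrow> (\<exists>s>0. s \<le> g \<and> box (u - s) (u + s) x z = 0)"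
      proof
        assume "c \<le> x \<and> z \<le> d"
        note o = le this
        obtain s where s: "0 < s" "s \<le> g" "box (u - s) (u + s) x y = 0" using xy o by force
        obtain t where t: "0 < t" "t \<le> g" "box (u - t) (u + t) y z = 0" using yz o by force
        \<comment> \<open>The two stacked strips may differ in width; the narrower width works for
          both by monotonicity.\<close>
        define m where "m = min s t"
        have m: "0 < m" "m \<le> s" "m \<le> t" "m \<le> g" using s t by (auto simp: m_def)
        have "box (u - m) (u + m) x y \<le> box (u - s) (u + s) x y"
             "box (u - m) (u + m) y z \<le> box (u - t) (u + t) y z"
             "0 \<le> box (u - m) (u + m) x y" "0 \<le> box (u - m) (u + m) y z"
          using m o s(1,2) t(1,2) g by (auto intro!: box_mono box_nonneg)
        then have "box (u - m) (u + m) x z = 0"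
          using s t box_split_death[of "u - m" "u + m" x z y] by linarith
        then show "\<exists>s>0. s \<le> g \<and> box (u - s) (u + s) x z = 0" using m by blast
      qed
    next
      fix v assume v: "c \<le> v" "v \<le> d"
      then have "u < v" using u assms by simp
      then obtain s where s: "0 < s" "2 * s < v - u"
        "\<And>t. \<lbrakk>0 < t; t \<le> s\<rbrakk> \<Longrightarrow> box (u - t) (u + t) (v - t) (v + t) = int (mult u v)"
        using mult_small_squares by blast
      define m where "m = min s g"
      have m: "0 < m" "m \<le> s" "m \<le> g" using s g by (auto simp: m_def)
      have sq: "box (u - m) (u + m) (v - m) (v + m) = 0"
        using s(3) m zero[of u v] u v by simp
      show "\<exists>e>0. \<forall>x y. x \<le> v \<and> v \<le> y \<and> y - x < e \<longrightarrow>
          c \<le> x \<and> y \<le> d \<longrightarrow> (\<exists>s>0. s \<le> g \<and> box (u - s) (u + s) x y = 0)"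
      proof (rule exI[of _ m], intro conjI allI impI)
        fix x y assume xy: "x \<le> v \<and> v \<le> y \<and> y - x < m" "c \<le> x \<and> y \<le> d"
        have "box (u - m) (u + m) x y \<le> box (u - m) (u + m) (v - m) (v + m)"
             "0 \<le> box (u - m) (u + m) x y"
          using xy m s(1,2) g by (auto intro!: box_mono box_nonneg)
        then show "\<exists>s>0. s \<le> g \<and> box (u - s) (u + s) x y = 0"
          using sq m by (intro exI[of _ m]) auto
      qed (use m in auto)
    qed
    then obtain s where s: "0 < s" "s \<le> g" "box (u - s) (u + s) c d = 0" by blast
    show "\<exists>e>0. \<forall>x y. x \<le> u \<and> u \<le> y \<and> y - x < e \<longrightarrow> a \<le> x \<and> y \<le> b \<longrightarrow> box x y c d = 0"
    proof (intro exI[of _ s] conjI allI impI)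
      fix x y assume xy: "x \<le> u \<and> u \<le> y \<and> y - x < s" "a \<le> x \<and> y \<le> b"
      have "box x y c d \<le> box (u - s) (u + s) c d" "0 \<le> box x y c d"
        using xy s(1,2) g assms(1-3) by (auto intro!: box_mono box_nonneg)
      then show "box x y c d = 0" using s by simp
    qed (use s in auto)
  qed
  then show ?thesis by simp
qed

text \<open>The points lie in the open rectangle, while absence of others is required on the closed
  one, boundary included, because \<open>box_eq_0\<close> is a compactness statement. A rectangle
  with a single point is a small square around it and four rectangles without points.\<close>

lemma box_eq_sum_mult:
  assumes "finite S" "S \<subseteq> {a<..<b} \<times> {c<..<d}" "a \<le> b" "c \<le> d" "b < c"
    and "\<And>u v. \<lbrakk>a \<le> u; u \<le> b; c \<le> v; v \<le> d; (u, v) \<notin> S\<rbrakk> \<Longrightarrow> mult u v = 0"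
  shows "box a b c d = int (\<Sum>p\<in>S. mult (fst p) (snd p))"
  using assms
proof (induction rule: plane_split_induct)
  case (empty a b c d)
  then show ?case by (auto intro: box_eq_0)
next
  case (singleton u v a b c d)
  then have "u < v" by simp
  then obtain s where s: "0 < s" "2 * s < v - u"
    "\<And>t. \<lbrakk>0 < t; t \<le> s\<rbrakk> \<Longrightarrow> box (u - t) (u + t) (v - t) (v + t) = int (mult u v)"
    using mult_small_squares by blast
  define t where "t = Min {s, u - a, b - u, v - c, d - v}"
  have t: "0 < t" "t \<le> s" "t \<le> u - a" "t \<le> b - u" "t \<le> v - c" "t \<le> d - v"
    using singleton(1-4) s(1) by (auto simp: t_def)
  have z: "mult x y = 0" if "a \<le> x" "x \<le> b" "c \<le> y" "y \<le> d" "x \<noteq> u \<or> y \<noteq> v" for x y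
    using singleton(6)[of x y] that by auto
  have "box a (u - t) c d = 0" "box (u + t) b c d = 0"
    "box (u - t) (u + t) c (v - t) = 0" "box (u - t) (u + t) (v + t) d = 0"
    using t singleton(1-5) by (auto intro!: box_eq_0 z)
  moreover have "box a b c d = box a (u - t) c d + box (u + t) b c d + box (u - t) (u + t) c (v - t)
      + box (u - t) (u + t) (v + t) d + box (u - t) (u + t) (v - t) (v + t)"
    by (simp add: box_def)
  ultimately show ?case using s(3) t by simp
next
  case (birth S1 S2 a e b c d)
  have "S1 \<inter> S2 = {}" using birth(3,4) by force
  moreover have "box a e c d = int (\<Sum>p\<in>S1. mult (fst p) (snd p))"
    using birth(4,6,10) by (intro birth(8) birth(11)) auto
  moreover have "box e b c d = int (\<Sum>p\<in>S2. mult (fst p) (snd p))"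
    using birth(3,5,10) by (intro birth(9) birth(11)) auto
  ultimately show ?case using birth(1,2) by (simp add: sum.union_disjoint box_split_birth[of a b c d e])
next
  case (death S1 S2 a b c e d)
  have "S1 \<inter> S2 = {}" using death(3,4) by force
  moreover have "box a b c e = int (\<Sum>p\<in>S1. mult (fst p) (snd p))"
    using death(4,6,10) by (intro death(8) death(11)) auto
  moreover have "box a b e d = int (\<Sum>p\<in>S2. mult (fst p) (snd p))"
    using death(3,5,10) by (intro death(9) death(11)) auto
  ultimately show ?case using death(1,2) by (simp add: sum.union_disjoint box_split_death[of a b c d e])
qed

text \<open>The count of a slightly larger rectangle, still off the diagonal since \<open>s\<close>
  is a third of the gap, bounds the size of every finite subset.\<close>

lemma finite_points_in_box:
  assumes "b < c"
  shows "finite (points \<inter> {a..b} \<times> {c..d})"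
proof (cases "a \<le> b \<and> c \<le> d")
  case True
  define s where "s = (c - b) / 3"
  have s: "0 < s" "b + s < c - s" using assms by (auto simp: s_def field_simps)
  show ?thesis
  proof (rule conjunct1[OF finite_if_finite_subsets_card_bdd[where C = "nat (box (a - s) (b + s) (c - s) (d + s))"]])
    fix S assume S: "S \<subseteq> points \<inter> {a..b} \<times> {c..d}" "finite S"
    have "card S = (\<Sum>p\<in>S. 1)" by simp
    also have "\<dots> \<le> (\<Sum>p\<in>S. mult (fst p) (snd p))"
      using S by (intro sum_mono) (auto simp: points_def Suc_le_eq)
    finally have "int (card S) \<le> int (\<Sum>p\<in>S. mult (fst p) (snd p))" by (simp del: of_nat_sum)
    also have "\<dots> \<le> box (a - s) (b + s) (c - s) (d + s)"
      using S s True by (intro sum_mult_le_box) (auto simp: subset_iff, force+)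
    finally show "card S \<le> nat (box (a - s) (b + s) (c - s) (d + s))" by simp
  qed
qed (auto simp: not_le intro: finite_subset[of _ "{}"])

text \<open>Points can accumulate only at the diagonal or at infinity. A rational between birth and
  death separates a point from the diagonal, so countably many rectangles, each with finitely many
  points, suffice. Countability is needed later to choose a generic grid and to number the points
  that are sent to the diagonal.\<close>

lemma countable_points: "countable points"
proof -
  have "points \<subseteq> (\<Union>q::rat. \<Union>n::nat. points \<inter>
      {- real n..of_rat q - inverse (real (Suc n))} \<times> {of_rat q + inverse (real (Suc n))..real n})"
  proof
    fix p assume p: "p \<in> points"
    obtain u v where uv: "p = (u, v)" "u < v" using p by (auto simp: points_def)
    obtain q where q: "u < of_rat q" "of_rat q < v" using of_rat_dense[OF uv(2)] by blast
    obtain n1 where n1: "inverse (real (Suc n1)) < of_rat q - u" using reals_Archimedean q(1) by (metis diff_gt_0_iff_gt)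
    obtain n2 where n2: "inverse (real (Suc n2)) < v - of_rat q" using reals_Archimedean q(2) by (metis diff_gt_0_iff_gt)
    obtain n3 where n3: "\<bar>u\<bar> \<le> real n3" using real_arch_simple by blast
    obtain n4 where n4: "\<bar>v\<bar> \<le> real n4" using real_arch_simple by blast
    define n where "n = Max {n1, n2, n3, n4}"
    have n: "n1 \<le> n" "n2 \<le> n" "n3 \<le> n" "n4 \<le> n" by (auto simp: n_def)
    have "inverse (real (Suc n)) \<le> inverse (real (Suc n1))" "inverse (real (Suc n)) \<le> inverse (real (Suc n2))"
      using n by (auto simp: le_imp_inverse_le)
    then have "u \<le> of_rat q - inverse (real (Suc n))" "of_rat q + inverse (real (Suc n)) \<le> v"
      using n1 n2 by linarith+
    moreover have "- real n \<le> u" "v \<le> real n" using n n3 n4 by linarith+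
    ultimately have "p \<in> points \<inter> {- real n..of_rat q - inverse (real (Suc n))}
        \<times> {of_rat q + inverse (real (Suc n))..real n}"
      using p uv(1) by (simp del: of_nat_Suc)
    then show "p \<in> (\<Union>q::rat. \<Union>n::nat. points \<inter>
      {- real n..of_rat q - inverse (real (Suc n))} \<times> {of_rat q + inverse (real (Suc n))..real n})" by blast
  qed
  moreover have "countable (points \<inter> {- real n..of_rat q - inverse (real (Suc n))}
      \<times> {of_rat q + inverse (real (Suc n))..real n})" for q :: rat and n :: nat
  proof (intro countable_finite finite_points_in_box)
    have "0 < inverse (real (Suc n))" by simp
    then show "real_of_rat q - inverse (real (Suc n)) < real_of_rat q + inverse (real (Suc n))" by linarith
  qed
  ultimately show ?thesis by (meson countable_UN countable_subset countableI_type)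
qed

lemma countable_point_copies: "countable point_copies"
proof -
  have "point_copies \<subseteq> points \<times> UNIV" by (auto simp: point_copies_def points_def)
  then show ?thesis using countable_points by (meson countable_SIGMA countableI_type countable_subset)
qed

lemma card_point_copies_in_box:
  assumes "a \<le> b" "b < c" "c \<le> d"
    and "\<And>u v. (u, v) \<in> points \<Longrightarrow> u \<noteq> a \<and> u \<noteq> b \<and> v \<noteq> c \<and> v \<noteq> d"
  shows "finite {(p, i) \<in> point_copies. p \<in> {a..b} \<times> {c..d}}"
    and "int (card {(p, i) \<in> point_copies. p \<in> {a..b} \<times> {c..d}}) = box a b c d"
proof -
  define S where "S = points \<inter> {a..b} \<times> {c..d}"
  have fin: "finite S" unfolding S_def by (rule finite_points_in_box) fact
  have S: "S \<subseteq> {a<..<b} \<times> {c<..<d}" using assms(4) by (force simp: S_def)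
  have "box a b c d = int (\<Sum>p\<in>S. mult (fst p) (snd p))"
    using assms by (intro box_eq_sum_mult fin S) (auto simp: S_def points_def)
  moreover have eq: "{(p, i) \<in> point_copies. p \<in> {a..b} \<times> {c..d}} = (SIGMA p:S. {..<mult (fst p) (snd p)})"
    using assms by (auto simp: S_def points_def point_copies_def)
  ultimately show "int (card {(p, i) \<in> point_copies. p \<in> {a..b} \<times> {c..d}}) = box a b c d"
    using fin by simp
  show "finite {(p, i) \<in> point_copies. p \<in> {a..b} \<times> {c..d}}"
    unfolding eq using fin by auto
qed

end


subsection \<open>Cells of a grid\<close>

text \<open>The functions \<open>k\<close> and \<open>l\<close> recover the index of the piece,
  which makes both families disjoint. The second conclusion records that the glued map preserves
  this index; it is what later bounds the displacement of points.\<close>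

lemma bij_betw_glue:
  assumes "\<And>c. c \<in> C \<Longrightarrow> bij_betw (f c) (A c) (B c)"
    and "\<And>c x. c \<in> C \<Longrightarrow> x \<in> A c \<Longrightarrow> k x = c"
    and "\<And>c y. c \<in> C \<Longrightarrow> y \<in> B c \<Longrightarrow> l y = c"
  shows "bij_betw (\<lambda>x. f (k x) x) (\<Union>c\<in>C. A c) (\<Union>c\<in>C. B c)"
    and "\<And>x. x \<in> (\<Union>c\<in>C. A c) \<Longrightarrow> l (f (k x) x) = k x"
proof -
  have f: "f (k x) x \<in> B c" "l (f (k x) x) = c" "k x = c" if "c \<in> C" "x \<in> A c" for c x
    using assms(2,3) bij_betwE[OF assms(1)[OF that(1)]] that by blast+
  then show "l (f (k x) x) = k x" if "x \<in> (\<Union>c\<in>C. A c)" for x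
    using that by auto
  show "bij_betw (\<lambda>x. f (k x) x) (\<Union>c\<in>C. A c) (\<Union>c\<in>C. B c)"
    unfolding bij_betw_def
  proof
    show "inj_on (\<lambda>x. f (k x) x) (\<Union>c\<in>C. A c)"
    proof (rule inj_onI)
      fix x y assume "x \<in> (\<Union>c\<in>C. A c)" "y \<in> (\<Union>c\<in>C. A c)" and eq: "f (k x) x = f (k y) y"
      then obtain c d where c: "c \<in> C" "x \<in> A c" "d \<in> C" "y \<in> A d" by blast
      then have "c = d" using f eq by metis
      then show "x = y"
        using c eq f(3) assms(1)[of c] by (auto simp: bij_betw_def inj_on_def)
    qed
    show "(\<lambda>x. f (k x) x) ` (\<Union>c\<in>C. A c) = (\<Union>c\<in>C. B c)"
    proof
      show "(\<lambda>x. f (k x) x) ` (\<Union>c\<in>C. A c) \<subseteq> (\<Union>c\<in>C. B c)" using f by blast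
      show "(\<Union>c\<in>C. B c) \<subseteq> (\<lambda>x. f (k x) x) ` (\<Union>c\<in>C. A c)"
      proof
        fix y assume "y \<in> (\<Union>c\<in>C. B c)"
        then obtain c where c: "c \<in> C" "y \<in> B c" by blast
        then obtain x where "x \<in> A c" "y = f c x" using assms(1)[of c] by (auto simp: bij_betw_def)
        then show "y \<in> (\<lambda>x. f (k x) x) ` (\<Union>c\<in>C. A c)" using c f(3) by (auto intro!: image_eqI[of _ _ x])
      qed
    qed
  qed
qed

definition grid_cell :: "real \<Rightarrow> real \<Rightarrow> real \<Rightarrow> int"
  where "grid_cell \<alpha> \<epsilon> x = \<lceil>(x - \<alpha>) / (2 * \<epsilon>)\<rceil>"

lemma grid_cell_eq_iff:
  assumes "0 < \<epsilon>"
  shows "grid_cell \<alpha> \<epsilon> x = a \<longleftrightarrow> \<alpha> + (2 * of_int a - 2) * \<epsilon> < x \<and> x \<le> \<alpha> + 2 * of_int a * \<epsilon>"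
proof -
  have "grid_cell \<alpha> \<epsilon> x = a \<longleftrightarrow> of_int a - 1 < (x - \<alpha>) / (2 * \<epsilon>) \<and> (x - \<alpha>) / (2 * \<epsilon>) \<le> of_int a"
    unfolding grid_cell_def by (rule ceiling_eq_iff)
  also have "\<dots> \<longleftrightarrow> (of_int a - 1) * (2 * \<epsilon>) < x - \<alpha> \<and> x - \<alpha> \<le> of_int a * (2 * \<epsilon>)"
    using assms by (simp add: pos_less_divide_eq pos_divide_le_eq)
  finally show ?thesis by (simp add: algebra_simps)
qed

text \<open>The number of classes of a chain of spaces indexed by integers that are born at step
  \<open>i\<close> and die at step \<open>j\<close>, where \<open>R i j\<close> is the rank from the
  \<open>i\<close>-th to the \<open>j\<close>-th space.\<close>

definition grid_rank :: "(int \<Rightarrow> int \<Rightarrow> int) \<Rightarrow> int \<Rightarrow> int \<Rightarrow> int"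
  where "grid_rank R i j = R i (j - 1) - R (i - 1) (j - 1) - R i j + R (i - 1) j"

context persistence_rank
begin

text \<open>Since \<open>r\<close> describes only the even members of the chain, a cell of mesh
  \<open>2 * \<epsilon>\<close> corresponds to a block of two by two steps:
  \<open>(i + 1) div 2 = a\<close> means that \<open>i\<close> is \<open>2 * a - 1\<close> or
  \<open>2 * a\<close>. The four grid ranks of a block telescope to the count of the cell, so both
  sides have the same finite cardinality. Cells with \<open>a < b - 1\<close> are those separated
  from the diagonal.\<close>

lemma bij_point_copies_grid:
  assumes "0 < \<epsilon>"
    and generic: "\<And>u v k. (u, v) \<in> points \<Longrightarrow> u \<noteq> \<alpha> + of_int k * \<epsilon> \<and> v \<noteq> \<alpha> + of_int k * \<epsilon>"
    and R: "\<And>a b. R (2 * a) (2 * b) = r (\<alpha> + of_int (2 * a) * \<epsilon>) (\<alpha> + of_int (2 * b) * \<epsilon>)"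
    and nonneg: "\<And>i j. i < j - 1 \<Longrightarrow> 0 \<le> grid_rank R i j"
  obtains f where
    "bij_betw f {(p, k) \<in> point_copies. grid_cell \<alpha> \<epsilon> (fst p) < grid_cell \<alpha> \<epsilon> (snd p) - 1}
       {((i, j), k :: nat). (i + 1) div 2 < (j + 1) div 2 - 1 \<and> int k < grid_rank R i j}"
    "\<And>u v m i j k. \<lbrakk>((u, v), m) \<in> point_copies; grid_cell \<alpha> \<epsilon> u < grid_cell \<alpha> \<epsilon> v - 1;
       f ((u, v), m) = ((i, j), k)\<rbrakk>
      \<Longrightarrow> (i + 1) div 2 = grid_cell \<alpha> \<epsilon> u \<and> (j + 1) div 2 = grid_cell \<alpha> \<epsilon> v"
proof -
  define A where "A = (\<lambda>(a, b). {(p, k) \<in> point_copies. grid_cell \<alpha> \<epsilon> (fst p) = a \<and> grid_cell \<alpha> \<epsilon> (snd p) = b})"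
  \<comment> \<open>The number \<open>k\<close> distinguishes the classes with the same birth and
    death step.\<close>
  define B where "B = (\<lambda>(a, b). {((i, j), k :: nat). (i + 1) div 2 = a \<and> (j + 1) div 2 = b \<and> int k < grid_rank R i j})"
  have "\<exists>f. bij_betw f (A c) (B c)" if c: "c \<in> {(a, b). a < b - 1}" for c
  proof -
    obtain a b where ab: "c = (a, b)" "a < b - 1" using c by auto
    let ?x = "\<lambda>a. \<alpha> + of_int (2 * a) * \<epsilon>"
    have mono: "?x i \<le> ?x j" if "i \<le> j" for i j using that \<open>0 < \<epsilon>\<close> by (simp add: mult_right_mono)
    have smono: "?x i < ?x j" if "i < j" for i j using that \<open>0 < \<epsilon>\<close> by simp
    have gen: "u \<noteq> ?x (a - 1) \<and> u \<noteq> ?x a \<and> v \<noteq> ?x (b - 1) \<and> v \<noteq> ?x b" if "(u, v) \<in> points" for u v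
      using generic[OF that] by blast
    have "A c = {(p, i) \<in> point_copies. p \<in> {?x (a - 1)..?x a} \<times> {?x (b - 1)..?x b}}" (is "_ = ?A")
    proof -
      have "grid_cell \<alpha> \<epsilon> u = a \<and> grid_cell \<alpha> \<epsilon> v = b \<longleftrightarrow> u \<in> {?x (a - 1)..?x a} \<and> v \<in> {?x (b - 1)..?x b}"
        if "((u, v), i) \<in> point_copies" for u v i
      proof -
        have "(u, v) \<in> points" using that by (auto simp: points_def point_copies_def)
        \<comment> \<open>The cells are half-open and the rectangles closed; for generic points this
          makes no difference.\<close>
        then have "u \<noteq> ?x (a - 1)" "v \<noteq> ?x (b - 1)" using gen by blast+
        moreover have "?x (a - 1) = \<alpha> + (2 * of_int a - 2) * \<epsilon>" "?x a = \<alpha> + 2 * of_int a * \<epsilon>"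
          "?x (b - 1) = \<alpha> + (2 * of_int b - 2) * \<epsilon>" "?x b = \<alpha> + 2 * of_int b * \<epsilon>" by simp_all
        ultimately show ?thesis
          unfolding grid_cell_eq_iff[OF \<open>0 < \<epsilon>\<close>] by force
      qed
      then show ?thesis unfolding A_def ab(1) by fastforce
    qed
    moreover have "?x (a - 1) \<le> ?x a" "?x a < ?x (b - 1)" "?x (b - 1) \<le> ?x b"
      using mono[of "a - 1" a] mono[of "b - 1" b] smono[of a "b - 1"] ab(2) by linarith+
    then have "finite ?A" "int (card ?A) = box (?x (a - 1)) (?x a) (?x (b - 1)) (?x b)"
      using card_point_copies_in_box[OF _ _ _ gen] by blast+
    moreover have "finite (B c)" "int (card (B c)) = box (?x (a - 1)) (?x a) (?x (b - 1)) (?x b)"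
    proof -
      have B: "B c = (SIGMA q:{2 * a - 1, 2 * a} \<times> {2 * b - 1, 2 * b}. {..<nat (grid_rank R (fst q) (snd q))})"
        unfolding B_def ab(1) by auto
      show "finite (B c)" unfolding B by auto
      have pos: "0 \<le> grid_rank R (2 * a - 1) (2 * b - 1)" "0 \<le> grid_rank R (2 * a) (2 * b - 1)"
        "0 \<le> grid_rank R (2 * a - 1) (2 * b)" "0 \<le> grid_rank R (2 * a) (2 * b)"
        using ab by (auto intro!: nonneg)
      have "card (B c) = (\<Sum>q\<in>{2 * a - 1, 2 * a} \<times> {2 * b - 1, 2 * b}. nat (grid_rank R (fst q) (snd q)))"
        unfolding B by simp
      also have "\<dots> = (\<Sum>i\<in>{2 * a - 1, 2 * a}. \<Sum>j\<in>{2 * b - 1, 2 * b}. nat (grid_rank R i j))"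
        by (simp add: sum.cartesian_product case_prod_unfold)
      also have "int \<dots> = grid_rank R (2 * a - 1) (2 * b - 1) + grid_rank R (2 * a) (2 * b - 1)
          + grid_rank R (2 * a - 1) (2 * b) + grid_rank R (2 * a) (2 * b)"
        using pos by simp
      also have "\<dots> = R (2 * a) (2 * (b - 1)) - R (2 * (a - 1)) (2 * (b - 1)) - R (2 * a) (2 * b) + R (2 * (a - 1)) (2 * b)"
        by (simp add: grid_rank_def)
      finally show "int (card (B c)) = box (?x (a - 1)) (?x a) (?x (b - 1)) (?x b)"
        unfolding R box_def .
    qed
    ultimately show ?thesis
      by (intro finite_same_card_bij) (auto simp flip: of_nat_eq_iff[where 'a = int])
  qed
  then obtain F where F: "\<And>c. c \<in> {(a, b). a < b - 1} \<Longrightarrow> bij_betw (F c) (A c) (B c)"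
    by metis
  define k where "k = (\<lambda>(p :: real \<times> real, _ :: nat). (grid_cell \<alpha> \<epsilon> (fst p), grid_cell \<alpha> \<epsilon> (snd p)))"
  define l where "l = (\<lambda>((i :: int, j :: int), _ :: nat). ((i + 1) div 2, (j + 1) div 2))"
  note glue = bij_betw_glue[OF F, where k = k and l = l]
  have k: "k x = c" if "x \<in> A c" for x c using that by (auto simp: A_def k_def)
  have l: "l x = c" if "x \<in> B c" for x c using that by (auto simp: B_def l_def)
  have UA: "(\<Union>c\<in>{(a, b). a < b - 1}. A c)
      = {(p, k) \<in> point_copies. grid_cell \<alpha> \<epsilon> (fst p) < grid_cell \<alpha> \<epsilon> (snd p) - 1}"
    by (auto simp: A_def)
  have UB: "(\<Union>c\<in>{(a, b). a < b - 1}. B c)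
      = {((i, j), k :: nat). (i + 1) div 2 < (j + 1) div 2 - 1 \<and> int k < grid_rank R i j}"
    by (auto simp: B_def)
  show ?thesis
  proof
    show "bij_betw (\<lambda>x. F (k x) x) {(p, k) \<in> point_copies. grid_cell \<alpha> \<epsilon> (fst p) < grid_cell \<alpha> \<epsilon> (snd p) - 1}
       {((i, j), k :: nat). (i + 1) div 2 < (j + 1) div 2 - 1 \<and> int k < grid_rank R i j}"
      unfolding UA[symmetric] UB[symmetric] by (rule glue(1)) (use k l in blast)+
    fix u v m i j n assume *: "((u, v), m) \<in> point_copies" "grid_cell \<alpha> \<epsilon> u < grid_cell \<alpha> \<epsilon> v - 1"
       "F (k ((u, v), m)) ((u, v), m) = ((i, j), n)"
    then have "((u, v), m) \<in> (\<Union>c\<in>{(a, b). a < b - 1}. A c)" unfolding UA by auto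
    then have "l (F (k ((u, v), m)) ((u, v), m)) = k ((u, v), m)"
      by (intro glue(2)) (use k l in blast)+
    then show "(i + 1) div 2 = grid_cell \<alpha> \<epsilon> u \<and> (j + 1) div 2 = grid_cell \<alpha> \<epsilon> v"
      unfolding *(3) by (auto simp: l_def k_def)
  qed
qed

end

text \<open>Both diagrams are compared with the same set of classes of the chain: copies of points
  of \<open>r\<close> go to classes, and these go back to copies of points of \<open>r'\<close>.
  Each map moves a point only within a cell of its own grid. The even grid and the odd grid overlap,
  and two cells that share a step together span an interval of length
  \<open>3 * \<epsilon>\<close>.\<close>

lemma interleaved_point_copies:
  assumes "persistence_rank r" "persistence_rank r'" "0 < \<epsilon>"
    and gen: "\<And>u v k. (u, v) \<in> persistence_rank.points r \<Longrightarrow> u \<noteq> \<alpha> + of_int k * \<epsilon> \<and> v \<noteq> \<alpha> + of_int k * \<epsilon>"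
    and gen': "\<And>u v k. (u, v) \<in> persistence_rank.points r' \<Longrightarrow> u \<noteq> \<alpha> + of_int k * \<epsilon> \<and> v \<noteq> \<alpha> + of_int k * \<epsilon>"
    and R: "\<And>a b. R (2 * a) (2 * b) = r (\<alpha> + of_int (2 * a) * \<epsilon>) (\<alpha> + of_int (2 * b) * \<epsilon>)"
    and R': "\<And>a b. R (2 * a + 1) (2 * b + 1) = r' (\<alpha> + of_int (2 * a + 1) * \<epsilon>) (\<alpha> + of_int (2 * b + 1) * \<epsilon>)"
    and nonneg: "\<And>i j. i < j - 1 \<Longrightarrow> 0 \<le> grid_rank R i j"
  obtains f where
    "inj_on f {((u, v), k) \<in> persistence_rank.point_copies r. 6 * \<epsilon> \<le> v - u}"
    "\<And>u v k. \<lbrakk>((u, v), k) \<in> persistence_rank.point_copies r; 6 * \<epsilon> \<le> v - u\<rbrakk>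
      \<Longrightarrow> \<exists>u' v' k'. f ((u, v), k) = ((u', v'), k') \<and> ((u', v'), k') \<in> persistence_rank.point_copies r' \<and>
          \<bar>u - u'\<bar> \<le> 3 * \<epsilon> \<and> \<bar>v - v'\<bar> \<le> 3 * \<epsilon>"
proof -
  interpret A: persistence_rank r by fact
  interpret B: persistence_rank r' by fact
  obtain f where f: "bij_betw f {(p, k) \<in> A.point_copies. grid_cell \<alpha> \<epsilon> (fst p) < grid_cell \<alpha> \<epsilon> (snd p) - 1}
       {((i, j), k :: nat). (i + 1) div 2 < (j + 1) div 2 - 1 \<and> int k < grid_rank R i j}"
    "\<And>u v m i j k. \<lbrakk>((u, v), m) \<in> A.point_copies; grid_cell \<alpha> \<epsilon> u < grid_cell \<alpha> \<epsilon> v - 1;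
       f ((u, v), m) = ((i, j), k)\<rbrakk>
      \<Longrightarrow> (i + 1) div 2 = grid_cell \<alpha> \<epsilon> u \<and> (j + 1) div 2 = grid_cell \<alpha> \<epsilon> v"
    using A.bij_point_copies_grid[where \<alpha> = \<alpha> and \<epsilon> = \<epsilon> and R = R] gen R nonneg \<open>0 < \<epsilon>\<close> by blast
  \<comment> \<open>The shift by one makes the odd members of the chain even ones, so that the
    preceding lemma applies to \<open>r'\<close> with origin
    \<open>\<alpha> + \<epsilon>\<close>.\<close>
  define Q where "Q i j = R (i + 1) (j + 1)" for i j
  have Q: "grid_rank Q i j = grid_rank R (i + 1) (j + 1)" for i j by (simp add: Q_def grid_rank_def)
  have "\<exists>f. bij_betw f {(p, k) \<in> B.point_copies. grid_cell (\<alpha> + \<epsilon>) \<epsilon> (fst p) < grid_cell (\<alpha> + \<epsilon>) \<epsilon> (snd p) - 1}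
       {((i, j), k :: nat). (i + 1) div 2 < (j + 1) div 2 - 1 \<and> int k < grid_rank Q i j} \<and>
    (\<forall>u v m i j k. ((u, v), m) \<in> B.point_copies \<longrightarrow> grid_cell (\<alpha> + \<epsilon>) \<epsilon> u < grid_cell (\<alpha> + \<epsilon>) \<epsilon> v - 1 \<longrightarrow>
       f ((u, v), m) = ((i, j), k)
      \<longrightarrow> (i + 1) div 2 = grid_cell (\<alpha> + \<epsilon>) \<epsilon> u \<and> (j + 1) div 2 = grid_cell (\<alpha> + \<epsilon>) \<epsilon> v)"
  proof (rule B.bij_point_copies_grid[where \<alpha> = "\<alpha> + \<epsilon>" and \<epsilon> = \<epsilon> and R = Q])
    show "0 < \<epsilon>" by fact
    fix u v and k :: int assume "(u, v) \<in> B.points"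
    then show "u \<noteq> \<alpha> + \<epsilon> + of_int k * \<epsilon> \<and> v \<noteq> \<alpha> + \<epsilon> + of_int k * \<epsilon>"
      using gen'[of u v "k + 1"] by (simp add: algebra_simps)
  next
    fix a b show "Q (2 * a) (2 * b) = r' (\<alpha> + \<epsilon> + of_int (2 * a) * \<epsilon>) (\<alpha> + \<epsilon> + of_int (2 * b) * \<epsilon>)"
      unfolding Q_def R' by (simp add: algebra_simps)
  next
    fix i j :: int assume "i < j - 1" then show "0 \<le> grid_rank Q i j" unfolding Q by (intro nonneg) simp
  qed blast
  then obtain g where g: "bij_betw g {(p, k) \<in> B.point_copies. grid_cell (\<alpha> + \<epsilon>) \<epsilon> (fst p) < grid_cell (\<alpha> + \<epsilon>) \<epsilon> (snd p) - 1}
       {((i, j), k :: nat). (i + 1) div 2 < (j + 1) div 2 - 1 \<and> int k < grid_rank Q i j}" (is "bij_betw g ?B ?V")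
    "\<And>u v m i j k. \<lbrakk>((u, v), m) \<in> B.point_copies; grid_cell (\<alpha> + \<epsilon>) \<epsilon> u < grid_cell (\<alpha> + \<epsilon>) \<epsilon> v - 1;
       g ((u, v), m) = ((i, j), k)\<rbrakk>
      \<Longrightarrow> (i + 1) div 2 = grid_cell (\<alpha> + \<epsilon>) \<epsilon> u \<and> (j + 1) div 2 = grid_cell (\<alpha> + \<epsilon>) \<epsilon> v"
    by blast
  \<comment> \<open>Translates a class of \<open>R\<close> into the same class of
    \<open>Q\<close>.\<close>
  define s where "s = (\<lambda>((i :: int, j :: int), k :: nat). ((i - 1, j - 1), k))"
  define h where "h x = inv_into ?B g (s (f x))" for x
  let ?D = "{((u, v), k) \<in> A.point_copies. 6 * \<epsilon> \<le> v - u}"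
  \<comment> \<open>This is the source of \<open>6 * \<epsilon>\<close>: the cell indices must
    differ by more than 2 because passing to the shifted grid can bring them closer by one, and they
    must still differ by more than 1 there.\<close>
  have cells: "grid_cell \<alpha> \<epsilon> u + 2 < grid_cell \<alpha> \<epsilon> v" if "6 * \<epsilon> \<le> v - u" for u v
  proof -
    define a b where "a = grid_cell \<alpha> \<epsilon> u" and "b = grid_cell \<alpha> \<epsilon> v"
    have a: "\<alpha> + (2 * of_int a - 2) * \<epsilon> < u" "v \<le> \<alpha> + 2 * of_int b * \<epsilon>"
      using grid_cell_eq_iff[OF \<open>0 < \<epsilon>\<close>] a_def b_def by blast+
    have "(2 * of_int a - 2) * \<epsilon> + 6 * \<epsilon> < 2 * of_int b * \<epsilon>" using a that by linarith
    then have "(2 * of_int a + 4) * \<epsilon> < 2 * of_int b * \<epsilon>" by (simp add: algebra_simps)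
    then have "2 * of_int a + 4 < (2 * of_int b :: real)" using \<open>0 < \<epsilon>\<close> by simp
    then show ?thesis unfolding a_def b_def by linarith
  qed
  have V: "s (f x) \<in> ?V" and fx: "\<exists>i j k. f x = ((i, j), k) \<and> (i + 1) div 2 = grid_cell \<alpha> \<epsilon> u \<and> (j + 1) div 2 = grid_cell \<alpha> \<epsilon> v"
    if "x = ((u, v), m)" "x \<in> ?D" for x u v m
  proof -
    have c: "grid_cell \<alpha> \<epsilon> u + 2 < grid_cell \<alpha> \<epsilon> v" using cells that by auto
    then have "x \<in> {(p, k) \<in> A.point_copies. grid_cell \<alpha> \<epsilon> (fst p) < grid_cell \<alpha> \<epsilon> (snd p) - 1}"
      using that by auto
    then have "f x \<in> {((i, j), k :: nat). (i + 1) div 2 < (j + 1) div 2 - 1 \<and> int k < grid_rank R i j}"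
      by (rule bspec[OF bij_betwE[OF f(1)]])
    then obtain i j k where ijk: "f x = ((i, j), k)" "int k < grid_rank R i j" by auto
    then have ij: "(i + 1) div 2 = grid_cell \<alpha> \<epsilon> u" "(j + 1) div 2 = grid_cell \<alpha> \<epsilon> v"
      using f(2)[of u v m i j k] that c by auto
    then show "\<exists>i j k. f x = ((i, j), k) \<and> (i + 1) div 2 = grid_cell \<alpha> \<epsilon> u \<and> (j + 1) div 2 = grid_cell \<alpha> \<epsilon> v"
      using ijk by blast
    have "i div 2 < j div 2 - 1" using ij c by linarith
    then show "s (f x) \<in> ?V" using ijk by (simp add: s_def Q)
  qed
  have hB: "h x \<in> ?B" "g (h x) = s (f x)" if "x \<in> ?D" for x
  proof -
    obtain u v m where "x = ((u, v), m)" by (metis surj_pair)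
    then have "s (f x) \<in> ?V" using that by (rule V)
    then have "s (f x) \<in> g ` ?B" unfolding bij_betw_imp_surj_on[OF g(1)] .
    then show "h x \<in> ?B" "g (h x) = s (f x)"
      unfolding h_def by (rule inv_into_into, rule f_inv_into_f)
  qed
  show ?thesis
  proof
    show "inj_on h ?D"
    proof (rule inj_onI)
      fix x y assume xy: "x \<in> ?D" "y \<in> ?D" "h x = h y"
      have "s (f x) = g (h y)" using hB(2)[OF xy(1)] unfolding xy(3) by (rule sym)
      also have "\<dots> = s (f y)" by (rule hB(2)[OF xy(2)])
      finally have "f x = f y" by (auto simp: s_def split: prod.splits)
      moreover have "x \<in> {(p, k) \<in> A.point_copies. grid_cell \<alpha> \<epsilon> (fst p) < grid_cell \<alpha> \<epsilon> (snd p) - 1}" if "x \<in> ?D" for x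
        using that cells by force
      ultimately show "x = y" using xy by (intro inj_onD[OF bij_betw_imp_inj_on[OF f(1)]])
    qed
    fix u v k assume uv: "((u, v), k) \<in> A.point_copies" "6 * \<epsilon> \<le> v - u"
    then have x: "((u, v), k) \<in> ?D" by simp
    obtain i j m where ij: "f ((u, v), k) = ((i, j), m)" "(i + 1) div 2 = grid_cell \<alpha> \<epsilon> u" "(j + 1) div 2 = grid_cell \<alpha> \<epsilon> v"
      using fx[OF refl x] by blast
    obtain u' v' k' where h: "h ((u, v), k) = ((u', v'), k')" by (metis surj_pair)
    have h': "((u', v'), k') \<in> B.point_copies" "grid_cell (\<alpha> + \<epsilon>) \<epsilon> u' < grid_cell (\<alpha> + \<epsilon>) \<epsilon> v' - 1"
      "g ((u', v'), k') = ((i - 1, j - 1), m)"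
      using hB[OF x] h ij(1) by (auto simp: s_def)
    have ij': "i div 2 = grid_cell (\<alpha> + \<epsilon>) \<epsilon> u'" "j div 2 = grid_cell (\<alpha> + \<epsilon>) \<epsilon> v'"
      using g(2)[OF h'] by auto
    have close: "\<bar>x - y\<bar> \<le> 3 * \<epsilon>" if x: "(n + 1) div 2 = grid_cell \<alpha> \<epsilon> x" and y: "n div 2 = grid_cell (\<alpha> + \<epsilon>) \<epsilon> y" for n x y
    proof -
      have 1: "\<alpha> + (2 * of_int ((n + 1) div 2) - 2) * \<epsilon> < x" "x \<le> \<alpha> + 2 * of_int ((n + 1) div 2) * \<epsilon>"
        using grid_cell_eq_iff[OF \<open>0 < \<epsilon>\<close>, of \<alpha> x] x by auto
      have 2: "\<alpha> + \<epsilon> + (2 * of_int (n div 2) - 2) * \<epsilon> < y" "y \<le> \<alpha> + \<epsilon> + 2 * of_int (n div 2) * \<epsilon>"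
        using grid_cell_eq_iff[OF \<open>0 < \<epsilon>\<close>, of "\<alpha> + \<epsilon>" y] y by auto
      consider (even) c where "n = 2 * c" | (odd) c where "n = 2 * c + 1" by (metis oddE evenE)
      then show ?thesis
      proof cases
        case even
        then have "(n + 1) div 2 = c" "n div 2 = c" by auto
        with 1 2 show ?thesis by (simp add: algebra_simps)
      next
        case odd
        then have "(n + 1) div 2 = c + 1" "n div 2 = c" by auto
        with 1 2 show ?thesis by (simp add: algebra_simps)
      qed
    qed
    show "\<exists>u' v' k'. h ((u, v), k) = ((u', v'), k') \<and> ((u', v'), k') \<in> B.point_copies \<and>
          \<bar>u - u'\<bar> \<le> 3 * \<epsilon> \<and> \<bar>v - v'\<bar> \<le> 3 * \<epsilon>"
      using h h'(1) close[OF ij(2) ij'(1)] close[OF ij(3) ij'(2)] by blast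
  qed
qed

section \<open>The bottleneck distance\<close>

text \<open>The usual theorem gives only a bijection. Here each matched pair also comes from
  \<open>f\<close> or from \<open>g\<close>, so a distance bound valid for both maps passes to
  \<open>h\<close>. The least fixed point \<open>S\<close> is the part of \<open>A\<close> on which
  \<open>f\<close> is used.\<close>

lemma Cantor_Bernstein_choice:
  assumes f: "inj_on f A" "f ` A \<subseteq> B" and g: "inj_on g B" "g ` B \<subseteq> A"
  obtains h where "bij_betw h A B" "\<And>x. x \<in> A \<Longrightarrow> h x = f x \<or> (h x \<in> B \<and> g (h x) = x)"
proof -
  define S where "S = lfp (\<lambda>X. A - g ` (B - f ` X))"
  have "mono (\<lambda>X. A - g ` (B - f ` X))" by (rule monoI) blast
  then have S: "S = A - g ` (B - f ` S)" unfolding S_def by (rule lfp_unfold)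
  define h where "h x = (if x \<in> S then f x else inv_into B g x)" for x
  have h2: "h x \<in> B - f ` S" "g (h x) = x" if "x \<in> A - S" for x
  proof -
    have "x \<in> g ` (B - f ` S)" using that S by blast
    then obtain y where y: "y \<in> B - f ` S" "x = g y" by blast
    then have "h x = y" using that g(1) by (simp add: h_def)
    then show "h x \<in> B - f ` S" "g (h x) = x" using y by auto
  qed
  have h1: "h x = f x" if "x \<in> S" for x using that by (simp add: h_def)
  have "S \<subseteq> A" using S by blast
  show ?thesis
  proof
    show "h x = f x \<or> (h x \<in> B \<and> g (h x) = x)" if "x \<in> A" for x
      using h1 h2 that by blast
    show "bij_betw h A B"
    proof (rule bij_betw_imageI)
      show "inj_on h A"
      proof (rule inj_onI)
        fix x y assume xy: "x \<in> A" "y \<in> A" "h x = h y"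
        consider "x \<in> S" "y \<in> S" | "x \<in> S" "y \<notin> S" | "x \<notin> S" "y \<in> S" | "x \<notin> S" "y \<notin> S" by blast
        then show "x = y"
        proof cases
          case 1
          then show ?thesis using inj_onD[OF f(1), of x y] xy h1 by simp
        next
          case 2
          then show ?thesis using h2(1)[of y] h1[of x] xy by auto
        next
          case 3
          then show ?thesis using h2(1)[of x] h1[of y] xy by auto
        next
          case 4
          then have "x = g (h x)" "y = g (h y)" using h2(2) xy(1,2) by auto
          then show ?thesis using xy(3) by simp
        qed
      qed
      show "h ` A = B"
      proof
        show "h ` A \<subseteq> B" using h1 h2(1) f(2) by blast
        show "B \<subseteq> h ` A"
        proof
          fix y assume y: "y \<in> B"
          show "y \<in> h ` A"
          proof (cases "y \<in> f ` S")
            case True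
            then show ?thesis using h1 \<open>S \<subseteq> A\<close> by force
          next
            case False
            then have "g y \<in> A - S" using y S g(2) by blast
            then have "g (h (g y)) = g y" "h (g y) \<in> B" using h2 by blast+
            then have "h (g y) = y" using g(1) y by (meson inj_onD)
            then show ?thesis using \<open>g y \<in> A - S\<close> by force
          qed
        qed
      qed
    qed
  qed
qed

lemma point_dist_nonneg: "0 \<le> point_dist p q"
  by (cases p; cases q) (auto simp: point_dist_def le_max_iff_disj)

lemma point_dist_self [simp]: "point_dist p p = 0"
  by (cases p) (auto simp: point_dist_def)

lemma point_dist_commute: "point_dist p q = point_dist q p"
proof -
  have "\<bar>v - v'\<bar> = \<bar>v' - v\<bar>" if "v \<noteq> v'" for v v' :: ereal
    using that by (cases v; cases v') auto
  then show ?thesis by (cases p; cases q) (auto simp: point_dist_def abs_minus_commute)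
qed

lemma point_dist_triangle: "point_dist p q \<le> point_dist p r + point_dist r q"
proof -
  obtain u v u' v' u'' v'' where pq: "p = (u, v)" "q = (u', v')" "r = (u'', v'')" by (metis surj_pair)
  let ?e = "\<lambda>v v'. if v = v' then 0 else \<bar>v - v'\<bar> :: ereal"
  have "\<bar>u - u'\<bar> \<le> \<bar>u - u''\<bar> + \<bar>u'' - u'\<bar>" by simp
  then have "ereal \<bar>u - u'\<bar> \<le> ereal \<bar>u - u''\<bar> + ereal \<bar>u'' - u'\<bar>" by simp
  also have "\<dots> \<le> max (ereal \<bar>u - u''\<bar>) (?e v v'') + max (ereal \<bar>u'' - u'\<bar>) (?e v'' v')"
    by (rule add_mono) simp_all
  finally have 1: "ereal \<bar>u - u'\<bar> \<le> max (ereal \<bar>u - u''\<bar>) (?e v v'') + max (ereal \<bar>u'' - u'\<bar>) (?e v'' v')" .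
  have "?e v v' \<le> ?e v v'' + ?e v'' v'" by (cases v; cases v'; cases v'') auto
  also have "\<dots> \<le> max (ereal \<bar>u - u''\<bar>) (?e v v'') + max (ereal \<bar>u'' - u'\<bar>) (?e v'' v')"
    by (rule add_mono) simp_all
  finally show ?thesis using 1 by (simp add: pq point_dist_def)
qed

lemma bottleneck_dist_le:
  assumes "bij_betw \<sigma> (occurrences D) (occurrences D')"
    and "\<And>q. q \<in> occurrences D \<Longrightarrow> point_dist (fst q) (fst (\<sigma> q)) \<le> M"
  shows "bottleneck_dist D D' \<le> M"
  unfolding bottleneck_dist_def
  by (rule INF_lower2[where i = \<sigma>]) (use assms in \<open>auto intro: SUP_least\<close>)

text \<open>Nonemptiness matters because a supremum over the empty set is
  \<open>-\<infinity>\<close> in the extended reals. If there is no bijection, the infimum is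
  \<open>\<infinity>\<close>.\<close>

lemma bottleneck_dist_nonneg:
  assumes "occurrences D \<noteq> {}"
  shows "0 \<le> bottleneck_dist D D'"
proof -
  obtain q where "q \<in> occurrences D" using assms by blast
  then show ?thesis unfolding bottleneck_dist_def by (auto intro!: INF_greatest SUP_upper2 point_dist_nonneg)
qed

lemma bottleneck_dist_self:
  assumes "occurrences D \<noteq> {}"
  shows "bottleneck_dist D D = 0"
  by (rule antisym[OF bottleneck_dist_le[of id] bottleneck_dist_nonneg]) (use assms in auto)

lemma bottleneck_dist_commute_le: "bottleneck_dist D' D \<le> bottleneck_dist D D'"
  unfolding bottleneck_dist_def[of D D']
proof (rule INF_greatest)
  fix \<sigma> assume "\<sigma> \<in> {\<sigma>. bij_betw \<sigma> (occurrences D) (occurrences D')}"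
  then have \<sigma>: "bij_betw \<sigma> (occurrences D) (occurrences D')" by simp
  let ?\<tau> = "inv_into (occurrences D) \<sigma>"
  have \<tau>: "bij_betw ?\<tau> (occurrences D') (occurrences D)" using \<sigma> by (rule bij_betw_inv_into)
  then show "bottleneck_dist D' D \<le> (SUP q\<in>occurrences D. point_dist (fst q) (fst (\<sigma> q)))"
  proof (rule bottleneck_dist_le)
    fix q assume q: "q \<in> occurrences D'"
    have "?\<tau> q \<in> occurrences D" using bij_betwE[OF \<tau>] q by blast
    moreover have "\<sigma> (?\<tau> q) = q" by (rule bij_betw_inv_into_right[OF \<sigma> q])
    ultimately show "point_dist (fst q) (fst (?\<tau> q)) \<le> (SUP q\<in>occurrences D. point_dist (fst q) (fst (\<sigma> q)))"
      by (intro SUP_upper2[where i = "?\<tau> q"]) (simp_all add: point_dist_commute)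
  qed
qed

lemma bottleneck_dist_commute: "bottleneck_dist D D' = bottleneck_dist D' D"
  by (intro antisym bottleneck_dist_commute_le)

text \<open>Nonnegativity rules out a sum of \<open>\<infinity>\<close> and
  \<open>-\<infinity>\<close>; an empty index set makes the right-hand side
  \<open>\<infinity>\<close>.\<close>

lemma ereal_le_INF_add_INF:
  fixes f :: "'i \<Rightarrow> ereal" and g :: "'j \<Rightarrow> ereal"
  assumes "\<And>i j. \<lbrakk>i \<in> I; j \<in> J\<rbrakk> \<Longrightarrow> x \<le> f i + g j"
    and "\<And>i. i \<in> I \<Longrightarrow> 0 \<le> f i" "\<And>j. j \<in> J \<Longrightarrow> 0 \<le> g j"
  shows "x \<le> (INF i\<in>I. f i) + (INF j\<in>J. g j)"
proof (cases "I = {} \<or> J = {}")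
  case True
  have "0 \<le> (INF i\<in>I. f i)" "0 \<le> (INF j\<in>J. g j)" using assms by (auto intro: INF_greatest)
  then show ?thesis using True by (auto simp: top_ereal_def)
next
  case False
  have J: "0 \<le> (INF j\<in>J. g j)" using assms by (auto intro: INF_greatest)
  have "x \<le> f i + (INF j\<in>J. g j)" if "i \<in> I" for i
  proof -
    have "x \<le> (INF j\<in>J. f i + g j)" using assms(1) that by (auto intro: INF_greatest)
    also have "\<dots> = f i + (INF j\<in>J. g j)"
      using False assms(2,3) that by (intro INF_ereal_add_right) auto
    finally show ?thesis .
  qed
  then have "x \<le> (INF i\<in>I. f i + (INF j\<in>J. g j))" by (auto intro: INF_greatest)
  also have "\<dots> = (INF i\<in>I. f i) + (INF j\<in>J. g j)"
    using False assms(2) J by (intro INF_ereal_add_left) auto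
  finally show ?thesis .
qed

lemma bottleneck_dist_triangle:
  assumes "occurrences D \<noteq> {}" "occurrences D' \<noteq> {}"
  shows "bottleneck_dist D D'' \<le> bottleneck_dist D D' + bottleneck_dist D' D''"
  unfolding bottleneck_dist_def[of D D'] bottleneck_dist_def[of D' D'']
proof (rule ereal_le_INF_add_INF)
  fix \<sigma> \<tau>
  assume "\<sigma> \<in> {\<sigma>. bij_betw \<sigma> (occurrences D) (occurrences D')}" "\<tau> \<in> {\<sigma>. bij_betw \<sigma> (occurrences D') (occurrences D'')}"
  then have \<sigma>: "bij_betw \<sigma> (occurrences D) (occurrences D')" and \<tau>: "bij_betw \<tau> (occurrences D') (occurrences D'')"
    by auto
  show "bottleneck_dist D D'' \<le> (SUP q\<in>occurrences D. point_dist (fst q) (fst (\<sigma> q)))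
      + (SUP q\<in>occurrences D'. point_dist (fst q) (fst (\<tau> q)))"
  proof (rule bottleneck_dist_le)
    show "bij_betw (\<tau> \<circ> \<sigma>) (occurrences D) (occurrences D'')" using \<sigma> \<tau> by (rule bij_betw_trans)
    fix q assume q: "q \<in> occurrences D"
    then have "\<sigma> q \<in> occurrences D'" using bij_betwE[OF \<sigma>] by blast
    then have "point_dist (fst q) (fst (\<sigma> q)) + point_dist (fst (\<sigma> q)) (fst (\<tau> (\<sigma> q)))
      \<le> (SUP q\<in>occurrences D. point_dist (fst q) (fst (\<sigma> q)))
      + (SUP q\<in>occurrences D'. point_dist (fst q) (fst (\<tau> q)))"
      using q by (intro add_mono SUP_upper2[where i = q] SUP_upper2[where i = "\<sigma> q"] order_refl)
    then show "point_dist (fst q) (fst ((\<tau> \<circ> \<sigma>) q)) \<le> (SUP q\<in>occurrences D. point_dist (fst q) (fst (\<sigma> q)))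
      + (SUP q\<in>occurrences D'. point_dist (fst q) (fst (\<tau> q)))"
      using order_trans[OF point_dist_triangle] by simp
  qed
next
  fix \<sigma> show "0 \<le> (SUP q\<in>occurrences D. point_dist (fst q) (fst (\<sigma> q)))"
    using assms(1) by (auto intro: SUP_upper2 point_dist_nonneg)
  fix \<tau> show "0 \<le> (SUP q\<in>occurrences D'. point_dist (fst q) (fst (\<tau> q)))"
    using assms(2) by (auto intro: SUP_upper2 point_dist_nonneg)
qed

lemma bottleneck_dist_le_of_injections:
  assumes "inj_on f (occurrences D)" "f ` occurrences D \<subseteq> occurrences D'"
    and "inj_on g (occurrences D')" "g ` occurrences D' \<subseteq> occurrences D"
    and f: "\<And>q. q \<in> occurrences D \<Longrightarrow> point_dist (fst q) (fst (f q)) \<le> M"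
    and g: "\<And>q. q \<in> occurrences D' \<Longrightarrow> point_dist (fst q) (fst (g q)) \<le> M"
  shows "bottleneck_dist D D' \<le> M"
proof -
  obtain h where h: "bij_betw h (occurrences D) (occurrences D')"
    "\<And>x. x \<in> occurrences D \<Longrightarrow> h x = f x \<or> (h x \<in> occurrences D' \<and> g (h x) = x)"
    using Cantor_Bernstein_choice[OF assms(1-4)] by blast
  show ?thesis
  proof (rule bottleneck_dist_le[OF h(1)])
    fix q assume q: "q \<in> occurrences D"
    then show "point_dist (fst q) (fst (h q)) \<le> M"
      using h(2)[OF q] f[OF q] g[of "h q"] by (auto simp: point_dist_commute)
  qed
qed

section \<open>Relative dimension\<close>

text \<open>A copy of \<^locale>\<open>vector_space\<close>: definitions made there would be duplicated by its
  global interpretation for real vector spaces.\<close>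

locale field_vector_space = vector_space scale
  for scale :: "'a::field \<Rightarrow> 'b::ab_group_add \<Rightarrow> 'b"
begin

definition rel_finite :: "'b set \<Rightarrow> 'b set \<Rightarrow> bool"
  where "rel_finite Z N \<longleftrightarrow> (\<exists>T. finite T \<and> Z \<subseteq> span (T \<union> N))"

text \<open>For subspaces this is the dimension of \<open>(Z + N) / N\<close>, and \<open>N\<close>
  need not lie in \<open>Z\<close>. With the cycles of a space as \<open>Z\<close> and the
  boundaries of a larger space as \<open>N\<close> it is the rank of the map induced in
  homology.\<close>

definition rel_dim :: "'b set \<Rightarrow> 'b set \<Rightarrow> nat"
  where "rel_dim Z N = (LEAST n. \<exists>S. finite S \<and> card S = n \<and> S \<subseteq> Z \<and> Z \<subseteq> span (S \<union> N))"

text \<open>The linear map that kills \<open>b\<close> and fixes \<open>S\<close> sends the span of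
  \<open>T \<union> b\<close> into the span of the image of \<open>T\<close>. The relative exchange
  bound thus reduces to the absolute one.\<close>

lemma independent_modulo_bound:
  assumes "independent (b \<union> S)" "S \<inter> b = {}" "finite T" "S \<subseteq> span (T \<union> b)"
  shows "finite S \<and> card S \<le> card T"
proof -
  interpret vector_space_pair scale scale ..
  obtain f where f: "Vector_Spaces.linear scale scale f" "\<forall>x\<in>b \<union> S. f x = (if x \<in> b then 0 else x)"
    using linear_independent_extend[OF assms(1), of "\<lambda>x. if x \<in> b then 0 else x"] by blast
  have "f x = x" if "x \<in> S" for x using f(2) assms(2) that by auto
  then have fS: "f ` S = S" by auto
  have "f ` (T \<union> b) \<subseteq> span (f ` T)"
  proof (rule image_subsetI)
    fix x assume "x \<in> T \<union> b"
    then show "f x \<in> span (f ` T)"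
      using f(2) by (cases "x \<in> b") (simp_all add: span_zero span_base)
  qed
  then have "span (f ` (T \<union> b)) \<subseteq> span (f ` T)"
    by (simp add: span_minimal)
  moreover have "f ` S \<subseteq> f ` span (T \<union> b)" using assms(4) by (rule image_mono)
  moreover have "f ` span (T \<union> b) = span (f ` (T \<union> b))"
    using linear_span_image[OF f(1)] by simp
  ultimately have "S \<subseteq> span (f ` T)" using fS by simp
  moreover have "independent S" using assms(1) by (rule independent_mono) simp
  ultimately have "finite S \<and> card S \<le> card (f ` T)"
    using independent_span_bound assms(3) by blast
  then show ?thesis using card_image_le[OF assms(3), of f] by linarith
qed

lemma span_Un_span_right: "span (S \<union> span b) = span (S \<union> b)"
  by (simp add: span_Un span_span)

lemma rel_basis_extend:
  assumes "independent C" "b \<subseteq> C" "C \<subseteq> b \<union> Z" "rel_finite Z (span b)"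
  obtains S where "C \<inter> S = {}" "S \<subseteq> Z" "independent (C \<union> S)" "Z \<subseteq> span (C \<union> S)" "finite S" "finite (C - b)"
proof -
  obtain D where D: "C \<subseteq> D" "D \<subseteq> b \<union> Z" "independent D" "b \<union> Z \<subseteq> span D"
    by (rule maximal_independent_subset_extend[OF assms(3,1)])
  obtain T where T: "finite T" "Z \<subseteq> span (T \<union> span b)"
    using assms(4) unfolding rel_finite_def by blast
  then have "D - b \<subseteq> span (T \<union> b)" using D unfolding span_Un_span_right by auto
  then have fin: "finite (D - b)"
    using independent_modulo_bound[of b "D - b" T] D(1,3) assms(2) T(1) by (auto simp: Un_absorb1)
  show ?thesis
  proof
    show "C \<inter> (D - C) = {}" by auto
    show "D - C \<subseteq> Z" using D assms(2) by auto
    show "independent (C \<union> (D - C))" "Z \<subseteq> span (C \<union> (D - C))" using D by (auto simp: Un_absorb1)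
    show "finite (D - C)" "finite (C - b)"
      by (rule finite_subset[OF _ fin]; use assms(2) D(1) in blast)+
  qed
qed

lemma rel_dim_eq_card:
  assumes "independent (b \<union> S)" "S \<inter> b = {}" "finite S" "S \<subseteq> Z" "Z \<subseteq> span (b \<union> S)"
  shows "rel_dim Z (span b) = card S"
  unfolding rel_dim_def
proof (rule Least_equality)
  show "\<exists>T. finite T \<and> card T = card S \<and> T \<subseteq> Z \<and> Z \<subseteq> span (T \<union> span b)"
    using assms by (intro exI[of _ S]) (auto simp: span_Un_span_right Un_commute)
  fix n assume "\<exists>T. finite T \<and> card T = n \<and> T \<subseteq> Z \<and> Z \<subseteq> span (T \<union> span b)"
  then obtain T where T: "finite T" "card T = n" "Z \<subseteq> span (T \<union> b)"
    unfolding span_Un_span_right by blast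
  then show "card S \<le> n"
    using independent_modulo_bound[of b S T] assms by blast
qed

lemma basis_of_span:
  obtains b where "independent b" "span b = span N"
proof -
  obtain b where "b \<subseteq> span N" "independent b" "span N \<subseteq> span b"
    by (rule maximal_independent_subset)
  moreover from this have "span b = span N"
    by (intro span_subspace subspace_span)
  ultimately show ?thesis using that by blast
qed

lemma rel_dim_witness:
  assumes "rel_finite Z (span N)"
  obtains S where "finite S" "card S = rel_dim Z (span N)" "S \<subseteq> Z" "Z \<subseteq> span (S \<union> span N)"
proof -
  obtain b where b: "independent b" "span b = span N"
    by (rule basis_of_span)
  obtain S where "b \<inter> S = {}" "S \<subseteq> Z" "independent (b \<union> S)" "Z \<subseteq> span (b \<union> S)" "finite S"
    using rel_basis_extend[of b b Z] b assms by auto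
  then have "\<exists>n S. finite S \<and> card S = n \<and> S \<subseteq> Z \<and> Z \<subseteq> span (S \<union> span N)"
    unfolding b(2)[symmetric] span_Un_span_right by (metis Un_commute)
  then have "\<exists>S. finite S \<and> card S = rel_dim Z (span N) \<and> S \<subseteq> Z \<and> Z \<subseteq> span (S \<union> span N)"
    unfolding rel_dim_def by (rule LeastI_ex)
  then show ?thesis using that by blast
qed

lemma rel_dim_le:
  assumes "finite S" "S \<subseteq> Z" "Z \<subseteq> span (S \<union> N)"
  shows "rel_dim Z N \<le> card S"
  unfolding rel_dim_def by (rule Least_le) (use assms in blast)

lemma rel_finite_mono:
  "\<lbrakk>rel_finite Z N; Z' \<subseteq> Z; N \<subseteq> N'\<rbrakk> \<Longrightarrow> rel_finite Z' N'"
  unfolding rel_finite_def by (meson Un_mono order_refl order_trans span_mono)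

lemma rel_dim_antimono:
  assumes "rel_finite Z (span N)" "span N \<subseteq> N'"
  shows "rel_dim Z N' \<le> rel_dim Z (span N)"
proof -
  obtain S where S: "finite S" "card S = rel_dim Z (span N)" "S \<subseteq> Z" "Z \<subseteq> span (S \<union> span N)"
    using rel_dim_witness[OF assms(1)] by blast
  moreover have "span (S \<union> span N) \<subseteq> span (S \<union> N')" using assms(2) by (intro span_mono) auto
  ultimately show ?thesis using rel_dim_le[of S Z N'] by auto
qed

text \<open>A basis \<open>b\<close> of the span of \<open>N\<close> is extended by \<open>S\<close>
  within \<open>Y\<close> and then by \<open>T\<close> within \<open>Z\<close>. The sizes of
  \<open>S\<close>, \<open>T\<close> and \<open>S \<union> T\<close> are the three
  dimensions.\<close>

lemma rel_dim_add:
  assumes "rel_finite Z (span N)" "Y \<subseteq> Z"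
  shows "rel_dim Z (span N) = rel_dim Y (span N) + rel_dim Z (span (Y \<union> N))"
proof -
  obtain b where b: "independent b" "span b = span N"
    by (rule basis_of_span)
  have "rel_finite Y (span b)" "rel_finite Z (span b)" using assms b rel_finite_mono by auto
  then obtain S where S: "b \<inter> S = {}" "S \<subseteq> Y" "independent (b \<union> S)" "Y \<subseteq> span (b \<union> S)" "finite S"
    using rel_basis_extend[of b b Y] b by auto
  obtain T where T: "(b \<union> S) \<inter> T = {}" "T \<subseteq> Z" "independent (b \<union> S \<union> T)" "Z \<subseteq> span (b \<union> S \<union> T)" "finite T"
  proof (rule rel_basis_extend[of "b \<union> S" b Z])
    show "b \<union> S \<subseteq> b \<union> Z" using S(2) assms(2) by blast
  qed (use S(3) \<open>rel_finite Z (span b)\<close> in auto)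
  have "span (b \<union> S) = span (Y \<union> N)"
  proof (rule span_eq[THEN iffD2], intro conjI)
    have "b \<subseteq> span N" using b(2) span_superset by blast
    then show "b \<union> S \<subseteq> span (Y \<union> N)"
      using S(2) span_mono[of N "Y \<union> N"] span_superset[of "Y \<union> N"] by blast
    have "N \<subseteq> span b" using b(2) span_superset by blast
    then show "Y \<union> N \<subseteq> span (b \<union> S)" using S(4) span_mono[of b "b \<union> S"] by blast
  qed
  moreover have "rel_dim Z (span (b \<union> S)) = card T"
    using T by (intro rel_dim_eq_card) auto
  moreover have "rel_dim Y (span b) = card S"
    using S by (intro rel_dim_eq_card) auto
  moreover have "rel_dim Z (span b) = card (S \<union> T)"
    using S T assms(2) by (intro rel_dim_eq_card) (auto simp: Un_assoc)
  moreover have "card (S \<union> T) = card S + card T"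
    using S T by (intro card_Un_disjoint) auto
  ultimately show ?thesis using b(2) by simp
qed

lemma rel_dim_mono:
  assumes "rel_finite Z (span N)" "Y \<subseteq> Z"
  shows "rel_dim Y (span N) \<le> rel_dim Z (span N)"
  using rel_dim_add[OF assms] by simp

text \<open>By additivity the two differences are the dimensions of \<open>Z\<close> modulo
  \<open>Y + N\<close> and modulo \<open>Y + N'\<close>, and the second quotient is an image of the
  first. This is the inequality behind \<open>persistence_rank\<close>.\<close>

lemma rel_dim_box_nonneg:
  assumes "rel_finite Z (span N)" "Y \<subseteq> Z" "span N \<subseteq> span N'"
  shows "0 \<le> int (rel_dim Z (span N)) - int (rel_dim Y (span N))
           - int (rel_dim Z (span N')) + int (rel_dim Y (span N'))"
proof -
  have "rel_finite Z (span N')" using rel_finite_mono assms by blast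
  then have "rel_dim Z (span N') = rel_dim Y (span N') + rel_dim Z (span (Y \<union> N'))"
    using assms by (intro rel_dim_add)
  moreover have "rel_dim Z (span N) = rel_dim Y (span N) + rel_dim Z (span (Y \<union> N))"
    using assms by (intro rel_dim_add)
  moreover have "rel_dim Z (span (Y \<union> N')) \<le> rel_dim Z (span (Y \<union> N))"
  proof (rule rel_dim_antimono)
    have "span N \<subseteq> span (Y \<union> N)" by (intro span_mono) auto
    then show "rel_finite Z (span (Y \<union> N))" using rel_finite_mono[OF assms(1)] by blast
    show "span (Y \<union> N) \<subseteq> span (Y \<union> N')"
      using assms(3) by (metis span_Un_span_right span_mono sup.mono order_refl)
  qed
  ultimately show ?thesis by linarith
qed

section \<open>Comparison with the dimension of an explicit quotient module\<close>

lemma vectorspace_quotient: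
  fixes W :: "('a, 'w) module" and q :: "'b \<Rightarrow> 'w"
  assumes Z: "subspace Z"
    and carrier: "carrier W = q ` Z"
    and add: "\<And>x y. \<lbrakk>x \<in> Z; y \<in> Z\<rbrakk> \<Longrightarrow> q x \<oplus>\<^bsub>W\<^esub> q y = q (x + y)"
    and zero: "\<zero>\<^bsub>W\<^esub> = q 0"
    and smult: "\<And>a x. x \<in> Z \<Longrightarrow> a \<odot>\<^bsub>W\<^esub> q x = q (scale a x)"
  shows "vectorspace (class_ring :: 'a ring) W"
proof -
  note Z' = subspace_0[OF Z] subspace_add[OF Z] subspace_scale[OF Z] subspace_neg[OF Z]
  have "abelian_group W"
  proof (rule abelian_groupI)
    fix x assume "x \<in> carrier W"
    then obtain z where "z \<in> Z" "x = q z" using carrier by auto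
    then show "\<exists>y\<in>carrier W. y \<oplus>\<^bsub>W\<^esub> x = \<zero>\<^bsub>W\<^esub>"
      using Z' by (intro bexI[of _ "q (- z)"]) (simp_all add: carrier add zero)
  next
    fix x y z assume "x \<in> carrier W" "y \<in> carrier W" "z \<in> carrier W"
    then show "x \<oplus>\<^bsub>W\<^esub> y \<oplus>\<^bsub>W\<^esub> z = x \<oplus>\<^bsub>W\<^esub> (y \<oplus>\<^bsub>W\<^esub> z)"
      unfolding carrier by (elim imageE) (simp add: add Z' add.assoc)
  next
    fix x y assume "x \<in> carrier W" "y \<in> carrier W"
    then show "x \<oplus>\<^bsub>W\<^esub> y = y \<oplus>\<^bsub>W\<^esub> x" "x \<oplus>\<^bsub>W\<^esub> y \<in> carrier W"
      unfolding carrier by (elim imageE, simp add: add Z' add.commute)+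
  next
    fix x assume "x \<in> carrier W"
    then show "\<zero>\<^bsub>W\<^esub> \<oplus>\<^bsub>W\<^esub> x = x"
      unfolding carrier by (elim imageE) (simp add: add zero Z')
  qed (simp add: carrier zero Z')
  moreover have "field (class_ring :: 'a ring)" by (rule class_field.field_axioms)
  moreover from this have "cring (class_ring :: 'a ring)" by (simp add: field_def domain_def)
  ultimately have "Module.module (class_ring :: 'a ring) W"
  proof (intro module.intro module_axioms.intro)
    fix a b x y assume "x \<in> carrier W" "y \<in> carrier W"
    then obtain z w where z: "z \<in> Z" "x = q z" "w \<in> Z" "y = q w" unfolding carrier by auto
    show "a \<odot>\<^bsub>W\<^esub> x \<in> carrier W" using z Z' by (simp add: carrier smult)
    show "(a \<oplus>\<^bsub>class_ring\<^esub> b) \<odot>\<^bsub>W\<^esub> x = a \<odot>\<^bsub>W\<^esub> x \<oplus>\<^bsub>W\<^esub> b \<odot>\<^bsub>W\<^esub> x"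
      using z Z' by (simp add: smult add scale_left_distrib)
    show "a \<odot>\<^bsub>W\<^esub> (x \<oplus>\<^bsub>W\<^esub> y) = a \<odot>\<^bsub>W\<^esub> x \<oplus>\<^bsub>W\<^esub> a \<odot>\<^bsub>W\<^esub> y"
      using z Z' by (simp add: smult add scale_right_distrib)
    show "(a \<otimes>\<^bsub>class_ring\<^esub> b) \<odot>\<^bsub>W\<^esub> x = a \<odot>\<^bsub>W\<^esub> (b \<odot>\<^bsub>W\<^esub> x)"
      using z Z' by (simp add: smult)
    show "\<one>\<^bsub>class_ring\<^esub> \<odot>\<^bsub>W\<^esub> x = x"
      using z Z' by (simp add: smult)
  qed
  with \<open>field class_ring\<close> show ?thesis
    by (intro vectorspace.intro)
qed

text \<open>Both dimensions are least sizes of finite generating sets. A generating set of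
  \<open>W\<close> lifts to representatives on which \<open>q\<close> is injective, and such a set
  generates \<open>W\<close> exactly if it spans \<open>Z\<close> modulo \<open>N\<close>.\<close>

lemma dim_quotient:
  fixes W :: "('a, 'w) module" and q :: "'b \<Rightarrow> 'w"
  assumes Z: "subspace Z" and N: "subspace N"
    and carrier: "carrier W = q ` Z"
    and add: "\<And>x y. \<lbrakk>x \<in> Z; y \<in> Z\<rbrakk> \<Longrightarrow> q x \<oplus>\<^bsub>W\<^esub> q y = q (x + y)"
    and zero: "\<zero>\<^bsub>W\<^esub> = q 0"
    and smult: "\<And>a x. x \<in> Z \<Longrightarrow> a \<odot>\<^bsub>W\<^esub> q x = q (scale a x)"
    and eq: "\<And>x y. \<lbrakk>x \<in> Z; y \<in> Z\<rbrakk> \<Longrightarrow> q x = q y \<longleftrightarrow> x - y \<in> N"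
    and fin: "rel_finite Z N"
  shows "vectorspace.dim (class_ring :: 'a ring) W = rel_dim Z N"
proof -
  interpret W: vectorspace "class_ring :: 'a ring" W
    by (rule vectorspace_quotient) fact+
  note Z' = subspace_0[OF Z] subspace_add[OF Z] subspace_scale[OF Z] subspace_sum[OF Z]
  have NN: "span N = N" using N by (rule span_eq_iff[THEN iffD2])
  have sum: "finsum W (\<lambda>s. q (g s)) S = q (\<Sum>s\<in>S. g s)" if "finite S" "g ` S \<subseteq> Z" for g :: "'w \<Rightarrow> 'b" and S
    using that
  proof (induction S rule: finite_induct)
    case (insert s S)
    moreover have "sum g S \<in> Z" using insert.prems by (intro Z') auto
    ultimately show ?case
      by (subst W.finsum_insert) (auto simp: carrier add)
  qed (simp add: zero)
  have spanS: "span S \<subseteq> Z" if "S \<subseteq> Z" for S using that Z by (rule span_minimal)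
  have span: "W.span (q ` S) = q ` span S" if S: "finite S" "S \<subseteq> Z" "inj_on q S" for S
  proof -
    have comb: "W.lincomb a (q ` S) = q (\<Sum>s\<in>S. scale (a (q s)) s)" for a
    proof -
      define p where "p = inv_into S q"
      have p: "p (q s) = s" if "s \<in> S" for s using S that by (simp add: p_def)
      have "W.lincomb a (q ` S) = finsum W (\<lambda>t. q (scale (a t) (p t))) (q ` S)"
        unfolding W.lincomb_def
        by (rule W.finsum_cong') (use S Z' p in \<open>auto simp: carrier smult\<close>)
      also have "\<dots> = q (\<Sum>t\<in>q ` S. scale (a t) (p t))"
        using S Z' p by (intro sum) auto
      also have "(\<Sum>t\<in>q ` S. scale (a t) (p t)) = (\<Sum>s\<in>S. scale (a (q s)) s)"
        using S p by (simp add: sum.reindex)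
      finally show ?thesis .
    qed
    have "W.span (q ` S) = {W.lincomb a (q ` S) | a. a \<in> q ` S \<rightarrow> carrier (class_ring :: 'a ring)}"
      using S by (intro W.finite_span) (auto simp: carrier)
    also have "\<dots> = q ` span S"
    proof -
      have "(\<Sum>s\<in>S. scale (c s) s) = (\<Sum>s\<in>S. scale ((c \<circ> inv_into S q) (q s)) s)" for c
        using S by (intro sum.cong) auto
      then have lift: "q (\<Sum>s\<in>S. scale (c s) s) = W.lincomb (c \<circ> inv_into S q) (q ` S)" for c
        unfolding comb by simp
      show ?thesis
      proof (intro equalityI subsetI)
        fix x assume "x \<in> {W.lincomb a (q ` S) | a. a \<in> q ` S \<rightarrow> carrier (class_ring :: 'a ring)}"
        then obtain a where "x = q (\<Sum>s\<in>S. scale ((a \<circ> q) s) s)" unfolding comb by auto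
        then show "x \<in> q ` span S" unfolding span_finite[OF S(1)] by blast
      next
        fix x assume "x \<in> q ` span S"
        then obtain c where "x = q (\<Sum>s\<in>S. scale (c s) s)" unfolding span_finite[OF S(1)] by auto
        then show "x \<in> {W.lincomb a (q ` S) | a. a \<in> q ` S \<rightarrow> carrier (class_ring :: 'a ring)}"
          unfolding lift by auto
      qed
    qed
    finally show ?thesis .
  qed
  have gen: "W.gen_set (q ` S) \<longleftrightarrow> Z \<subseteq> local.span (S \<union> N)" if S: "finite S" "S \<subseteq> Z" "inj_on q S" for S
  proof -
    have "q ` span S = q ` Z \<longleftrightarrow> (\<forall>z\<in>Z. \<exists>y\<in>span S. z - y \<in> N)"
    proof
      assume *: "q ` span S = q ` Z"
      show "\<forall>z\<in>Z. \<exists>y\<in>span S. z - y \<in> N"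
      proof
        fix z assume z: "z \<in> Z"
        then have "q z \<in> q ` span S" unfolding * by (rule imageI)
        then obtain y where y: "y \<in> span S" "q z = q y" by auto
        then have "z - y \<in> N" using eq[OF z, of y] spanS[OF S(2)] by blast
        then show "\<exists>y\<in>span S. z - y \<in> N" using y(1) by blast
      qed
    next
      assume *: "\<forall>z\<in>Z. \<exists>y\<in>span S. z - y \<in> N"
      have "q z \<in> q ` span S" if z: "z \<in> Z" for z
      proof -
        obtain y where y: "y \<in> span S" "z - y \<in> N" using * z by blast
        then have "q z = q y" using eq[OF z, of y] spanS[OF S(2)] by blast
        then show ?thesis using y(1) by blast
      qed
      then show "q ` span S = q ` Z" using spanS[OF S(2)] by blast
    qed
    also have "\<dots> \<longleftrightarrow> Z \<subseteq> span (S \<union> N)"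
    proof -
      have "z \<in> span (S \<union> N) \<longleftrightarrow> (\<exists>y\<in>span S. z - y \<in> N)" for z
      proof
        assume "z \<in> span (S \<union> N)"
        then obtain y n where "y \<in> span S" "n \<in> span N" "z = y + n" unfolding span_Un by auto
        then show "\<exists>y\<in>span S. z - y \<in> N" by (intro bexI[of _ y]) (auto simp: NN)
      next
        assume "\<exists>y\<in>span S. z - y \<in> N"
        then obtain y where "y \<in> span S" "z - y \<in> span N" using span_base by blast
        then have "y + (z - y) \<in> span (S \<union> N)" unfolding span_Un by blast
        then show "z \<in> span (S \<union> N)" by simp
      qed
      then show ?thesis by blast
    qed
    finally show ?thesis using span[OF S] carrier by simp
  qed
  obtain S where S: "finite S" "card S = rel_dim Z N" "S \<subseteq> Z" "Z \<subseteq> span (S \<union> N)"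
    using rel_dim_witness[of Z N] fin unfolding NN by blast
  \<comment> \<open>Two elements with the same image differ by an element of \<open>N\<close>, so
    one could be dropped from a spanning set of least size.\<close>
  have inj: "inj_on q S"
  proof (rule ccontr)
    assume "\<not> inj_on q S"
    then obtain x y where xy: "x \<in> S" "y \<in> S" "x \<noteq> y" "q x = q y" by (auto simp: inj_on_def)
    then have "x - y \<in> N" using eq S by blast
    then have "(x - y) + y \<in> span ((S - {x}) \<union> N)"
      using xy by (intro span_add span_base) auto
    then have "S \<union> N \<subseteq> span ((S - {x}) \<union> N)" by (auto intro: span_base)
    then have "span (S \<union> N) \<subseteq> span ((S - {x}) \<union> N)" by (intro span_minimal) auto
    then have "rel_dim Z N \<le> card (S - {x})" using S by (intro rel_dim_le) auto
    moreover have "card (S - {x}) < card S" using S(1) xy(1) by (rule card_Diff1_less)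
    ultimately show False using S(2) by linarith
  qed
  show ?thesis
    unfolding W.dim_def
  proof (rule Least_equality)
    show "\<exists>A. finite A \<and> card A = rel_dim Z N \<and> A \<subseteq> carrier W \<and> W.gen_set A"
      using S inj gen[of S] by (intro exI[of _ "q ` S"]) (auto simp: card_image carrier)
    fix n assume "\<exists>A. finite A \<and> card A = n \<and> A \<subseteq> carrier W \<and> W.gen_set A"
    then obtain A where A: "finite A" "card A = n" "A \<subseteq> q ` Z" "W.gen_set A" using carrier by auto
    obtain T where T: "T \<subseteq> Z" "inj_on q T" "q ` T = A"
      using subset_image_inj[THEN iffD1, OF A(3)] by metis
    have "finite T" using A(1) T(2,3) finite_imageD[of q T] by simp
    moreover have "card T = n" using A(2) T(3) card_image[OF T(2)] by simp
    moreover have "Z \<subseteq> span (T \<union> N)" using gen[OF \<open>finite T\<close> T(1,2)] A(4) T(3) by simp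
    ultimately show "rel_dim Z N \<le> n" using rel_dim_le[of T Z N] T by simp
  qed
qed

end

section \<open>Chains with coefficients in a field\<close>

definition field_scale :: "'k::field \<Rightarrow> ('x \<Rightarrow>\<^sub>0 'k) \<Rightarrow> ('x \<Rightarrow>\<^sub>0 'k)"
  where "field_scale a = Poly_Mapping.map ((*) a)"

lemma lookup_field_scale [simp]: "Poly_Mapping.lookup (field_scale a c) x = a * Poly_Mapping.lookup c x"
  by (simp add: field_scale_def Poly_Mapping.map.rep_eq when_def)

global_interpretation field_chain: field_vector_space "field_scale :: 'k::field \<Rightarrow> ('x \<Rightarrow>\<^sub>0 'k) \<Rightarrow> ('x \<Rightarrow>\<^sub>0 'k)"
  by unfold_locales (auto intro!: poly_mapping_eqI simp: lookup_add algebra_simps)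

definition field_of_chain :: "('x \<Rightarrow>\<^sub>0 int) \<Rightarrow> ('x \<Rightarrow>\<^sub>0 'k::field)"
  where "field_of_chain c = Poly_Mapping.map of_int c"

lemma lookup_field_of_chain [simp]:
  "Poly_Mapping.lookup (field_of_chain c) x = of_int (Poly_Mapping.lookup c x)"
  by (simp add: field_of_chain_def Poly_Mapping.map.rep_eq when_def)

lemma keys_field_of_chain: "Poly_Mapping.keys (field_of_chain c) \<subseteq> Poly_Mapping.keys c"
  by (auto simp: in_keys_iff)

lemma field_of_chain_0 [simp]: "field_of_chain 0 = 0"
  and field_of_chain_add: "field_of_chain (c + d) = field_of_chain c + field_of_chain d"
  and field_of_chain_diff: "field_of_chain (c - d) = field_of_chain c - field_of_chain d"
  and field_of_chain_cmul: "field_of_chain (frag_cmul n c) = field_scale (of_int n) (field_of_chain c)"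
  by (auto intro!: poly_mapping_eqI simp: lookup_add lookup_minus)

lemma field_of_chain_frag_of: "field_of_chain (frag_of x) = Poly_Mapping.single x 1"
  by (auto intro!: poly_mapping_eqI simp: lookup_single when_def)

lemma field_of_chain_sum: "field_of_chain (sum f A) = (\<Sum>x\<in>A. field_of_chain (f x))"
  by (induction A rule: infinite_finite_induct) (auto simp: field_of_chain_add)

text \<open>Identities between integral chain operators carry over to any field through this linear
  extension.\<close>

definition field_extend :: "('x \<Rightarrow> 'y \<Rightarrow>\<^sub>0 int) \<Rightarrow> ('x \<Rightarrow>\<^sub>0 'k::field) \<Rightarrow> ('y \<Rightarrow>\<^sub>0 'k)"
  where "field_extend D c =
    (\<Sum>x\<in>Poly_Mapping.keys c. field_scale (Poly_Mapping.lookup c x) (field_of_chain (D x)))"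

lemma field_extend_superset:
  assumes "finite A" "Poly_Mapping.keys c \<subseteq> A"
  shows "field_extend D c = (\<Sum>x\<in>A. field_scale (Poly_Mapping.lookup c x) (field_of_chain (D x)))"
  unfolding field_extend_def
  using assms by (intro sum.mono_neutral_left) (auto simp: in_keys_iff field_chain.scale_zero_left)

lemma field_extend_0 [simp]: "field_extend D 0 = 0"
  by (simp add: field_extend_def)

lemma field_extend_add: "field_extend D (c + d) = field_extend D c + field_extend D d"
proof -
  let ?A = "Poly_Mapping.keys c \<union> Poly_Mapping.keys d"
  have "Poly_Mapping.keys (c + d) \<subseteq> ?A" by (rule keys_add)
  then show ?thesis
    by (simp add: field_extend_superset[of ?A] lookup_add field_chain.scale_left_distrib sum.distrib)
qed

lemma field_extend_scale: "field_extend D (field_scale a c) = field_scale a (field_extend D c)"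
proof -
  have "Poly_Mapping.keys (field_scale a c) \<subseteq> Poly_Mapping.keys c" by (auto simp: in_keys_iff)
  then show ?thesis
    by (simp add: field_extend_superset[of "Poly_Mapping.keys c"] field_chain.scale_sum_right)
qed

lemma linear_field_extend: "Vector_Spaces.linear field_scale field_scale (field_extend D)"
  by unfold_locales (rule field_extend_add field_extend_scale)+

lemma field_extend_sum: "field_extend D (sum f A) = (\<Sum>x\<in>A. field_extend D (f x))"
  by (induction A rule: infinite_finite_induct) (auto simp: field_extend_add)

lemma field_extend_of_chain: "field_extend D (field_of_chain c) = field_of_chain (frag_extend D c)"
  by (simp add: field_extend_superset[of "Poly_Mapping.keys c"] keys_field_of_chain
      frag_extend_def field_of_chain_sum field_of_chain_cmul)

lemma field_extend_compose:
  "field_extend D (field_extend E c) = field_extend (\<lambda>x. frag_extend D (E x)) c"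
  unfolding field_extend_def[of E] field_extend_sum field_extend_scale field_extend_of_chain
  by (simp add: field_extend_def)

lemma field_extend_cong:
  "(\<And>x. x \<in> Poly_Mapping.keys c \<Longrightarrow> D x = E x) \<Longrightarrow> field_extend D c = field_extend E c"
  by (simp add: field_extend_def)

lemma field_extend_diff_fun:
  "field_extend (\<lambda>x. D x - E x) c = field_extend D c - field_extend E c"
  by (simp add: field_extend_def field_of_chain_diff field_chain.scale_right_diff_distrib sum_subtractf)

lemma field_scale_single: "field_scale a (Poly_Mapping.single x b) = Poly_Mapping.single x (a * b)"
  by (auto intro!: poly_mapping_eqI simp: lookup_single when_def)

lemma field_extend_frag_of: "field_extend frag_of c = c"
proof (rule poly_mapping_eqI)
  fix x
  have "(\<Sum>y\<in>Poly_Mapping.keys c. Poly_Mapping.lookup c y * (if y = x then 1 else 0))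
      = (\<Sum>y\<in>Poly_Mapping.keys c. if y = x then Poly_Mapping.lookup c y else 0)"
    by (rule sum.cong) auto
  also have "\<dots> = Poly_Mapping.lookup c x"
    by (simp add: in_keys_iff)
  finally show "Poly_Mapping.lookup (field_extend frag_of c) x = Poly_Mapping.lookup c x"
    by (simp add: field_extend_def lookup_sum field_of_chain_frag_of lookup_single when_def)
qed

lemma keys_field_extend:
  fixes c :: "'x \<Rightarrow>\<^sub>0 'k::field"
  shows "Poly_Mapping.keys (field_extend D c) \<subseteq> (\<Union>x\<in>Poly_Mapping.keys c. Poly_Mapping.keys (D x))"
proof
  fix y assume "y \<in> Poly_Mapping.keys (field_extend D c)"
  then have "(\<Sum>x\<in>Poly_Mapping.keys c. Poly_Mapping.lookup c x * of_int (Poly_Mapping.lookup (D x) y)) \<noteq> 0"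
    by (simp add: in_keys_iff field_extend_def lookup_sum)
  then obtain x where "x \<in> Poly_Mapping.keys c" "of_int (Poly_Mapping.lookup (D x) y) \<noteq> (0 :: 'k)"
    by (metis (no_types, lifting) mult_zero_right sum.neutral)
  then have "y \<in> Poly_Mapping.keys (D x)" by (auto simp: in_keys_iff)
  then show "y \<in> (\<Union>x\<in>Poly_Mapping.keys c. Poly_Mapping.keys (D x))"
    using \<open>x \<in> Poly_Mapping.keys c\<close> by blast
qed

text \<open>An additive operator on integral chains is determined by its values on single simplices;
  this puts the library operators into the form that \<open>field_extend\<close> transfers.\<close>

lemma frag_extend_additive:
  assumes "h 0 = 0" "\<And>c d. h (c - d) = h c - h d"
  shows "frag_extend (\<lambda>x. h (frag_of x)) c = h c"
proof -
  have "Poly_Mapping.keys c \<subseteq> UNIV" by simp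
  then show ?thesis
    by (induction c rule: frag_induction) (simp_all add: assms frag_extend_diff)
qed

lemma field_boundary_eq: "field_boundary p c = field_extend (\<lambda>f. chain_boundary p (frag_of f)) c"
proof (cases "p = 0")
  case False
  have "field_scale (Poly_Mapping.lookup c f) (field_of_chain (chain_boundary p (frag_of f)))
     = (\<Sum>i\<le>p. Poly_Mapping.single (singular_face p i f) ((-1) ^ i * Poly_Mapping.lookup c f))" for f
    using False
    by (simp add: chain_boundary_of field_of_chain_sum field_of_chain_cmul field_of_chain_frag_of
        field_chain.scale_sum_right field_scale_single mult.commute)
  then show ?thesis
    using False by (simp add: field_boundary_def field_extend_def)
qed (simp add: field_boundary_def field_extend_def chain_boundary_of)

lemma frag_extend_chain_boundary: "frag_extend (\<lambda>f. chain_boundary p (frag_of f)) c = chain_boundary p c"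
  by (rule frag_extend_additive) (simp_all add: chain_boundary_diff)

lemma linear_field_boundary: "Vector_Spaces.linear field_scale field_scale (field_boundary p)"
  unfolding field_boundary_eq[abs_def] by (rule linear_field_extend)

definition field_chains :: "nat \<Rightarrow> 'a topology \<Rightarrow> ('a, 'k::field) field_chain set"
  where "field_chains p X = {c. Poly_Mapping.keys c \<subseteq> singular_simplex_set p X}"

lemma carrier_chain_space: "carrier (chain_space p X) = field_chains p X"
  by (simp add: chain_space_def field_chains_def)

lemma subspace_field_chains: "field_chain.subspace (field_chains p X)"
  unfolding field_chain.subspace_def field_chains_def
  by (auto simp: in_keys_iff lookup_add subset_iff) (metis add.left_neutral)

lemma field_boundary_field_extend:
  "field_boundary p (field_extend D c) = field_extend (\<lambda>f. chain_boundary p (D f)) c"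
  by (simp add: field_boundary_eq field_extend_compose frag_extend_chain_boundary)

lemma field_extend_field_boundary:
  "field_extend D (field_boundary p c) = field_extend (\<lambda>f. frag_extend D (chain_boundary p (frag_of f))) c"
  by (simp add: field_boundary_eq field_extend_compose)

lemma field_boundary_boundary:
  assumes "c \<in> field_chains (Suc p) X"
  shows "field_boundary p (field_boundary (Suc p) c) = 0"
proof -
  have "field_boundary p (field_boundary (Suc p) c)
      = field_extend (\<lambda>f. chain_boundary p (chain_boundary (Suc p) (frag_of f))) c"
    unfolding field_boundary_eq[of "Suc p"] by (rule field_boundary_field_extend)
  also have "\<dots> = field_extend (\<lambda>f. 0) c"
  proof (rule field_extend_cong)
    fix f assume "f \<in> Poly_Mapping.keys c"
    then have "singular_chain (Suc p) X (frag_of f)"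
      using assms by (auto simp: field_chains_def singular_chain_of)
    then show "chain_boundary p (chain_boundary (Suc p) (frag_of f)) = 0"
      by (rule chain_boundary_boundary_alt)
  qed
  also have "\<dots> = 0" by (simp add: field_extend_def)
  finally show ?thesis .
qed

lemma field_extend_in_field_chains:
  assumes "c \<in> field_chains p X" "\<And>f. singular_simplex p X f \<Longrightarrow> f \<in> Poly_Mapping.keys c \<Longrightarrow> singular_chain q Y (D f)"
  shows "field_extend D c \<in> field_chains q Y"
  using assms keys_field_extend[of D c] unfolding field_chains_def singular_chain_def by blast

lemma field_boundary_in_field_chains:
  assumes "c \<in> field_chains (Suc p) X"
  shows "field_boundary (Suc p) c \<in> field_chains p X"
  unfolding field_boundary_eq using assms
  by (rule field_extend_in_field_chains) (simp add: singular_chain_boundary_alt singular_chain_of)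

lemma cycles_eq: "cycles p X = {c \<in> field_chains p X. field_boundary p c = 0}"
  by (simp add: cycles_def carrier_chain_space)

lemma boundaries_eq: "boundaries p X = field_boundary (Suc p) ` field_chains (Suc p) X"
  by (simp add: boundaries_def carrier_chain_space)

lemma subspace_cycles: "field_chain.subspace (cycles p X)"
proof -
  interpret b: Vector_Spaces.linear field_scale field_scale "field_boundary p"
    by (rule linear_field_boundary)
  show ?thesis
    using subspace_field_chains[of p X]
    unfolding field_chain.subspace_def cycles_eq by (auto simp: b.add b.scale b.zero)
qed

lemma subspace_boundaries: "field_chain.subspace (boundaries p X)"
proof -
  interpret b: Vector_Spaces.linear field_scale field_scale "field_boundary (Suc p)"
    by (rule linear_field_boundary)
  show ?thesis
    unfolding boundaries_eq by (rule b.subspace_image) (rule subspace_field_chains)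
qed

lemma span_boundaries: "field_chain.span (boundaries p X) = boundaries p X"
  by (rule field_chain.span_eq_iff[THEN iffD2]) (rule subspace_boundaries)

lemma boundaries_subset_cycles: "boundaries p X \<subseteq> cycles p X"
  unfolding boundaries_eq cycles_eq
  using field_boundary_in_field_chains field_boundary_boundary by blast

lemma field_chains_mono: "S \<subseteq> T \<Longrightarrow> field_chains p (top_of_set S) \<subseteq> field_chains p (top_of_set T)"
  unfolding field_chains_def using singular_simplex_mono by blast

lemma cycles_mono: "S \<subseteq> T \<Longrightarrow> cycles p (top_of_set S) \<subseteq> cycles p (top_of_set T)"
  unfolding cycles_eq using field_chains_mono by blast

lemma boundaries_mono: "S \<subseteq> T \<Longrightarrow> boundaries p (top_of_set S) \<subseteq> boundaries p (top_of_set T)"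
  unfolding boundaries_eq using field_chains_mono by blast

text \<open>The image of the induced map consists of the cosets \<open>q z\<close> of the boundaries
  of \<open>T\<close> whose representative \<open>z\<close> is a cycle of \<open>S\<close>. So
  \<open>dim_quotient\<close> applies with \<open>Z\<close> and \<open>N\<close> taken from
  different spaces.\<close>

lemma dim_inclusion_image:
  fixes S T :: "'a::topological_space set"
  assumes "S \<subseteq> T"
    and fin: "field_chain.rel_finite (cycles p (top_of_set S) :: ('a, 'k::field) field_chain set) (boundaries p (top_of_set T))"
  shows "vectorspace.dim (class_ring :: 'k ring)
      ((homology_space p (top_of_set T))
        \<lparr>carrier := inclusion_hom p (top_of_set T) ` carrier (homology_space p (top_of_set S))\<rparr>)
    = field_chain.rel_dim (cycles p (top_of_set S) :: ('a, 'k) field_chain set) (boundaries p (top_of_set T))"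
proof -
  let ?Z = "cycles p (top_of_set S) :: ('a, 'k) field_chain set"
  let ?N = "boundaries p (top_of_set T) :: ('a, 'k) field_chain set"
  let ?N' = "boundaries p (top_of_set S) :: ('a, 'k) field_chain set"
  define q where "q z = (\<lambda>n. n + z) ` ?N" for z
  have N: "field_chain.subspace ?N" by (rule subspace_boundaries)
  note N0 = field_chain.subspace_0[OF N]
  note Nadd = field_chain.subspace_add[OF N]
  note Ndiff = field_chain.subspace_diff[OF N]
  note Nscale = field_chain.subspace_scale[OF N]
  have q_iff: "x \<in> q z \<longleftrightarrow> x - z \<in> ?N" for x z
    unfolding q_def by (auto simp: image_iff) (metis diff_add_cancel)
  have inc: "inclusion_hom p (top_of_set T) ((\<lambda>n. n + z) ` ?N') = q z" for z
  proof -
    have N': "?N' \<subseteq> ?N" using assms(1) by (rule boundaries_mono)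
    have "0 \<in> ?N'" by (rule field_chain.subspace_0[OF subspace_boundaries])
    show ?thesis
    proof (intro equalityI subsetI)
      fix x assume "x \<in> inclusion_hom p (top_of_set T) ((\<lambda>n. n + z) ` ?N')"
      then obtain m n where "m \<in> ?N'" "n \<in> ?N" "x = (m + z) + n"
        by (auto simp: inclusion_hom_def set_add_def' chain_space_def)
      then show "x \<in> q z" using N' Nadd[of m n] by (auto simp: q_iff algebra_simps)
    next
      fix x assume "x \<in> q z"
      then have "x - z \<in> ?N" "x = (0 + z) + (x - z)" by (auto simp: q_iff)
      then show "x \<in> inclusion_hom p (top_of_set T) ((\<lambda>n. n + z) ` ?N')"
        using \<open>0 \<in> ?N'\<close> by (auto simp: inclusion_hom_def set_add_def' chain_space_def intro!: bexI)
    qed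
  qed
  show ?thesis
  proof (rule field_chain.dim_quotient[where q = q])
    show "field_chain.subspace ?Z" "field_chain.subspace ?N"
      by (rule subspace_cycles subspace_boundaries)+
    show "field_chain.rel_finite ?Z ?N" by (rule fin)
    have "carrier (homology_space p (top_of_set S)) = (\<lambda>z. (\<lambda>n. n + z) ` ?N') ` ?Z"
      by (auto simp: homology_space_def quotient_module_def A_RCOSETS_def' a_r_coset_def' chain_space_def)
    then show "carrier (homology_space p (top_of_set T)
        \<lparr>carrier := inclusion_hom p (top_of_set T) ` carrier (homology_space p (top_of_set S))\<rparr>) = q ` ?Z"
      using inc by (auto simp: image_image)
    show "q x = q y \<longleftrightarrow> x - y \<in> ?N" if "x \<in> ?Z" "y \<in> ?Z" for x y
    proof
      assume "q x = q y"
      moreover have "x \<in> q x" using N0 by (simp add: q_iff)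
      ultimately show "x - y \<in> ?N" by (simp add: q_iff)
    next
      assume *: "x - y \<in> ?N"
      show "q x = q y"
      proof (intro equalityI subsetI)
        fix z assume "z \<in> q x"
        then show "z \<in> q y" using Nadd[OF _ *, of "z - x"] by (simp add: q_iff)
      next
        fix z assume "z \<in> q y"
        then show "z \<in> q x" using Ndiff[OF _ *, of "z - y"] by (simp add: q_iff)
      qed
    qed
    have sum: "A <+>\<^bsub>(chain_space p (top_of_set T))\<lparr>carrier := cycles p (top_of_set T)\<rparr>\<^esub> B = {x + y |x y. x \<in> A \<and> y \<in> B}"
      for A B :: "('a, 'k) field_chain set"
      by (auto simp: set_add_def' chain_space_def)
    show "q x \<oplus>\<^bsub>(homology_space p (top_of_set T))\<lparr>carrier := C\<rparr>\<^esub> q y = q (x + y)" for x y C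
    proof -
      have "{x' + y' |x' y'. x' \<in> q x \<and> y' \<in> q y} = q (x + y)"
      proof (intro equalityI subsetI)
        fix z assume "z \<in> {x' + y' |x' y'. x' \<in> q x \<and> y' \<in> q y}"
        then obtain x' y' where "z = x' + y'" "x' - x \<in> ?N" "y' - y \<in> ?N" by (auto simp: q_iff)
        then show "z \<in> q (x + y)" using Nadd[of "x' - x" "y' - y"] by (simp add: q_iff algebra_simps)
      next
        fix z assume "z \<in> q (x + y)"
        then have "z - y \<in> q x" "y \<in> q y" "z = (z - y) + y" using N0 by (simp_all add: q_iff algebra_simps)
        then show "z \<in> {x' + y' |x' y'. x' \<in> q x \<and> y' \<in> q y}" by blast
      qed
      then show ?thesis by (simp add: homology_space_def quotient_module_def sum)
    qed
    show "\<zero>\<^bsub>(homology_space p (top_of_set T))\<lparr>carrier := C\<rparr>\<^esub> = q 0" for C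
      by (auto simp: homology_space_def quotient_module_def q_iff)
    show "a \<odot>\<^bsub>(homology_space p (top_of_set T))\<lparr>carrier := C\<rparr>\<^esub> q x = q (field_scale a x)" for a x C
    proof -
      have "{x' + y' |x' y'. x' \<in> field_scale a ` q x \<and> y' \<in> ?N} = q (field_scale a x)"
      proof (intro equalityI subsetI)
        fix z assume "z \<in> {x' + y' |x' y'. x' \<in> field_scale a ` q x \<and> y' \<in> ?N}"
        then obtain x' y' where "z = field_scale a x' + y'" "x' - x \<in> ?N" "y' \<in> ?N" by (auto simp: q_iff)
        then show "z \<in> q (field_scale a x)"
          using Nadd[OF Nscale[of "x' - x" a], of y']
          by (simp add: q_iff algebra_simps field_chain.scale_right_diff_distrib)
      next
        fix z assume "z \<in> q (field_scale a x)"
        then have "z - field_scale a x \<in> ?N" "x \<in> q x" "z = field_scale a x + (z - field_scale a x)"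
          using N0 by (simp_all add: q_iff)
        then show "z \<in> {x' + y' |x' y'. x' \<in> field_scale a ` q x \<and> y' \<in> ?N}" by blast
      qed
      moreover have "(\<lambda>v. a \<odot>\<^bsub>(chain_space p (top_of_set T))\<lparr>carrier := cycles p (top_of_set T)\<rparr>\<^esub> v) = field_scale a"
        by (simp add: chain_space_def field_scale_def)
      ultimately show ?thesis by (simp add: homology_space_def quotient_module_def sum)
    qed
  qed
qed

section \<open>Finiteness of persistent Betti numbers\<close>

text \<open>The identity of \<open>C\<close> is homotopic to a constant map, so \<open>z\<close> is
  homologous to its image in a point. In positive degree that image bounds because a point has no
  homology there; in degree 0 a difference of two simplices is mapped to 0.\<close>

lemma convex_cycle_bounds:
  fixes C :: "'e::real_normed_vector set"
  assumes C: "convex C" and z: "singular_chain p (top_of_set C) z" "chain_boundary p z = 0"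
    and 0: "p = 0 \<Longrightarrow> \<exists>f g. z = frag_of f - frag_of g"
  obtains d where "singular_chain (Suc p) (top_of_set C) d" "chain_boundary (Suc p) d = z"
proof (cases "C = {}")
  case True
  then have "z = 0" using z(1) by (simp add: singular_chain_empty)
  then show ?thesis using that[of 0] by simp
next
  case False
  then obtain a where a: "a \<in> C" by blast
  let ?k = "\<lambda>x::'e. a"
  have "homotopic_with (\<lambda>h. True) (top_of_set C) (top_of_set C) id ?k"
    using C a by (intro homotopic_with_linear continuous_intros) (auto dest: convex_contains_segment[THEN iffD1])
  \<comment> \<open>Absolute homology is used as homology relative to the empty set, for which the
    condition on \<open>h\<close> is vacuous.\<close>
  then have "homotopic_with (\<lambda>h. h \<in> {} \<rightarrow> {}) (top_of_set C) (top_of_set C) id ?k" by simp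
  then have "homologous_rel p (top_of_set C) {} (chain_map p id z) (chain_map p ?k z)"
    by (rule homotopic_imp_homologous_rel_chain_maps) (use z in \<open>simp add: singular_cycle\<close>)
  then have hom: "singular_relboundary p (top_of_set C) {} (z - chain_map p ?k z)"
    using z(1) by (simp add: homologous_rel_def chain_map_ident)
  have "singular_relboundary p (top_of_set C) {} (chain_map p ?k z)"
  proof (cases "p = 0")
    case True
    then obtain f g where "z = frag_of f - frag_of g" using 0 by blast
    then have "chain_map p ?k z = 0" by (simp add: chain_map_diff simplex_map_def o_def)
    then show ?thesis by simp
  next
    case False
    have "singular_relcycle p (top_of_set {a}) {} (chain_map p ?k z)"
      by (rule singular_relcycle_chain_map[where X = "top_of_set C" and S = "{}"])
        (use z in \<open>auto simp: singular_cycle\<close>)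
    then have "singular_relboundary p (top_of_set {a}) {} (chain_map p ?k z)"
      using False by (subst singular_boundary_eq_cycle_singleton) auto
    then show ?thesis
      unfolding singular_boundary using a by (meson empty_subsetI insert_subset singular_chain_mono)
  qed
  with hom have "singular_relboundary p (top_of_set C) {} (z - chain_map p ?k z + chain_map p ?k z)"
    by (rule singular_relboundary_add)
  then show ?thesis using that by (auto simp: singular_boundary)
qed

section \<open>Deforming singular simplices into affine ones by convex carriers\<close>

definition affine_simplex :: "nat \<Rightarrow> (nat \<Rightarrow> 'e::real_vector) \<Rightarrow> (nat \<Rightarrow> real) \<Rightarrow> 'e"
  where "affine_simplex p w = (\<lambda>x\<in>standard_simplex p. \<Sum>j\<le>p. x j *\<^sub>R w j)"

text \<open>The coface map: vertex \<open>j\<close> of the \<open>k\<close>-th face is vertex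
  \<open>skip k j\<close> of the simplex.\<close>

definition skip :: "nat \<Rightarrow> nat \<Rightarrow> nat"
  where "skip k j = (if j < k then j else Suc j)"

definition basis_vertex :: "nat \<Rightarrow> nat \<Rightarrow> real"
  where "basis_vertex j = (\<lambda>i. if i = j then 1 else 0)"

lemma basis_vertex_in_standard_simplex [simp]: "basis_vertex j \<in> standard_simplex p \<longleftrightarrow> j \<le> p"
  by (simp add: basis_vertex_def)

lemma simplical_face_basis_vertex: "simplical_face k (basis_vertex j) = basis_vertex (skip k j)"
  by (auto simp: simplical_face_def basis_vertex_def skip_def fun_eq_iff)

lemma singular_face_basis_vertex:
  "j \<le> p \<Longrightarrow> singular_face (Suc p) k f (basis_vertex j) = f (basis_vertex (skip k j))"
  by (simp add: singular_face_def simplical_face_basis_vertex)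

lemma skip_le: "\<lbrakk>j \<le> p; k \<le> Suc p\<rbrakk> \<Longrightarrow> skip k j \<le> Suc p"
  by (simp add: skip_def)

lemma affine_simplex_cong: "(\<And>j. j \<le> p \<Longrightarrow> v j = w j) \<Longrightarrow> affine_simplex p v = affine_simplex p w"
  by (auto simp: affine_simplex_def intro!: restrict_ext sum.cong)

lemma singular_simplex_affine_simplex:
  fixes w :: "nat \<Rightarrow> 'e::real_normed_vector"
  assumes "convex C" "w ` {..p} \<subseteq> C"
  shows "singular_simplex p (top_of_set C) (affine_simplex p w)"
  unfolding singular_simplex_def affine_simplex_def
proof
  have "continuous_on (standard_simplex p) (\<lambda>x. \<Sum>j\<le>p. x j *\<^sub>R w j)"
    by (intro continuous_intros continuous_on_product_coordinates continuous_on_subset[OF _ subset_UNIV])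
  then have "continuous_map (top_of_set (standard_simplex p)) euclidean (\<lambda>x. \<Sum>j\<le>p. x j *\<^sub>R w j)"
    by simp
  moreover have "(\<Sum>j\<le>p. x j *\<^sub>R w j) \<in> C" if "x \<in> standard_simplex p" for x
    using that assms by (intro convex_sum) (auto simp: standard_simplex_def)
  ultimately show "continuous_map (subtopology (powertop_real UNIV) (standard_simplex p)) (top_of_set C)
     (\<lambda>x\<in>standard_simplex p. \<Sum>j\<le>p. x j *\<^sub>R w j)"
    by (auto simp: euclidean_product_topology continuous_map_in_subtopology image_subset_iff
        elim: continuous_map_eq)
\<comment> \<open>What remains is extensionality, which is why \<open>affine_simplex\<close> is
  restricted to the standard simplex.\<close>
qed simp

lemma sum_skip:
  fixes g :: "nat \<Rightarrow> 'e::ab_group_add"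
  assumes "k \<le> Suc p" "g k = 0"
  shows "(\<Sum>j\<le>Suc p. g j) = (\<Sum>j\<le>p. g (skip k j))"
proof -
  have "inj_on (skip k) {..p}" by (auto simp: inj_on_def skip_def split: if_splits)
  moreover have "skip k ` {..p} = {..Suc p} - {k}"
  proof (intro equalityI subsetI)
    fix i assume "i \<in> {..Suc p} - {k}"
    then show "i \<in> skip k ` {..p}"
      using assms(1) by (intro image_eqI[of _ _ "if i < k then i else i - 1"]) (auto simp: skip_def)
  qed (auto simp: skip_def)
  ultimately have "(\<Sum>j\<le>p. g (skip k j)) = sum g ({..Suc p} - {k})"
    by (metis (mono_tags, lifting) sum.reindex_cong)
  also have "\<dots> = sum g {..Suc p}" using assms by (simp add: sum_diff1)
  finally show ?thesis by simp
qed

lemma singular_face_affine_simplex: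
  assumes "k \<le> Suc p"
  shows "singular_face (Suc p) k (affine_simplex (Suc p) w) = affine_simplex p (w \<circ> skip k)"
proof -
  have "(\<Sum>j\<le>Suc p. simplical_face k x j *\<^sub>R w j) = (\<Sum>j\<le>p. x j *\<^sub>R w (skip k j))" for x :: "nat \<Rightarrow> real"
    using assms by (subst sum_skip[of k]) (auto simp: simplical_face_def skip_def intro!: sum.cong)
  then show ?thesis
    using assms by (auto simp: singular_face_def affine_simplex_def simplical_face_in_standard_simplex
        intro!: restrict_ext)
qed

text \<open>A singular simplex \<open>f\<close> is carried to the space by \<open>h\<close>, and its vertices are then rounded by
  \<open>n\<close>. The homotopy from the carried simplex to the affine one on the rounded vertices is chosen
  degree by degree inside the following convex carrier, where all cycles bound.\<close>

definition rounded_vertex :: "('a \<Rightarrow> 'e) \<Rightarrow> ('e \<Rightarrow> 'e) \<Rightarrow> ((nat \<Rightarrow> real) \<Rightarrow> 'a) \<Rightarrow> nat \<Rightarrow> 'e"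
  where "rounded_vertex h n f j = n (h (f (basis_vertex j)))"

definition carrier_hull ::
    "('a \<Rightarrow> 'e) \<Rightarrow> ('e \<Rightarrow> 'e) \<Rightarrow> nat \<Rightarrow> ((nat \<Rightarrow> real) \<Rightarrow> 'a) \<Rightarrow> 'e::real_vector set"
  where "carrier_hull h n p f =
    convex hull ((\<lambda>x. h (f x)) ` standard_simplex p \<union> rounded_vertex h n f ` {..p})"

primrec rounding_homotopy ::
    "('a \<Rightarrow> 'e) \<Rightarrow> ('e \<Rightarrow> 'e::real_normed_vector) \<Rightarrow> nat \<Rightarrow> ((nat \<Rightarrow> real) \<Rightarrow> 'a) \<Rightarrow> 'e chain"
  where
    "rounding_homotopy h n 0 = (\<lambda>f. SOME d. singular_chain (Suc 0) (top_of_set (carrier_hull h n 0 f)) d \<and>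
       chain_boundary (Suc 0) d = frag_of (affine_simplex 0 (rounded_vertex h n f)) - frag_of (simplex_map 0 h f))"
  | "rounding_homotopy h n (Suc p) = (\<lambda>f. SOME d.
       singular_chain (Suc (Suc p)) (top_of_set (carrier_hull h n (Suc p) f)) d \<and>
       chain_boundary (Suc (Suc p)) d =
         frag_of (affine_simplex (Suc p) (rounded_vertex h n f)) - frag_of (simplex_map (Suc p) h f)
         - frag_extend (rounding_homotopy h n p) (chain_boundary (Suc p) (frag_of f)))"

lemma carrier_hull_face:
  assumes "k \<le> Suc p"
  shows "carrier_hull h n p (singular_face (Suc p) k f) \<subseteq> carrier_hull h n (Suc p) f"
  unfolding carrier_hull_def
proof (rule hull_mono, rule Un_least)
  show "(\<lambda>x. h (singular_face (Suc p) k f x)) ` standard_simplex p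
     \<subseteq> (\<lambda>x. h (f x)) ` standard_simplex (Suc p) \<union> rounded_vertex h n f ` {..Suc p}"
    using assms by (auto simp: singular_face_def simplical_face_in_standard_simplex)
  show "rounded_vertex h n (singular_face (Suc p) k f) ` {..p}
     \<subseteq> (\<lambda>x. h (f x)) ` standard_simplex (Suc p) \<union> rounded_vertex h n f ` {..Suc p}"
    using assms by (auto simp: rounded_vertex_def singular_face_basis_vertex skip_le)
qed

lemma singular_simplex_carrier_hull:
  fixes h :: "'a::topological_space \<Rightarrow> 'e::real_normed_vector"
  assumes h: "continuous_on S h" and f: "singular_simplex p (top_of_set S) f"
  shows "singular_simplex p (top_of_set (carrier_hull h n p f)) (simplex_map p h f)"
    and "singular_simplex p (top_of_set (carrier_hull h n p f)) (affine_simplex p (rounded_vertex h n f))"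
proof -
  have "singular_simplex p euclidean (simplex_map p h f)"
    using f by (rule singular_simplex_simplex_map) (use h in simp)
  then show "singular_simplex p (top_of_set (carrier_hull h n p f)) (simplex_map p h f)"
    by (auto simp: singular_simplex_subtopology simplex_map_def carrier_hull_def intro: hull_inc)
  show "singular_simplex p (top_of_set (carrier_hull h n p f)) (affine_simplex p (rounded_vertex h n f))"
    by (rule singular_simplex_affine_simplex) (auto simp: carrier_hull_def intro: hull_inc)
qed

lemma chain_boundary_frag_of_Suc:
  "chain_boundary (Suc p) (frag_of f) = (\<Sum>k\<le>Suc p. frag_cmul ((-1) ^ k) (frag_of (singular_face (Suc p) k f)))"
  by (simp add: chain_boundary_of)

lemma frag_extend_diff_fun:
  fixes D E :: "'x \<Rightarrow> 'y \<Rightarrow>\<^sub>0 int"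
  shows "frag_extend (\<lambda>x. D x - E x) c = frag_extend D c - frag_extend E c"
proof -
  have "frag_cmul a (x - y) = frag_cmul a x - frag_cmul a y" for a and x y :: "'y \<Rightarrow>\<^sub>0 int"
    by (rule poly_mapping_eqI) (simp add: lookup_minus right_diff_distrib)
  then show ?thesis by (simp add: frag_extend_def sum_subtractf)
qed

lemma chain_boundary_frag_extend:
  "chain_boundary p (frag_extend E c) = frag_extend (\<lambda>g. chain_boundary p (E g)) c"
  using frag_extend_additive[of "\<lambda>c. chain_boundary p (frag_extend E c)" c]
  by (simp add: frag_extend_diff chain_boundary_diff)

text \<open>The method of acyclic carriers. The chain to be filled lies in the convex carrier of
  \<open>f\<close>, because carriers of faces are contained in it, and it is a cycle by the identity
  one degree lower; so the choices in \<open>rounding_homotopy\<close> succeed. For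
  \<open>p = 0\<close> the last term vanishes, as the boundary in degree 0 is 0.\<close>

lemma chain_boundary_rounding_homotopy:
  fixes h :: "'a::topological_space \<Rightarrow> 'e::real_normed_vector"
  assumes h: "continuous_on S h" and f: "singular_simplex p (top_of_set S) f"
  shows "singular_chain (Suc p) (top_of_set (carrier_hull h n p f)) (rounding_homotopy h n p f)"
    and "chain_boundary (Suc p) (rounding_homotopy h n p f) =
      frag_of (affine_simplex p (rounded_vertex h n f)) - frag_of (simplex_map p h f)
      - frag_extend (rounding_homotopy h n (p - 1)) (chain_boundary p (frag_of f))"
proof -
  have "singular_chain (Suc p) (top_of_set (carrier_hull h n p f)) (rounding_homotopy h n p f) \<and>
    chain_boundary (Suc p) (rounding_homotopy h n p f) =
      frag_of (affine_simplex p (rounded_vertex h n f)) - frag_of (simplex_map p h f)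
      - frag_extend (rounding_homotopy h n (p - 1)) (chain_boundary p (frag_of f))"
    using f
  proof (induction p arbitrary: f)
    case 0
    let ?z = "frag_of (affine_simplex 0 (rounded_vertex h n f)) - frag_of (simplex_map 0 h f)"
    have "\<exists>d. singular_chain (Suc 0) (top_of_set (carrier_hull h n 0 f)) d \<and> chain_boundary (Suc 0) d = ?z"
    proof (rule convex_cycle_bounds[of "carrier_hull h n 0 f" 0 ?z])
      show "singular_chain 0 (top_of_set (carrier_hull h n 0 f)) ?z"
        using singular_simplex_carrier_hull[OF h 0]
        by (intro singular_chain_diff) (simp_all add: singular_chain_of)
      show "chain_boundary 0 ?z = 0" by (simp add: chain_boundary_def)
    qed (auto simp: carrier_hull_def)
    then have "singular_chain (Suc 0) (top_of_set (carrier_hull h n 0 f)) (rounding_homotopy h n 0 f)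
        \<and> chain_boundary (Suc 0) (rounding_homotopy h n 0 f) = ?z"
      unfolding rounding_homotopy.simps by (rule someI_ex)
    then show ?case by (simp add: chain_boundary_of)
  next
    case (Suc p)
    define C where "C = carrier_hull h n (Suc p) f"
    define b where "b = chain_boundary (Suc p) (frag_of f)"
    define z where "z = frag_of (affine_simplex (Suc p) (rounded_vertex h n f)) - frag_of (simplex_map (Suc p) h f)
         - frag_extend (rounding_homotopy h n p) b"
    have face: "singular_simplex p (top_of_set S) (singular_face (Suc p) k f)" if "k \<le> Suc p" for k
      using singular_simplex_singular_face[OF Suc.prems _ that] by simp
    have b: "b = (\<Sum>k\<le>Suc p. frag_cmul ((-1) ^ k) (frag_of (singular_face (Suc p) k f)))"
      unfolding b_def by (rule chain_boundary_frag_of_Suc)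
    have bb: "chain_boundary p b = 0"
      unfolding b_def using Suc.prems
      by (intro chain_boundary_boundary_alt[of p "top_of_set S"]) (simp add: singular_chain_of)
    have keys: "\<exists>k\<le>Suc p. g = singular_face (Suc p) k f" if "g \<in> Poly_Mapping.keys b" for g
    proof -
      have "Poly_Mapping.keys b
          \<subseteq> (\<Union>k\<in>{..Suc p}. Poly_Mapping.keys (frag_cmul ((-1) ^ k) (frag_of (singular_face (Suc p) k f))))"
        unfolding b by (rule keys_sum)
      with that have "g \<in> (\<Union>k\<in>{..Suc p}. Poly_Mapping.keys (frag_cmul ((-1) ^ k) (frag_of (singular_face (Suc p) k f))))"
        by (rule subsetD[rotated])
      then show ?thesis by auto
    qed
    have chain: "singular_chain (Suc p) (top_of_set C) z"
      unfolding z_def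
    proof (intro singular_chain_diff)
      show "singular_chain (Suc p) (top_of_set C) (frag_extend (rounding_homotopy h n p) b)"
      proof (rule singular_chain_extend)
        fix g assume "g \<in> Poly_Mapping.keys b"
        then obtain k where k: "k \<le> Suc p" "g = singular_face (Suc p) k f" using keys by blast
        then have "singular_chain (Suc p) (top_of_set (carrier_hull h n p g)) (rounding_homotopy h n p g)"
          using Suc.IH face by blast
        then show "singular_chain (Suc p) (top_of_set C) (rounding_homotopy h n p g)"
          unfolding C_def k(2) by (rule singular_chain_mono) (rule carrier_hull_face[OF k(1)])
      qed
    qed (use singular_simplex_carrier_hull[OF h Suc.prems] in \<open>simp_all add: singular_chain_of C_def\<close>)
    \<comment> \<open>A rounded vertex depends only on the vertex itself, so simplices sharing a
      face are rounded alike and rounding commutes with faces.\<close>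
    have T: "chain_boundary (Suc p) (frag_of (affine_simplex (Suc p) (rounded_vertex h n f)))
        = frag_extend (\<lambda>g. frag_of (affine_simplex p (rounded_vertex h n g))) b"
    proof -
      have "affine_simplex p (rounded_vertex h n f \<circ> skip k)
          = affine_simplex p (rounded_vertex h n (singular_face (Suc p) k f))" for k
        by (rule affine_simplex_cong) (simp add: rounded_vertex_def singular_face_basis_vertex)
      then show ?thesis
        unfolding b chain_boundary_frag_of_Suc
        by (simp add: frag_extend_sum frag_extend_cmul o_def singular_face_affine_simplex del: sum.atMost_Suc)
    qed
    have H: "chain_boundary (Suc p) (frag_of (simplex_map (Suc p) h f))
        = frag_extend (\<lambda>g. frag_of (simplex_map p h g)) b"
      using chain_boundary_chain_map[of "Suc p" "top_of_set S" "frag_of f" h] Suc.prems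
      by (simp add: singular_chain_of b_def chain_map_def o_def)
    \<comment> \<open>The induction hypothesis, extended to \<open>b\<close>, gives the boundary of
      the third term of \<open>z\<close>; it cancels the other two since \<open>b\<close> itself has
      boundary 0.\<close>
    have "chain_boundary (Suc p) (frag_extend (rounding_homotopy h n p) b)
        = frag_extend (\<lambda>g. chain_boundary (Suc p) (rounding_homotopy h n p g)) b"
      by (rule chain_boundary_frag_extend)
    also have "\<dots> = frag_extend (\<lambda>g. frag_of (affine_simplex p (rounded_vertex h n g)) - frag_of (simplex_map p h g)
        - frag_extend (rounding_homotopy h n (p - 1)) (chain_boundary p (frag_of g))) b"
      using Suc.IH face keys by (intro frag_extend_eq) metis
    also have "\<dots> = frag_extend (\<lambda>g. frag_of (affine_simplex p (rounded_vertex h n g))) b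
        - frag_extend (\<lambda>g. frag_of (simplex_map p h g)) b
        - frag_extend (\<lambda>g. frag_extend (rounding_homotopy h n (p - 1)) (chain_boundary p (frag_of g))) b"
      by (simp only: frag_extend_diff_fun)
    also have "frag_extend (\<lambda>g. frag_extend (rounding_homotopy h n (p - 1)) (chain_boundary p (frag_of g))) b
        = frag_extend (rounding_homotopy h n (p - 1)) (chain_boundary p b)"
      by (rule frag_extend_additive) (simp_all add: chain_boundary_diff frag_extend_diff)
    finally have bz: "chain_boundary (Suc p) z = 0"
      unfolding z_def by (simp add: chain_boundary_diff T H bb)
    obtain d where "singular_chain (Suc (Suc p)) (top_of_set C) d" "chain_boundary (Suc (Suc p)) d = z"
    proof (rule convex_cycle_bounds[of C "Suc p" z, OF _ chain bz])
      show "convex C" by (simp add: C_def carrier_hull_def)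
    qed simp
    then have "\<exists>d. singular_chain (Suc (Suc p)) (top_of_set C) d \<and> chain_boundary (Suc (Suc p)) d = z"
      by blast
    then have "singular_chain (Suc (Suc p)) (top_of_set C) (rounding_homotopy h n (Suc p) f)
        \<and> chain_boundary (Suc (Suc p)) (rounding_homotopy h n (Suc p) f) = z"
      unfolding rounding_homotopy.simps C_def z_def b_def by (rule someI_ex)
    then show ?case by (simp add: C_def z_def b_def)
  qed
  then show "singular_chain (Suc p) (top_of_set (carrier_hull h n p f)) (rounding_homotopy h n p f)"
    and "chain_boundary (Suc p) (rounding_homotopy h n p f) =
      frag_of (affine_simplex p (rounded_vertex h n f)) - frag_of (simplex_map p h f)
      - frag_extend (rounding_homotopy h n (p - 1)) (chain_boundary p (frag_of f))"
    by blast+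
qed


section \<open>Reducing cycles to finitely many simplices\<close>

definition small_simplices :: "nat \<Rightarrow> 'a::topological_space set \<Rightarrow> ('a \<Rightarrow> 'e::metric_space) \<Rightarrow> real \<Rightarrow> ((nat \<Rightarrow> real) \<Rightarrow> 'a) set"
  where "small_simplices p S h \<delta> = {f. singular_simplex p (top_of_set S) f \<and>
    (\<exists>a\<in>S. \<forall>x\<in>standard_simplex p. dist (h a) (h (f x)) < \<delta>)}"

lemma field_cycle_small_representative:
  fixes c :: "('a::topological_space, 'k::field) field_chain" and h :: "'a \<Rightarrow> 'e::metric_space"
  assumes h: "continuous_on S h" and "0 < \<delta>" and c: "c \<in> cycles p (top_of_set S)"
  obtains c' b where "Poly_Mapping.keys c' \<subseteq> small_simplices p S h \<delta>" "b \<in> boundaries p (top_of_set S)" "c' = c + b"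
proof -
  define \<C> where "\<C> = (\<lambda>a. {x\<in>S. dist (h a) (h x) < \<delta>}) ` S"
  have "openin (top_of_set S) {x\<in>S. dist (h a) (h x) < \<delta>}" for a
  proof -
    have "{x\<in>S. dist (h a) (h x) < \<delta>} = S \<inter> h -` ball (h a) \<delta>" by auto
    then show ?thesis using h by (simp add: continuous_openin_preimage_gen)
  qed
  then have op: "openin (top_of_set S) U" if "U \<in> \<C>" for U using that by (auto simp: \<C>_def)
  have cover: "topspace (top_of_set S) \<subseteq> \<Union>\<C>" using \<open>0 < \<delta>\<close> by (force simp: \<C>_def)
  have keys: "singular_simplex p (top_of_set S) f" if "f \<in> Poly_Mapping.keys c" for f
    using c that by (auto simp: cycles_eq field_chains_def)
  have "\<exists>n. \<forall>m\<ge>n. \<forall>g\<in>Poly_Mapping.keys ((singular_subdivision p ^^ m) (frag_of f)). \<exists>V\<in>\<C>. g \<in> standard_simplex p \<rightarrow> V"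
    if "f \<in> Poly_Mapping.keys c" for f
  proof -
    have "singular_chain p (top_of_set S) (frag_of f)" using keys that by (simp add: singular_chain_of)
    then show ?thesis
      using sufficient_iterated_singular_subdivision_exists[of \<C> "top_of_set S" p "frag_of f"] op cover by metis
  qed
  then obtain N where N: "\<And>f m g. \<lbrakk>f \<in> Poly_Mapping.keys c; N f \<le> m;
      g \<in> Poly_Mapping.keys ((singular_subdivision p ^^ m) (frag_of f))\<rbrakk> \<Longrightarrow> \<exists>V\<in>\<C>. g \<in> standard_simplex p \<rightarrow> V"
    by metis
  \<comment> \<open>One number of subdivisions for all simplices of \<open>c\<close>; the 0 covers
    the zero chain.\<close>
  define m where "m = Max (insert 0 (N ` Poly_Mapping.keys c))"
  have m: "N f \<le> m" if "f \<in> Poly_Mapping.keys c" for f using that by (auto simp: m_def)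
  obtain H :: "nat \<Rightarrow> 'a chain \<Rightarrow> 'a chain" where H: "\<And>p. H p 0 = 0" "\<And>p c1 c2. H p (c1 - c2) = H p c1 - H p c2"
    "\<And>p X c. singular_chain p X c \<Longrightarrow> singular_chain (Suc p) X (H p c)"
    "\<And>p X c. singular_chain p X c \<Longrightarrow> chain_boundary (Suc p) (H p c) + H (p - Suc 0) (chain_boundary p c)
         = (singular_subdivision p ^^ m) c - c"
    using chain_homotopic_iterated_singular_subdivision[where n = m] by blast
  define E where "E f = (singular_subdivision p ^^ m) (frag_of f)" for f :: "(nat \<Rightarrow> real) \<Rightarrow> 'a"
  define B where "B = field_extend (\<lambda>f. H p (frag_of f)) c"
  have cf: "c \<in> field_chains p (top_of_set S)" "field_boundary p c = 0" using c by (auto simp: cycles_eq)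
  have "B \<in> field_chains (Suc p) (top_of_set S)"
    unfolding B_def by (rule field_extend_in_field_chains[OF cf(1)]) (simp add: H(3) singular_chain_of)
  have "field_boundary (Suc p) B = field_extend (\<lambda>f. chain_boundary (Suc p) (H p (frag_of f))) c"
    unfolding B_def by (rule field_boundary_field_extend)
  also have "\<dots> = field_extend (\<lambda>f. (E f - frag_of f) - H (p - Suc 0) (chain_boundary p (frag_of f))) c"
  proof (rule field_extend_cong)
    fix f assume "f \<in> Poly_Mapping.keys c"
    then have "chain_boundary (Suc p) (H p (frag_of f)) + H (p - Suc 0) (chain_boundary p (frag_of f)) = E f - frag_of f"
      unfolding E_def by (intro H(4)[of _ "top_of_set S"]) (simp add: singular_chain_of keys)
    then show "chain_boundary (Suc p) (H p (frag_of f)) = E f - frag_of f - H (p - Suc 0) (chain_boundary p (frag_of f))"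
      by (simp add: algebra_simps)
  qed
  \<comment> \<open>The last term is the homotopy applied to the boundary of \<open>c\<close>, hence
    0.\<close>
  also have "\<dots> = field_extend E c - c - field_extend (\<lambda>f. H (p - Suc 0) (chain_boundary p (frag_of f))) c"
    by (simp only: field_extend_diff_fun field_extend_frag_of)
  also have "field_extend (\<lambda>f. H (p - Suc 0) (chain_boundary p (frag_of f))) c
      = field_extend (\<lambda>f. H (p - Suc 0) (frag_of f)) (field_boundary p c)"
    unfolding field_extend_field_boundary
    by (simp add: frag_extend_additive[of "H (p - Suc 0)", OF H(1,2)])
  finally have eq: "field_extend E c = c + field_boundary (Suc p) B" by (simp add: cf)
  show ?thesis
  proof
    show "field_boundary (Suc p) B \<in> boundaries p (top_of_set S)"
      unfolding boundaries_eq using \<open>B \<in> _\<close> by blast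
    show "field_extend E c = c + field_boundary (Suc p) B" by (rule eq)
    show "Poly_Mapping.keys (field_extend E c) \<subseteq> small_simplices p S h \<delta>"
    proof
      fix g assume "g \<in> Poly_Mapping.keys (field_extend E c)"
      from subsetD[OF keys_field_extend this]
      obtain f where f: "f \<in> Poly_Mapping.keys c" "g \<in> Poly_Mapping.keys (E f)" by blast
      have "singular_chain p (top_of_set S) ((singular_subdivision p ^^ i) (frag_of f))" for i
        by (induction i) (simp_all add: singular_chain_of keys f singular_chain_singular_subdivision)
      then have "singular_simplex p (top_of_set S) g" using f(2) by (auto simp: E_def singular_chain_def)
      moreover obtain V where "V \<in> \<C>" "g \<in> standard_simplex p \<rightarrow> V" using N[OF f(1) m] f by (auto simp: E_def)
      ultimately show "g \<in> small_simplices p S h \<delta>"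
        by (fastforce simp: small_simplices_def \<C>_def)
    qed
  qed
qed

lemma chain_map_frag_extend: "chain_map p g (frag_extend E c) = frag_extend (\<lambda>x. chain_map p g (E x)) c"
  using frag_extend_additive[of "\<lambda>c. chain_map p g (frag_extend E c)" c]
  by (simp add: frag_extend_diff chain_map_diff)

text \<open>A cycle with small simplices is carried by \<open>h\<close> into \<open>N\<close>,
  deformed there to affine simplices with vertices in \<open>V\<close>, and brought back by
  \<open>\<kappa>\<close>. The deformation stays in \<open>N\<close>, so its image is a chain of
  \<open>T\<close> and the change is a boundary of \<open>T\<close>. There are only finitely many
  choices of vertices.\<close>

lemma rel_finite_cycles_boundaries:
  fixes S T :: "'a::topological_space set" and h :: "'a \<Rightarrow> 'e::real_normed_vector"
  assumes h: "continuous_on S h" and "0 < \<delta>"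
    and \<kappa>: "continuous_on N \<kappa>" "\<kappa> ` N \<subseteq> T" "\<And>x. x \<in> S \<Longrightarrow> \<kappa> (h x) = x"
    and N: "\<And>x. x \<in> S \<Longrightarrow> ball (h x) (2 * \<delta>) \<subseteq> N"
    and V: "finite V" "\<And>x. x \<in> S \<Longrightarrow> n (h x) \<in> V \<and> dist (h x) (n (h x)) < \<delta>"
  shows "field_chain.rel_finite (cycles p (top_of_set S) :: ('a, 'k::field) field_chain set) (boundaries p (top_of_set T))"
proof -
  define F where "F = (\<lambda>w. simplex_map p \<kappa> (affine_simplex p w)) ` ({..p} \<rightarrow>\<^sub>E V)"
  \<comment> \<open>These single simplices are in general not cycles; \<open>rel_finite\<close>
    allows spanning elements from outside.\<close>
  define Q where "Q = (\<lambda>f. Poly_Mapping.single f (1 :: 'k)) ` F"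
  have "finite Q" unfolding Q_def F_def using V(1) by (intro finite_imageI finite_PiE) auto
  have "S \<subseteq> T" using N \<kappa> \<open>0 < \<delta>\<close> by (metis (full_types) centre_in_ball image_subset_iff mult_pos_pos subsetD subsetI zero_less_numeral)
  have hull: "carrier_hull h n p f \<subseteq> N" if f: "f \<in> small_simplices p S h \<delta>" for f
  proof -
    obtain a where a: "a \<in> S" "\<And>x. x \<in> standard_simplex p \<Longrightarrow> dist (h a) (h (f x)) < \<delta>"
      using f by (auto simp: small_simplices_def)
    have fS: "f x \<in> S" if "x \<in> standard_simplex p" for x
      using f that by (auto simp: small_simplices_def singular_simplex_def continuous_map_in_subtopology)
    \<comment> \<open>One \<delta> for the small simplex and one for rounding its vertices; the
      convex hull stays in the ball.\<close>
    have "carrier_hull h n p f \<subseteq> ball (h a) (2 * \<delta>)"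
      unfolding carrier_hull_def
    proof (rule hull_minimal)
      show "(\<lambda>x. h (f x)) ` standard_simplex p \<union> rounded_vertex h n f ` {..p} \<subseteq> ball (h a) (2 * \<delta>)"
      proof (intro Un_least image_subsetI)
        fix x assume "x \<in> standard_simplex p"
        then show "h (f x) \<in> ball (h a) (2 * \<delta>)" using a(2)[of x] \<open>0 < \<delta>\<close> by simp
      next
        fix j assume "j \<in> {..p}"
        then have *: "basis_vertex j \<in> standard_simplex p" by simp
        have "dist (h a) (n (h (f (basis_vertex j))))
            \<le> dist (h a) (h (f (basis_vertex j))) + dist (h (f (basis_vertex j))) (n (h (f (basis_vertex j))))"
          by (rule dist_triangle)
        also have "\<dots> < \<delta> + \<delta>" using a(2)[OF *] V(2)[OF fS[OF *]] by (intro add_strict_mono) auto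
        finally show "rounded_vertex h n f j \<in> ball (h a) (2 * \<delta>)" by (simp add: rounded_vertex_def)
      qed
    qed (rule convex_ball)
    then show ?thesis using N[OF a(1)] by blast
  qed
  have "c \<in> field_chain.span (Q \<union> boundaries p (top_of_set T))" if c: "c \<in> cycles p (top_of_set S)"
    for c :: "('a, 'k) field_chain"
  proof -
    obtain c' b where c': "Poly_Mapping.keys c' \<subseteq> small_simplices p S h \<delta>"
      "b \<in> boundaries p (top_of_set S)" "c' = c + b"
      using field_cycle_small_representative[OF h \<open>0 < \<delta>\<close> c] by blast
    have "b \<in> cycles p (top_of_set S)" using c'(2) boundaries_subset_cycles by blast
    then have cyc: "c' \<in> cycles p (top_of_set S)" unfolding c'(3) using c subspace_cycles
      by (metis field_chain.subspace_add)
    define K where "K f = chain_map (Suc p) \<kappa> (rounding_homotopy h n p f)" for f :: "(nat \<Rightarrow> real) \<Rightarrow> 'a"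
    define A where "A f = simplex_map p \<kappa> (affine_simplex p (rounded_vertex h n f))" for f :: "(nat \<Rightarrow> real) \<Rightarrow> 'a"
    have \<kappa>': "continuous_map (top_of_set N) (top_of_set T) \<kappa>" using \<kappa>(1,2) by (auto simp: continuous_map_in_subtopology)
    have Nchain: "singular_chain (Suc p) (top_of_set N) (rounding_homotopy h n p f)" if "f \<in> Poly_Mapping.keys c'" for f
    proof -
      have f: "f \<in> small_simplices p S h \<delta>" using c'(1) that by blast
      then show ?thesis
        using chain_boundary_rounding_homotopy(1)[OF h, of p f n] hull[OF f]
        by (auto simp: small_simplices_def intro: singular_chain_mono)
    qed
    have KT: "field_extend K c' \<in> field_chains (Suc p) (top_of_set T)"
      using cyc unfolding cycles_eq K_def
      by (intro field_extend_in_field_chains[where p = p and X = "top_of_set S"])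
        (auto intro!: singular_chain_chain_map[OF Nchain \<kappa>'])
    have "field_boundary (Suc p) (field_extend K c') = field_extend (\<lambda>f. chain_boundary (Suc p) (K f)) c'"
      by (rule field_boundary_field_extend)
    also have "\<dots> = field_extend (\<lambda>f. frag_of (A f) - frag_of f
        - chain_map p \<kappa> (frag_extend (rounding_homotopy h n (p - 1)) (chain_boundary p (frag_of f)))) c'"
    proof (rule field_extend_cong)
      fix f assume f: "f \<in> Poly_Mapping.keys c'"
      then have f': "singular_simplex p (top_of_set S) f" using c'(1) by (auto simp: small_simplices_def)
      have "simplex_map p \<kappa> (simplex_map p h f) = simplex_map p (\<kappa> \<circ> h) f"
        by (simp add: simplex_map_compose)
      also have "\<dots> = f" using f' by (rule simplex_map_id_gen) (simp add: \<kappa>(3))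
      finally have "simplex_map p \<kappa> (simplex_map p h f) = f" .
      moreover have "chain_boundary (Suc p) (K f) = chain_map p \<kappa> (chain_boundary (Suc p) (rounding_homotopy h n p f))"
        unfolding K_def using chain_boundary_chain_map[OF Nchain[OF f], of \<kappa>] by simp
      ultimately show "chain_boundary (Suc p) (K f) = frag_of (A f) - frag_of f
        - chain_map p \<kappa> (frag_extend (rounding_homotopy h n (p - 1)) (chain_boundary p (frag_of f)))"
        by (simp add: chain_boundary_rounding_homotopy(2)[OF h f'] chain_map_diff A_def)
    qed
    also have "\<dots> = field_extend (\<lambda>f. frag_of (A f)) c' - c'
        - field_extend (\<lambda>f. chain_map p \<kappa> (frag_extend (rounding_homotopy h n (p - 1)) (chain_boundary p (frag_of f)))) c'"
      by (simp only: field_extend_diff_fun field_extend_frag_of)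
    also have "field_extend (\<lambda>f. chain_map p \<kappa> (frag_extend (rounding_homotopy h n (p - 1)) (chain_boundary p (frag_of f)))) c'
        = field_extend (\<lambda>f. chain_map p \<kappa> (rounding_homotopy h n (p - 1) f)) (field_boundary p c')"
      unfolding field_extend_field_boundary chain_map_frag_extend ..
    also have "field_boundary p c' = 0" using cyc by (simp add: cycles_eq)
    finally have "c = field_extend (\<lambda>f. frag_of (A f)) c' - field_boundary (Suc p) (field_extend K c') - b"
      using c'(3) by (simp add: algebra_simps)
    moreover have "field_boundary (Suc p) (field_extend K c') \<in> boundaries p (top_of_set T)"
      using KT by (auto simp: boundaries_eq)
    moreover have "b \<in> boundaries p (top_of_set T)" using c'(2) boundaries_mono[OF \<open>S \<subseteq> T\<close>] by blast
    moreover have "field_extend (\<lambda>f. frag_of (A f)) c' \<in> field_chain.span Q"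
      unfolding field_extend_def
    proof (intro field_chain.span_sum field_chain.span_scale field_chain.span_base)
      fix f assume "f \<in> Poly_Mapping.keys c'"
      then have f: "singular_simplex p (top_of_set S) f" using c'(1) by (auto simp: small_simplices_def)
      have "rounded_vertex h n f j \<in> V" if "j \<le> p" for j
      proof -
        have "f (basis_vertex j) \<in> S"
          using f that by (auto simp: singular_simplex_def continuous_map_in_subtopology image_subset_iff)
        then show ?thesis using V(2) by (simp add: rounded_vertex_def)
      qed
      \<comment> \<open>Only finitely many vertices matter; restriction makes the vertex function an
        element of the finite set of extensional functions used in \<open>F\<close>.\<close>
      moreover have "affine_simplex p (rounded_vertex h n f) = affine_simplex p (restrict (rounded_vertex h n f) {..p})"
        by (rule affine_simplex_cong) simp
      ultimately have "A f \<in> F" unfolding A_def F_def by (auto intro!: image_eqI[where x = "restrict (rounded_vertex h n f) {..p}"])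
      then show "field_of_chain (frag_of (A f)) \<in> Q" by (simp add: Q_def field_of_chain_frag_of)
    qed
    moreover have "field_chain.span Q \<subseteq> field_chain.span (Q \<union> boundaries p (top_of_set T))"
      by (rule field_chain.span_mono) simp
    ultimately show ?thesis
      by (auto intro!: field_chain.span_diff intro: field_chain.span_base)
  qed
  then show ?thesis unfolding field_chain.rel_finite_def using \<open>finite Q\<close> by blast
qed

text \<open>A finite union of compact convex sets is a neighbourhood retract. Since
  \<open>u < v\<close>, the part \<open>N\<close> of the neighbourhood where the function, extended
  by the retraction, is below \<open>v\<close> is open and contains the compact image of the lower
  sublevel set. This leaves a uniform margin for deformations.\<close>

lemma rel_finite_sublevel:
  fixes \<phi> :: "'a::metric_space \<Rightarrow>\<^sub>C real" and T :: "'e::euclidean_space set set"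
  assumes "simplicial_complex T" "(UNIV :: 'a set) homeomorphic \<Union>T" "u < v"
  shows "field_chain.rel_finite (cycles p (sublevel \<phi> u) :: ('a, 'k::field) field_chain set) (boundaries p (sublevel \<phi> v))"
proof -
  obtain h g where hg: "homeomorphism (UNIV :: 'a set) (\<Union>T) h g" using assms(2) unfolding homeomorphic_def by (elim exE)
  have h: "continuous_on UNIV h" "h x \<in> \<Union>T" "g (h x) = x" and g: "continuous_on (\<Union>T) g" for x
    using hg by (auto simp: homeomorphism_def)
  have T: "finite T" "\<And>C. C \<in> T \<Longrightarrow> compact C" "\<And>C. C \<in> T \<Longrightarrow> convex C"
    using assms(1) unfolding simplicial_complex_def by (auto intro: compact_simplex convex_simplex)
  have cT: "compact (\<Union>T)" using T by (intro compact_Union) auto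
  have "ANR (\<Union>T)" using T by (intro ANR_finite_Union_convex_closed) (auto intro: compact_imp_closed)
  then obtain W where W: "open W" "\<Union>T retract_of W"
    using ANR_imp_absolute_neighbourhood_retract_UNIV[OF _ homeomorphic_refl compact_imp_closed[OF cT]] by blast
  obtain \<rho> where "retraction W (\<Union>T) \<rho>" using W(2) unfolding retract_of_def by blast
  then have \<rho>: "\<Union>T \<subseteq> W" "continuous_on W \<rho>" "\<rho> ` W \<subseteq> \<Union>T" "\<And>x. x \<in> \<Union>T \<Longrightarrow> \<rho> x = x"
    unfolding retraction_def by auto
  define \<kappa> where "\<kappa> = g \<circ> \<rho>"
  have \<kappa>: "continuous_on W \<kappa>" unfolding \<kappa>_def using \<rho> g by (meson continuous_on_compose continuous_on_subset)
  have \<kappa>h: "\<kappa> (h x) = x" for x using \<rho>(4) h by (simp add: \<kappa>_def)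
  define S where "S = {x. apply_bcontfun \<phi> x \<le> u}"
  define N where "N = {w \<in> W. apply_bcontfun \<phi> (\<kappa> w) < v}"
  have \<phi>: "continuous_on UNIV (apply_bcontfun \<phi>)" by (rule continuous_on_apply_bcontfun)
  have "open N"
  proof -
    have "continuous_on W (\<lambda>w. apply_bcontfun \<phi> (\<kappa> w))"
      using continuous_on_compose2[OF \<phi> \<kappa>] by simp
    then have "open (W \<inter> (\<lambda>w. apply_bcontfun \<phi> (\<kappa> w)) -` {..<v})"
      using W(1) by (intro continuous_open_preimage) auto
    moreover have "N = W \<inter> (\<lambda>w. apply_bcontfun \<phi> (\<kappa> w)) -` {..<v}" by (auto simp: N_def)
    ultimately show ?thesis by simp
  qed
  have "closed S" unfolding S_def using \<phi> by (intro closed_Collect_le) auto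
  have "compact (UNIV :: 'a set)" using assms(2) cT homeomorphic_compactness by blast
  then have "compact S" using \<open>closed S\<close> compact_Int_closed by fastforce
  then have chS: "compact (h ` S)" using h(1) by (intro compact_continuous_image) (auto intro: continuous_on_subset)
  have "h ` S \<subseteq> N" using h \<rho>(1) \<open>u < v\<close> by (force simp: N_def S_def \<kappa>h)
  obtain e where e: "0 < e" "\<And>y. y \<in> h ` S \<Longrightarrow> ball y e \<subseteq> N"
  proof (cases "h ` S = {}")
    case False
    obtain e where "0 < e" "(\<Union>y\<in>h ` S. ball y e) \<subseteq> N"
      using compact_subset_open_imp_ball_epsilon_subset[OF chS \<open>open N\<close> \<open>h ` S \<subseteq> N\<close>] by blast
    then show ?thesis using that by blast
  qed (use that[of 1] in auto)
  \<comment> \<open>Balls of radius \<open>2 * \<delta>\<close> around the image of \<open>S\<close>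
    must fit into \<open>N\<close>.\<close>
  define \<delta> where "\<delta> = e / 2"
  have "0 < \<delta>" using e by (simp add: \<delta>_def)
  obtain V where V: "finite V" "V \<subseteq> h ` S" "h ` S \<subseteq> (\<Union>x\<in>V. ball x \<delta>)"
    using compactE_image[OF chS, of "h ` S" "\<lambda>x. ball x \<delta>"] \<open>0 < \<delta>\<close> by force
  define n where "n y = (SOME x. x \<in> V \<and> dist y x < \<delta>)" for y
  have n: "n (h x) \<in> V \<and> dist (h x) (n (h x)) < \<delta>" if "x \<in> S" for x
  proof -
    have "h x \<in> (\<Union>x\<in>V. ball x \<delta>)" using that V(3) by blast
    then have "\<exists>z. z \<in> V \<and> dist (h x) z < \<delta>" by (auto simp: dist_commute)
    then show ?thesis unfolding n_def by (rule someI_ex)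
  qed
  show ?thesis
    unfolding sublevel_def S_def[symmetric]
  proof (rule rel_finite_cycles_boundaries[where n = n])
    show "continuous_on S h" using h(1) by (rule continuous_on_subset) simp
    show "continuous_on N \<kappa>" using \<kappa> by (rule continuous_on_subset) (auto simp: N_def)
    show "\<kappa> ` N \<subseteq> {x. apply_bcontfun \<phi> x \<le> v}" by (auto simp: N_def)
    show "ball (h x) (2 * \<delta>) \<subseteq> N" if "x \<in> S" for x using e(2) that by (simp add: \<delta>_def)
  qed (use \<kappa>h n V \<open>0 < \<delta>\<close> in auto)
qed

section \<open>Invariance under homeomorphisms\<close>

definition field_push :: "nat \<Rightarrow> ('a \<Rightarrow> 'b) \<Rightarrow> ('a, 'k::field) field_chain \<Rightarrow> ('b, 'k) field_chain"
  where "field_push p g = field_extend (\<lambda>f. frag_of (simplex_map p g f))"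

lemma field_push_in_field_chains:
  assumes "continuous_map X Y g" "c \<in> field_chains p X"
  shows "field_push p g c \<in> field_chains p Y"
  unfolding field_push_def
  by (rule field_extend_in_field_chains[OF assms(2)])
    (use assms(1) in \<open>simp add: singular_chain_of singular_simplex_simplex_map\<close>)

lemma field_boundary_push:
  assumes "c \<in> field_chains p X"
  shows "field_boundary p (field_push p g c) = field_push (p - 1) g (field_boundary p c)"
proof -
  have "field_boundary p (field_push p g c)
      = field_extend (\<lambda>f. chain_boundary p (frag_of (simplex_map p g f))) c"
    unfolding field_push_def by (rule field_boundary_field_extend)
  also have "\<dots> = field_extend (\<lambda>f. frag_extend (\<lambda>f. frag_of (simplex_map (p - 1) g f)) (chain_boundary p (frag_of f))) c"
  proof (rule field_extend_cong)
    fix f assume "f \<in> Poly_Mapping.keys c"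
    then have "singular_chain p X (frag_of f)" using assms by (auto simp: field_chains_def singular_chain_of)
    from chain_boundary_chain_map[OF this, of g]
    show "chain_boundary p (frag_of (simplex_map p g f))
        = frag_extend (\<lambda>f. frag_of (simplex_map (p - 1) g f)) (chain_boundary p (frag_of f))"
      by (simp add: chain_map_def o_def)
  qed
  also have "\<dots> = field_push (p - 1) g (field_boundary p c)"
    unfolding field_push_def field_extend_field_boundary ..
  finally show ?thesis .
qed

lemma field_push_cycles:
  assumes "continuous_map X Y g" "c \<in> cycles p X"
  shows "field_push p g c \<in> cycles p Y"
  using assms field_push_in_field_chains[of X Y g c p] field_boundary_push[of c p X g]
  by (auto simp: cycles_eq) (simp add: field_push_def)

lemma field_push_boundaries:
  assumes "continuous_map X Y g" "c \<in> boundaries p X"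
  shows "field_push p g c \<in> boundaries p Y"
proof -
  obtain b where b: "b \<in> field_chains (Suc p) X" "c = field_boundary (Suc p) b"
    using assms(2) by (auto simp: boundaries_eq)
  then have "field_push p g c = field_boundary (Suc p) (field_push (Suc p) g b)"
    by (simp add: field_boundary_push[of b "Suc p" X])
  then show ?thesis
    using field_push_in_field_chains[OF assms(1) b(1)] by (auto simp: boundaries_eq)
qed

lemma field_push_inverse:
  assumes "c \<in> field_chains p X" "\<And>x. x \<in> topspace X \<Longrightarrow> g' (g x) = x"
  shows "field_push p g' (field_push p g c) = c"
proof -
  have "field_push p g' (field_push p g c) = field_extend (\<lambda>f. frag_of (simplex_map p g' (simplex_map p g f))) c"
    by (simp add: field_push_def field_extend_compose)
  also have "\<dots> = field_extend frag_of c"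
  proof (rule field_extend_cong)
    fix f assume "f \<in> Poly_Mapping.keys c"
    then have "singular_simplex p X f" using assms(1) by (auto simp: field_chains_def)
    then have "simplex_map p (g' \<circ> g) f = f" by (rule simplex_map_id_gen) (simp add: assms(2))
    then show "frag_of (simplex_map p g' (simplex_map p g f)) = frag_of f" by (simp add: simplex_map_compose)
  qed
  finally show ?thesis by (simp add: field_extend_frag_of)
qed

text \<open>A spanning set of the cycles of \<open>S\<close> modulo the boundaries of
  \<open>T\<close> is pushed forward by \<open>g\<close>. Its image spans because every cycle of
  \<open>S'\<close> is the push of its image under the right inverse \<open>g'\<close>. Exchanging
  the roles of the two maps yields equality for homeomorphisms.\<close>

lemma rel_dim_push_le:
  fixes S T :: "'a::topological_space set" and S' T' :: "'b::topological_space set"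
  assumes fin: "field_chain.rel_finite (cycles p (top_of_set S) :: ('a, 'k::field) field_chain set) (boundaries p (top_of_set T))"
    and "continuous_map (top_of_set S) (top_of_set S') g" "continuous_map (top_of_set T) (top_of_set T') g"
    and g': "continuous_map (top_of_set S') (top_of_set S) g'" "\<And>x. x \<in> S' \<Longrightarrow> g (g' x) = x"
  shows "field_chain.rel_dim (cycles p (top_of_set S') :: ('b, 'k) field_chain set) (boundaries p (top_of_set T'))
    \<le> field_chain.rel_dim (cycles p (top_of_set S) :: ('a, 'k) field_chain set) (boundaries p (top_of_set T))"
proof -
  let ?Z = "cycles p (top_of_set S) :: ('a, 'k) field_chain set"
  let ?N = "boundaries p (top_of_set T) :: ('a, 'k) field_chain set"
  let ?Z' = "cycles p (top_of_set S') :: ('b, 'k) field_chain set"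
  let ?N' = "boundaries p (top_of_set T') :: ('b, 'k) field_chain set"
  obtain F where F: "finite F" "card F = field_chain.rel_dim ?Z ?N" "F \<subseteq> ?Z" "?Z \<subseteq> field_chain.span (F \<union> ?N)"
    using field_chain.rel_dim_witness[of ?Z ?N] fin unfolding span_boundaries by blast
  let ?g = "field_push p g :: ('a, 'k) field_chain \<Rightarrow> ('b, 'k) field_chain"
  interpret G: Vector_Spaces.linear field_scale field_scale ?g
    unfolding field_push_def by (rule linear_field_extend)
  have "?Z' \<subseteq> field_chain.span (?g ` F \<union> ?N')"
  proof
    fix c assume c: "c \<in> ?Z'"
    then have "field_push p g' c \<in> ?Z" by (rule field_push_cycles[OF g'(1)])
    moreover have "?g (field_push p g' c) = c"
      by (rule field_push_inverse[of _ _ "top_of_set S'"]) (use c g'(2) in \<open>auto simp: cycles_eq\<close>)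
    ultimately have "c \<in> ?g ` field_chain.span (F \<union> ?N)" using F(4) by (metis imageI subsetD)
    also have "?g ` field_chain.span (F \<union> ?N) = field_chain.span (?g ` (F \<union> ?N))"
      by (simp add: G.span_image)
    also have "\<dots> \<subseteq> field_chain.span (?g ` F \<union> ?N')"
      using field_push_boundaries[OF assms(3)] by (intro field_chain.span_mono) blast
    finally show "c \<in> field_chain.span (?g ` F \<union> ?N')" .
  qed
  moreover have "?g ` F \<subseteq> ?Z'" using F(3) field_push_cycles[OF assms(2)] by blast
  ultimately have "field_chain.rel_dim ?Z' ?N' \<le> card (?g ` F)" using F(1) by (intro field_chain.rel_dim_le) auto
  also have "\<dots> \<le> card F" using F(1) by (rule card_image_le)
  finally show ?thesis using F(2) by simp
qed

section \<open>The rank function of a continuous function\<close>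

definition sublevel_set :: "('a::topological_space \<Rightarrow>\<^sub>C real) \<Rightarrow> real \<Rightarrow> 'a set"
  where "sublevel_set \<phi> t = {x. apply_bcontfun \<phi> x \<le> t}"

lemma sublevel_eq: "sublevel \<phi> t = top_of_set (sublevel_set \<phi> t)"
  by (simp add: sublevel_def sublevel_set_def)

lemma sublevel_set_mono: "s \<le> t \<Longrightarrow> sublevel_set \<phi> s \<subseteq> sublevel_set \<phi> t"
  by (auto simp: sublevel_set_def)

definition inclusion_rank :: "'k::field itself \<Rightarrow> nat \<Rightarrow> 'a::topological_space set \<Rightarrow> 'a set \<Rightarrow> nat"
  where "inclusion_rank K k S T =
    field_chain.rel_dim (cycles k (top_of_set S) :: ('a, 'k) field_chain set) (boundaries k (top_of_set T))"

definition inclusion_finite :: "'k::field itself \<Rightarrow> nat \<Rightarrow> 'a::topological_space set \<Rightarrow> 'a set \<Rightarrow> bool"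
  where "inclusion_finite K k S T \<longleftrightarrow>
    field_chain.rel_finite (cycles k (top_of_set S) :: ('a, 'k) field_chain set) (boundaries k (top_of_set T))"

lemma inclusion_finite_mono:
  "\<lbrakk>inclusion_finite K k S T; S' \<subseteq> S; T \<subseteq> T'\<rbrakk> \<Longrightarrow> inclusion_finite K k S' T'"
  unfolding inclusion_finite_def by (meson boundaries_mono cycles_mono field_chain.rel_finite_mono)

lemma inclusion_rank_mono:
  assumes "inclusion_finite K k S T" "S' \<subseteq> S"
  shows "inclusion_rank K k S' T \<le> inclusion_rank K k S T"
  unfolding inclusion_rank_def
  by (rule field_chain.rel_dim_mono[where N = "boundaries k (top_of_set T)", unfolded span_boundaries])
    (use assms cycles_mono in \<open>simp_all add: inclusion_finite_def\<close>)

lemma inclusion_rank_box_nonneg: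
  assumes "inclusion_finite K k S T" "S' \<subseteq> S" "T \<subseteq> T'"
  shows "0 \<le> int (inclusion_rank K k S T) - int (inclusion_rank K k S' T)
    - int (inclusion_rank K k S T') + int (inclusion_rank K k S' T')"
  unfolding inclusion_rank_def
  by (rule field_chain.rel_dim_box_nonneg[where N = "boundaries k (top_of_set T)"
        and N' = "boundaries k (top_of_set T')", unfolded span_boundaries])
    (use assms cycles_mono boundaries_mono in \<open>simp_all add: inclusion_finite_def\<close>)

lemma persistent_betti_eq_inclusion_rank:
  assumes "u \<le> v" "inclusion_finite K k (sublevel_set \<phi> u) (sublevel_set \<phi> v)"
  shows "persistent_betti K k \<phi> u v = inclusion_rank K k (sublevel_set \<phi> u) (sublevel_set \<phi> v)"
  unfolding persistent_betti_def sublevel_eq inclusion_rank_def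
  by (rule dim_inclusion_image)
    (use assms sublevel_set_mono in \<open>simp_all add: inclusion_finite_def\<close>)

lemma inclusion_rank_homeomorphic:
  fixes g :: "'a::topological_space \<Rightarrow> 'a"
  assumes g: "homeomorphic_map euclidean euclidean g"
    and fin: "inclusion_finite K k S T" "inclusion_finite K k (g -` S) (g -` T)"
  shows "inclusion_rank K k (g -` S) (g -` T) = inclusion_rank K k S T"
proof -
  obtain g' where "homeomorphic_maps euclidean euclidean g g'"
    using g unfolding homeomorphic_map_maps by blast
  then have g': "continuous_on UNIV g" "continuous_on UNIV g'" "\<And>x. g' (g x) = x" "\<And>x. g (g' x) = x"
    by (auto simp: homeomorphic_maps_def)
  have c: "continuous_map (top_of_set (g -` A)) (top_of_set A) g"
    "continuous_map (top_of_set A) (top_of_set (g -` A)) g'" for A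
    using g' by (auto simp: continuous_map_in_subtopology intro: continuous_on_subset)
  show ?thesis
    unfolding inclusion_rank_def
    by (rule antisym)
      (rule rel_dim_push_le[OF fin(1)[unfolded inclusion_finite_def] c(2) c(2) c(1) g'(3)]
        rel_dim_push_le[OF fin(2)[unfolded inclusion_finite_def] c(1) c(1) c(2) g'(4)])+
qed

lemma sublevel_set_comp:
  "continuous_on UNIV g \<Longrightarrow> sublevel_set (\<phi> \<circ>\<^sub>C g) t = g -` sublevel_set \<phi> t"
  by (auto simp: sublevel_set_def apply_bcontfun_comp)

text \<open>All intervals are cut off at \<open>L\<close>. For large \<open>L\<close> this turns a point \<open>(u, \<infinity>)\<close> of the
  diagram into the point \<open>(u, L)\<close> and changes no other point.\<close>

definition cut_rank ::
    "'k::field itself \<Rightarrow> nat \<Rightarrow> real \<Rightarrow> ('a::topological_space \<Rightarrow>\<^sub>C real) \<Rightarrow> real \<Rightarrow> real \<Rightarrow> int"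
  where "cut_rank K k L \<phi> u v =
    (if u < v \<and> v < L then int (inclusion_rank K k (sublevel_set \<phi> u) (sublevel_set \<phi> v)) else 0)"

definition persistence_finite :: "'k::field itself \<Rightarrow> nat \<Rightarrow> ('a::topological_space \<Rightarrow>\<^sub>C real) \<Rightarrow> bool"
  where "persistence_finite K k \<phi> \<longleftrightarrow>
    (\<forall>u v. u < v \<longrightarrow> inclusion_finite K k (sublevel_set \<phi> u) (sublevel_set \<phi> v))"

text \<open>Below the cut this is the inequality for relative dimensions. If only \<open>d\<close>
  reaches \<open>L\<close>, the two terms with \<open>d\<close> vanish and monotonicity of the rank
  in the smaller space remains; if \<open>c\<close> does too, all terms vanish.\<close>

lemma persistence_rank_cut_rank:
  assumes "persistence_finite K k \<phi>"
  shows "persistence_rank (cut_rank K k L \<phi>)"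
proof
  fix a b c d :: real assume *: "a \<le> b" "b < c" "c \<le> d"
  have fin: "inclusion_finite K k (sublevel_set \<phi> b) (sublevel_set \<phi> c)"
    using assms * by (simp add: persistence_finite_def)
  have sub: "sublevel_set \<phi> a \<subseteq> sublevel_set \<phi> b" "sublevel_set \<phi> c \<subseteq> sublevel_set \<phi> d"
    using * by (simp_all add: sublevel_set_mono)
  show "0 \<le> cut_rank K k L \<phi> b c - cut_rank K k L \<phi> a c - cut_rank K k L \<phi> b d + cut_rank K k L \<phi> a d"
    using * inclusion_rank_box_nonneg[OF fin sub] inclusion_rank_mono[OF fin sub(1)]
    by (auto simp: cut_rank_def)
qed

lemma persistent_betti_cut_rank:
  assumes "persistence_finite K k \<phi>" "u < v" "v < L"
  shows "int (persistent_betti K k \<phi> u v) = cut_rank K k L \<phi> u v"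
  using assms persistent_betti_eq_inclusion_rank[of u v K k \<phi>]
  by (simp add: cut_rank_def persistence_finite_def)

section \<open>Evaluating the multiplicities of the persistence diagram\<close>

lemma the_nat_limit_eq:
  fixes f :: "real \<Rightarrow> int"
  assumes "0 < s" "\<And>x. \<lbrakk>0 < x; x \<le> s\<rbrakk> \<Longrightarrow> f x = int n"
  shows "filterlim f (nhds (int m)) (at_right 0) \<longleftrightarrow> m = n"
proof
  have "\<forall>\<^sub>F x in at_right 0. f x = int n"
    using assms by (intro eventually_at_right_less[THEN eventually_mono] eventually_at_rightI[of 0 s]) auto
  then have lim: "filterlim f (nhds (int n)) (at_right 0)" by (rule tendsto_eventually)
  show "m = n" if "filterlim f (nhds (int m)) (at_right 0)"
    using tendsto_unique[OF _ that lim] by simp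
  show "filterlim f (nhds (int m)) (at_right 0)" if "m = n" using lim that by simp
qed

text \<open>In squares small enough to stay below \<open>L\<close> the Betti numbers agree with
  \<open>cut_rank\<close>, and the counts are constant; the limit is therefore this
  constant.\<close>

lemma finite_multiplicity_eq_mult:
  assumes fin: "persistence_finite K k \<phi>" and "u < v" "v < L"
  shows "finite_multiplicity K k \<phi> u v = persistence_rank.mult (cut_rank K k L \<phi>) u v"
proof -
  interpret persistence_rank "cut_rank K k L \<phi>" using fin by (rule persistence_rank_cut_rank)
  obtain s where s: "0 < s" "2 * s < v - u"
    "\<And>t. \<lbrakk>0 < t; t \<le> s\<rbrakk> \<Longrightarrow> box (u - t) (u + t) (v - t) (v + t) = int (mult u v)"
    using mult_small_squares[OF \<open>u < v\<close>] by blast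
  define t where "t = min s ((L - v) / 2)"
  have t: "0 < t" "t \<le> s" "v + t < L" using s(1) \<open>v < L\<close> by (auto simp: t_def min_def field_simps)
  let ?r = "\<lambda>s t. int (persistent_betti K k \<phi> s t)"
  have "?r (u + x) (v - x) - ?r (u - x) (v - x) - ?r (u + x) (v + x) + ?r (u - x) (v + x) = int (mult u v)"
    if x: "0 < x" "x \<le> t" for x
  proof -
    have "?r (u + x) (v - x) = cut_rank K k L \<phi> (u + x) (v - x)"
      "?r (u - x) (v - x) = cut_rank K k L \<phi> (u - x) (v - x)"
      "?r (u + x) (v + x) = cut_rank K k L \<phi> (u + x) (v + x)"
      "?r (u - x) (v + x) = cut_rank K k L \<phi> (u - x) (v + x)"
      by (rule persistent_betti_cut_rank[OF fin]; use x t s \<open>u < v\<close> in linarith)+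
    then show ?thesis using s(3)[of x] x t by (simp add: box_def)
  qed
  then have *: "filterlim (\<lambda>x. ?r (u + x) (v - x) - ?r (u - x) (v - x) - ?r (u + x) (v + x) + ?r (u - x) (v + x)) (nhds (int m)) (at_right 0) \<longleftrightarrow> m = mult u v" for m
    using t(1) by (intro the_nat_limit_eq)
  show ?thesis by (simp add: finite_multiplicity_def Let_def *)
qed

lemma sublevel_set_UNIV:
  assumes "(SUP x. apply_bcontfun \<phi> x) \<le> t"
  shows "sublevel_set \<phi> t = UNIV"
proof -
  have "bdd_above (range (apply_bcontfun \<phi>))"
    by (rule bounded_imp_bdd_above) simp
  then have "apply_bcontfun \<phi> x \<le> t" for x using assms cSUP_upper[of x UNIV "apply_bcontfun \<phi>"] by fastforce
  then show ?thesis by (simp add: sublevel_set_def)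
qed

lemma cut_rank_const:
  assumes "(SUP x. apply_bcontfun \<phi> x) \<le> v" "(SUP x. apply_bcontfun \<phi> x) \<le> w" "u < v" "u < w" "v < L" "w < L"
  shows "cut_rank K k L \<phi> u v = cut_rank K k L \<phi> u w"
  using assms by (simp add: cut_rank_def sublevel_set_UNIV)

text \<open>Above the supremum of the function the upper sublevel set is the whole space, so the
  rank does not depend on the death level except for the drop to 0 at \<open>L\<close>. The square
  is chosen so small that its death levels stay above the supremum and on one side of
  \<open>L\<close>.\<close>

lemma cut_rank_above_mult:
  assumes fin: "persistence_finite K k \<phi>" and "u < v" "(SUP x. apply_bcontfun \<phi> x) < v" "v \<noteq> L"
  shows "persistence_rank.mult (cut_rank K k L \<phi>) u v = 0"
proof -
  interpret persistence_rank "cut_rank K k L \<phi>" using fin by (rule persistence_rank_cut_rank)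
  obtain s where s: "0 < s" "2 * s < v - u"
    "\<And>t. \<lbrakk>0 < t; t \<le> s\<rbrakk> \<Longrightarrow> box (u - t) (u + t) (v - t) (v + t) = int (mult u v)"
    using mult_small_squares[OF \<open>u < v\<close>] by blast
  define M where "M = (SUP x. apply_bcontfun \<phi> x)"
  define t where "t = Min {s, (v - M) / 2, \<bar>L - v\<bar> / 2}"
  have "0 < v - M" "0 < \<bar>L - v\<bar>" using assms by (auto simp: M_def)
  then have "0 < t" using s(1) by (auto simp: t_def)
  moreover have "t \<le> s" "t \<le> (v - M) / 2" "t \<le> \<bar>L - v\<bar> / 2" unfolding t_def by (rule Min_le; simp)+
  ultimately have t: "0 < t" "t \<le> s" "t \<le> (v - M) / 2" "t \<le> \<bar>L - v\<bar> / 2" by auto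
  have t': "M \<le> v - t" "t < \<bar>L - v\<bar>" using t \<open>0 < v - M\<close> \<open>0 < \<bar>L - v\<bar>\<close> by (auto simp: field_simps)
  have "cut_rank K k L \<phi> x (v - t) = cut_rank K k L \<phi> x (v + t)" if "x < v - t" for x
  proof (cases "v < L")
    case True
    then show ?thesis using t t' that by (intro cut_rank_const) (auto simp flip: M_def)
  next
    case False
    then show ?thesis using t t' by (auto simp: cut_rank_def)
  qed
  from this[of "u - t"] this[of "u + t"] have "box (u - t) (u + t) (v - t) (v + t) = 0"
    using t s by (simp add: box_def)
  then show ?thesis using s(3)[of t] t by simp
qed

text \<open>In a square around \<open>(u, L)\<close> the terms with death level above
  \<open>L\<close> vanish. What remains is the difference of ranks into the whole space, which is
  the one defining the multiplicity at infinity and is the same for every large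
  \<open>w\<close>.\<close>

lemma infinite_multiplicity_eq_mult:
  assumes fin: "persistence_finite K k \<phi>" and L: "(SUP x. apply_bcontfun \<phi> x) < L" and "u < L"
  shows "infinite_multiplicity K k \<phi> u = persistence_rank.mult (cut_rank K k L \<phi>) u L"
proof -
  interpret persistence_rank "cut_rank K k L \<phi>" using fin by (rule persistence_rank_cut_rank)
  define M where "M = (SUP x. apply_bcontfun \<phi> x)"
  obtain s where s: "0 < s" "2 * s < L - u"
    "\<And>t. \<lbrakk>0 < t; t \<le> s\<rbrakk> \<Longrightarrow> box (u - t) (u + t) (L - t) (L + t) = int (mult u L)"
    using mult_small_squares[OF \<open>u < L\<close>] by blast
  let ?r = "\<lambda>s t. int (persistent_betti K k \<phi> s t)"
  have *: "filterlim (\<lambda>x. ?r (u + x) w - ?r (u - x) w) (nhds (int m)) (at_right 0) \<longleftrightarrow> m = mult u L"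
    if w: "w > max u M" for w m
  proof -
    define t where "t = Min {s, (w - u) / 2, L - M}"
    have "0 < t" using s(1) w L by (auto simp: t_def M_def)
    moreover have "t \<le> s" "t \<le> (w - u) / 2" "t \<le> L - M" unfolding t_def by (rule Min_le; simp)+
    ultimately have t: "0 < t" "t \<le> s" "t \<le> (w - u) / 2" "t \<le> L - M" by auto
    have "?r (u + x) w - ?r (u - x) w = int (mult u L)" if x: "0 < x" "x \<le> t" for x
    proof -
      have less: "u + x < w" "u - x < w" "u + x < L - x" "u - x < L - x" "M \<le> L - x" "M \<le> w"
        using x t s w by (auto simp: field_simps)
      have "?r y w = cut_rank K k L \<phi> y (L - x)" if "y < w" "y < L - x" for y
      proof -
        have "?r y w = int (inclusion_rank K k (sublevel_set \<phi> y) (sublevel_set \<phi> w))"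
          using fin that by (simp add: persistent_betti_eq_inclusion_rank persistence_finite_def)
        then show ?thesis using that x less by (simp add: cut_rank_def sublevel_set_UNIV flip: M_def)
      qed
      then show ?thesis using s(3)[of x] x t less by (simp add: box_def cut_rank_def)
    qed
    then show ?thesis using t(1) by (intro the_nat_limit_eq)
  qed
  have "(\<forall>w>max u M. filterlim (\<lambda>x. ?r (u + x) w - ?r (u - x) w) (nhds (int m)) (at_right 0)) \<longleftrightarrow> m = mult u L" (is "?lhs \<longleftrightarrow> _") for m
  proof
    have "max u M < max u M + 1" by simp
    moreover assume ?lhs
    ultimately show "m = mult u L" using * by blast
  next
    assume "m = mult u L"
    then show ?lhs using * by blast
  qed
  then show ?thesis by (simp add: infinite_multiplicity_def Let_def M_def)
qed

lemma infinite_multiplicity_above: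
  assumes "(SUP x. apply_bcontfun \<phi> x) < u"
  shows "infinite_multiplicity K k \<phi> u = 0"
proof -
  define M where "M = (SUP x. apply_bcontfun \<phi> x)"
  let ?r = "\<lambda>s t. int (persistent_betti K k \<phi> s t)"
  have *: "filterlim (\<lambda>x. ?r (u + x) w - ?r (u - x) w) (nhds (int m)) (at_right 0) \<longleftrightarrow> m = 0" for w m
  proof (rule the_nat_limit_eq)
    show "0 < u - M" using assms by (simp add: M_def)
    fix x assume "0 < x" "x \<le> u - M"
    then have "sublevel \<phi> (u + x) = sublevel \<phi> (u - x)"
      by (simp add: sublevel_eq sublevel_set_UNIV flip: M_def)
    then show "?r (u + x) w - ?r (u - x) w = int 0" by (simp add: persistent_betti_def)
  qed
  have "(\<forall>w>max u M. filterlim (\<lambda>x. ?r (u + x) w - ?r (u - x) w) (nhds (int m)) (at_right 0)) \<longleftrightarrow> m = 0" (is "?lhs \<longleftrightarrow> _") for m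
  proof
    have "max u M < max u M + 1" by simp
    moreover assume ?lhs
    ultimately show "m = 0" using * by blast
  next
    assume "m = 0"
    then show ?lhs using * by blast
  qed
  then show ?thesis by (simp add: infinite_multiplicity_def Let_def M_def)
qed

lemma finite_multiplicity_above:
  assumes "(SUP x. apply_bcontfun \<phi> x) < v"
  shows "finite_multiplicity K k \<phi> u v = 0"
proof -
  define M where "M = (SUP x. apply_bcontfun \<phi> x)"
  let ?r = "\<lambda>s t. int (persistent_betti K k \<phi> s t)"
  have "filterlim (\<lambda>x. ?r (u + x) (v - x) - ?r (u - x) (v - x) - ?r (u + x) (v + x) + ?r (u - x) (v + x)) (nhds (int m)) (at_right 0) \<longleftrightarrow> m = 0" for m
  proof (rule the_nat_limit_eq)
    show "0 < v - M" using assms by (simp add: M_def)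
    fix x assume "0 < x" "x \<le> v - M"
    then have "sublevel \<phi> (v + x) = sublevel \<phi> (v - x)"
      by (simp add: sublevel_eq sublevel_set_UNIV flip: M_def)
    then show "?r (u + x) (v - x) - ?r (u - x) (v - x) - ?r (u + x) (v + x) + ?r (u - x) (v + x) = int 0"
      by (simp add: persistent_betti_def)
  qed
  then show ?thesis by (simp add: finite_multiplicity_def Let_def)
qed

text \<open>The dictionary between the diagram and the points of \<open>cut_rank\<close>. As
  \<open>L\<close> exceeds the supremum, no finite point of the diagram has death \<open>L\<close>,
  so this value is free to encode infinity.\<close>

lemma occurrences_persistence_diagram:
  assumes fin: "persistence_finite K k \<phi>" and L: "(SUP x. apply_bcontfun \<phi> x) < L"
  shows "((u, v), i) \<in> occurrences (persistence_diagram K k \<phi>) \<longleftrightarrow>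
    v = ereal u \<or> (\<exists>w. ((u, w), i) \<in> persistence_rank.point_copies (cut_rank K k L \<phi>) \<and>
      v = (if w = L then \<infinity> else ereal w))"
proof -
  interpret persistence_rank "cut_rank K k L \<phi>" using fin by (rule persistence_rank_cut_rank)
  show ?thesis
  proof (cases v)
    case PInf
    have "infinite_multiplicity K k \<phi> u = (if u < L then mult u L else 0)"
      using infinite_multiplicity_eq_mult[OF fin L] infinite_multiplicity_above[of \<phi> u] L by auto
    then show ?thesis
      using PInf by (auto simp: occurrences_def persistence_diagram_def point_copies_def)
  next
    case MInf
    then show ?thesis
      by (auto simp: occurrences_def persistence_diagram_def zero_enat_def)
  next
    case (real w)
    show ?thesis
    proof (cases "w = L")
      case True
      then show ?thesis
        using real L finite_multiplicity_above[of \<phi> L K k u]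
        by (auto simp: occurrences_def persistence_diagram_def zero_enat_def)
    next
      case False
      have "finite_multiplicity K k \<phi> u w = mult u w" if "u < w"
      proof (cases "w < L")
        case True
        then show ?thesis using finite_multiplicity_eq_mult[OF fin that] by simp
      next
        case wL: False
        then show ?thesis
          using that False L finite_multiplicity_above[of \<phi> w] cut_rank_above_mult[OF fin that] by simp
      qed
      then show ?thesis
        using real False by (auto simp: occurrences_def persistence_diagram_def point_copies_def zero_enat_def)
    qed
  qed
qed

section \<open>Uniform finiteness of the matching distance\<close>

lemma point_copies_injection:
  fixes \<phi> \<psi> :: "'a::topological_space \<Rightarrow>\<^sub>C real"
  assumes fin: "persistence_finite K k \<phi>" "persistence_finite K k \<psi>" and \<epsilon>: "dist \<phi> \<psi> < \<epsilon>"
  obtains f where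
    "inj_on f {((u, v), i) \<in> persistence_rank.point_copies (cut_rank K k L \<phi>). 6 * \<epsilon> \<le> v - u}"
    "\<And>u v i. \<lbrakk>((u, v), i) \<in> persistence_rank.point_copies (cut_rank K k L \<phi>); 6 * \<epsilon> \<le> v - u\<rbrakk>
      \<Longrightarrow> \<exists>u' v' i'. f ((u, v), i) = ((u', v'), i')
          \<and> ((u', v'), i') \<in> persistence_rank.point_copies (cut_rank K k L \<psi>)
          \<and> \<bar>u - u'\<bar> \<le> 3 * \<epsilon> \<and> \<bar>v - v'\<bar> \<le> 3 * \<epsilon>"
proof -
  interpret A: persistence_rank "cut_rank K k L \<phi>" using fin(1) by (rule persistence_rank_cut_rank)
  interpret B: persistence_rank "cut_rank K k L \<psi>" using fin(2) by (rule persistence_rank_cut_rank)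
  have "0 < \<epsilon>" using \<epsilon> zero_le_dist[of \<phi> \<psi>] by linarith
  define C where "C = fst ` A.points \<union> snd ` A.points \<union> fst ` B.points \<union> snd ` B.points"
  have "countable C" using A.countable_points B.countable_points by (auto simp: C_def)
  then have "countable ((\<lambda>(x, j). x - of_int j * \<epsilon>) ` (C \<times> (UNIV :: int set)))"
    by (intro countable_image countable_SIGMA) auto
  \<comment> \<open>Countably many coordinates exclude only countably many origins of the
    grid.\<close>
  then obtain \<alpha> where \<alpha>: "\<alpha> \<notin> (\<lambda>(x, j). x - of_int j * \<epsilon>) ` (C \<times> (UNIV :: int set))"
    using uncountable_UNIV_real by (metis UNIV_eq_I)
  have generic: "x \<noteq> \<alpha> + of_int j * \<epsilon>" if "x \<in> C" for x j
  proof
    assume "x = \<alpha> + of_int j * \<epsilon>"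
    then have "\<alpha> = (\<lambda>(x, j). x - of_int j * \<epsilon>) (x, j)" by simp
    then show False using \<alpha> that by blast
  qed
  define t where "t j = \<alpha> + of_int j * \<epsilon>" for j
  have t_mono: "t i \<le> t j" if "i \<le> j" for i j using that \<open>0 < \<epsilon>\<close> by (simp add: t_def mult_right_mono)
  have t_less: "t i < t j \<longleftrightarrow> i < j" for i j using \<open>0 < \<epsilon>\<close> by (simp add: t_def)
  define S where "S j = sublevel_set (if even j then \<phi> else \<psi>) (t j)" for j :: int
  have near: "apply_bcontfun \<phi> x \<le> apply_bcontfun \<psi> x + dist \<phi> \<psi>"
    "apply_bcontfun \<psi> x \<le> apply_bcontfun \<phi> x + dist \<phi> \<psi>" for x
    using dist_bounded[of \<phi> x \<psi>] by (auto simp: dist_real_def)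
  have S_step: "S i \<subseteq> sublevel_set (if even j then \<phi> else \<psi>) (t i + dist \<phi> \<psi>)" for i j :: int
  proof
    fix x assume "x \<in> S i"
    then have "apply_bcontfun (if even i then \<phi> else \<psi>) x \<le> t i"
      by (simp only: S_def sublevel_set_def mem_Collect_eq)
    then have "apply_bcontfun (if even j then \<phi> else \<psi>) x \<le> t i + dist \<phi> \<psi>"
      using near[of x] zero_le_dist[of \<phi> \<psi>] by (auto split: if_splits)
    then show "x \<in> sublevel_set (if even j then \<phi> else \<psi>) (t i + dist \<phi> \<psi>)"
      by (simp only: sublevel_set_def mem_Collect_eq)
  qed
  have t_Suc: "t i + dist \<phi> \<psi> < t (i + 1)" for i using \<epsilon> by (simp add: t_def algebra_simps)
  have S_mono: "S (i - 1) \<subseteq> S i" for i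
  proof -
    have "S (i - 1) \<subseteq> sublevel_set (if even i then \<phi> else \<psi>) (t (i - 1) + dist \<phi> \<psi>)" by (rule S_step)
    also have "\<dots> \<subseteq> S i" unfolding S_def using t_Suc[of "i - 1"] by (intro sublevel_set_mono) simp
    finally show ?thesis .
  qed
  \<comment> \<open>The inclusion factors through a sublevel set of the function defining
    \<open>S j\<close>, at a level strictly below \<open>t j\<close>; finiteness is known only for
    two levels of one function.\<close>
  have S_fin: "inclusion_finite K k (S i) (S j)" if "i < j" for i j
  proof -
    have "t (i + 1) \<le> t j" using that by (intro t_mono) simp
    then have "t i + dist \<phi> \<psi> < t j" using t_Suc[of i] by linarith
    then have "inclusion_finite K k (sublevel_set (if even j then \<phi> else \<psi>) (t i + dist \<phi> \<psi>)) (S j)"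
      using fin unfolding S_def persistence_finite_def by simp
    then show ?thesis using S_step[of i j] by (rule inclusion_finite_mono) simp
  qed
  \<comment> \<open>Cut at the same \<open>L\<close> as both rank functions, so that
    \<open>R\<close> agrees with them at even and at odd indices.\<close>
  define R where "R i j = (if i < j \<and> t j < L then int (inclusion_rank K k (S i) (S j)) else 0)" for i j
  have nonneg: "0 \<le> grid_rank R i j" if "i < j - 1" for i j
  proof -
    have "t (j - 1) \<le> t j" by (rule t_mono) simp
    then show ?thesis
      using that inclusion_rank_box_nonneg[OF S_fin[of i "j - 1"] S_mono[of i] S_mono[of j]]
        inclusion_rank_mono[OF S_fin[of i "j - 1"] S_mono[of i]]
      by (auto simp: grid_rank_def R_def)
  qed
  show ?thesis
  proof (rule interleaved_point_copies[OF A.persistence_rank_axioms B.persistence_rank_axioms \<open>0 < \<epsilon>\<close>, of \<alpha> R])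
    show "u \<noteq> \<alpha> + of_int j * \<epsilon> \<and> v \<noteq> \<alpha> + of_int j * \<epsilon>" if "(u, v) \<in> A.points" for u v j
      using that generic by (force simp: C_def)
    show "u \<noteq> \<alpha> + of_int j * \<epsilon> \<and> v \<noteq> \<alpha> + of_int j * \<epsilon>" if "(u, v) \<in> B.points" for u v j
      using that generic by (force simp: C_def)
    show "R (2 * a) (2 * b) = cut_rank K k L \<phi> (\<alpha> + of_int (2 * a) * \<epsilon>) (\<alpha> + of_int (2 * b) * \<epsilon>)" for a b
      unfolding t_def[symmetric] by (simp add: R_def cut_rank_def S_def t_less)
    show "R (2 * a + 1) (2 * b + 1) = cut_rank K k L \<psi> (\<alpha> + of_int (2 * a + 1) * \<epsilon>) (\<alpha> + of_int (2 * b + 1) * \<epsilon>)" for a b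
      unfolding t_def[symmetric] by (simp add: R_def cut_rank_def S_def t_less)
    show "0 \<le> grid_rank R i j" if "i < j - 1" for i j using that by (rule nonneg)
  qed (rule that)
qed

lemma diagram_injection:
  fixes \<phi> \<psi> :: "'a::topological_space \<Rightarrow>\<^sub>C real"
  assumes fin: "persistence_finite K k \<phi>" "persistence_finite K k \<psi>" and \<epsilon>: "dist \<phi> \<psi> < \<epsilon>"
  obtains f where "inj_on f (occurrences (persistence_diagram K k \<phi>))"
    "f ` occurrences (persistence_diagram K k \<phi>) \<subseteq> occurrences (persistence_diagram K k \<psi>)"
    "\<And>q. q \<in> occurrences (persistence_diagram K k \<phi>) \<Longrightarrow> point_dist (fst q) (fst (f q)) \<le> ereal (6 * \<epsilon>)"
proof -
  have "0 < \<epsilon>" using \<epsilon> zero_le_dist[of \<phi> \<psi>] by linarith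
  define M where "M = max (SUP x. apply_bcontfun \<phi> x) (SUP x. apply_bcontfun \<psi> x)"
  \<comment> \<open>The gap of \<open>7 * \<epsilon>\<close> exceeds both constants: a displacement
    of \<open>3 * \<epsilon>\<close> cannot turn an infinite death into a finite one, and a point of
    infinite death, born at or below \<open>M\<close>, is never among those sent to the
    diagonal.\<close>
  define L where "L = M + 7 * \<epsilon>"
  have L: "(SUP x. apply_bcontfun \<phi> x) < L" "(SUP x. apply_bcontfun \<psi> x) < L"
    using \<open>0 < \<epsilon>\<close> by (auto simp: L_def M_def)
  interpret A: persistence_rank "cut_rank K k L \<phi>" using fin(1) by (rule persistence_rank_cut_rank)
  interpret B: persistence_rank "cut_rank K k L \<psi>" using fin(2) by (rule persistence_rank_cut_rank)
  have deathA: "w = L \<or> w \<le> M" if "((u, w), i) \<in> A.point_copies" for u w i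
    using that cut_rank_above_mult[OF fin(1), of u w L] by (force simp: A.point_copies_def M_def)
  have deathB: "w = L \<or> w \<le> M" if "((u, w), i) \<in> B.point_copies" for u w i
    using that cut_rank_above_mult[OF fin(2), of u w L] by (force simp: B.point_copies_def M_def)
  have birthA: "u \<le> M" if "((u, L), i) \<in> A.point_copies" for u i
    using that infinite_multiplicity_eq_mult[OF fin(1) L(1), of u] infinite_multiplicity_above[of \<phi> u K k]
    by (force simp: A.point_copies_def M_def)
  \<comment> \<open>\<open>e\<close> reads death \<open>L\<close> as infinity, and \<open>d\<close>
    undoes this.\<close>
  define e where "e = (\<lambda>((u, w), i :: nat). ((u :: real, if w = L then \<infinity> else ereal w), i))"
  define d where "d = (\<lambda>((u :: real, v), i :: nat). ((u, if v = \<infinity> then L else real_of_ereal v), i))"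
  have de: "d (e p) = p" for p by (auto simp: d_def e_def split: prod.splits)
  obtain f0 where f0: "inj_on f0 {((u, v), i) \<in> A.point_copies. 6 * \<epsilon> \<le> v - u}" (is "inj_on f0 ?Big")
    "\<And>u v i. \<lbrakk>((u, v), i) \<in> A.point_copies; 6 * \<epsilon> \<le> v - u\<rbrakk>
      \<Longrightarrow> \<exists>u' v' i'. f0 ((u, v), i) = ((u', v'), i') \<and> ((u', v'), i') \<in> B.point_copies
          \<and> \<bar>u - u'\<bar> \<le> 3 * \<epsilon> \<and> \<bar>v - v'\<bar> \<le> 3 * \<epsilon>"
    using point_copies_injection[OF fin \<epsilon>, of L] by blast
  define diag where "diag = (\<lambda>q :: (real \<times> ereal) \<times> nat. snd (fst q) = ereal (fst (fst q)))"
  \<comment> \<open>A short-lived point moves down to the diagonal point with the same birth. Odd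
    copy numbers are used here and even ones for the old diagonal points, so the images do not
    collide; numbering all copies of points makes \<open>small\<close> injective.\<close>
  define small where "small p = ((fst (fst p), ereal (fst (fst p))), 2 * to_nat_on A.point_copies p + 1)"
    for p :: "(real \<times> real) \<times> nat"
  define f where "f q = (if diag q then (fst q, 2 * snd q)
    else if d q \<in> ?Big then e (f0 (d q)) else small (d q))" for q
  have occA: "q \<in> occurrences (persistence_diagram K k \<phi>) \<longleftrightarrow> diag q \<or> q \<in> e ` A.point_copies" for q
  proof -
    obtain u v i where q: "q = ((u, v), i)" by (metis surj_pair)
    show ?thesis unfolding q occurrences_persistence_diagram[OF fin(1) L(1)]
      by (force simp: diag_def e_def image_iff)
  qed
  have occB: "q \<in> occurrences (persistence_diagram K k \<psi>) \<longleftrightarrow> diag q \<or> q \<in> e ` B.point_copies" for q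
  proof -
    obtain u v i where q: "q = ((u, v), i)" by (metis surj_pair)
    show ?thesis unfolding q occurrences_persistence_diagram[OF fin(2) L(2)]
      by (force simp: diag_def e_def image_iff)
  qed
  have off_diag: "\<not> diag (e ((u, w), i))" if "u < w" for u w i using that by (auto simp: diag_def e_def)
  have offA: "\<not> diag (e p)" if "p \<in> A.point_copies" for p
    using that off_diag by (auto simp: A.point_copies_def)
  have offB: "\<not> diag (e p)" if "p \<in> B.point_copies" for p
    using that off_diag by (auto simp: B.point_copies_def)
  have big: "f0 p \<in> B.point_copies" if "p \<in> ?Big" for p
    using that f0(2) by (cases p) force
  have f_diag: "f q = (fst q, 2 * snd q)" if "diag q" for q using that by (simp add: f_def)
  have f_big: "f (e p) = e (f0 p)" if "p \<in> ?Big" for p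
  proof -
    have "p \<in> A.point_copies" using that by auto
    then show ?thesis using that offA unfolding f_def de by simp
  qed
  have f_small: "f (e p) = small p" if "p \<in> A.point_copies" "p \<notin> ?Big" for p
    using that offA unfolding f_def de by simp
  have diag_small: "diag (small p)" for p by (simp add: diag_def small_def)
  have cases: thesis' if "q \<in> occurrences (persistence_diagram K k \<phi>)"
    "diag q \<Longrightarrow> f q = (fst q, 2 * snd q) \<Longrightarrow> thesis'"
    "\<And>p. q = e p \<Longrightarrow> p \<in> ?Big \<Longrightarrow> f q = e (f0 p) \<Longrightarrow> thesis'"
    "\<And>p. q = e p \<Longrightarrow> p \<in> A.point_copies \<Longrightarrow> p \<notin> ?Big \<Longrightarrow> f q = small p \<Longrightarrow> thesis'" for q thesis'
    using that(1) unfolding occA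
  proof
    assume "q \<in> e ` A.point_copies"
    then obtain p where p: "q = e p" "p \<in> A.point_copies" by blast
    show thesis'
    proof (cases "p \<in> ?Big")
      case True
      show thesis' by (rule that(3)[OF p(1) True]) (simp only: p(1) f_big[OF True])
    next
      case False
      show thesis' by (rule that(4)[OF p False]) (simp only: p(1) f_small[OF p(2) False])
    qed
  qed (use that(2) f_diag in blast)
  show ?thesis
  proof (rule that)
    show "f ` occurrences (persistence_diagram K k \<phi>) \<subseteq> occurrences (persistence_diagram K k \<psi>)"
    proof (rule image_subsetI)
      fix q assume "q \<in> occurrences (persistence_diagram K k \<phi>)"
      then show "f q \<in> occurrences (persistence_diagram K k \<psi>)"
      proof (rule cases)
        assume "diag q" "f q = (fst q, 2 * snd q)"
        then show ?thesis unfolding occB by (simp add: diag_def)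
      next
        fix p assume "p \<in> ?Big" "f q = e (f0 p)"
        then show ?thesis unfolding occB using big[of p] by auto
      next
        fix p assume "f q = small p"
        then show ?thesis unfolding occB using diag_small[of p] by simp
      qed
    qed
    show "inj_on f (occurrences (persistence_diagram K k \<phi>))"
    proof (rule inj_onI)
      fix q q' assume q: "q \<in> occurrences (persistence_diagram K k \<phi>)"
        and q': "q' \<in> occurrences (persistence_diagram K k \<phi>)" and eq: "f q = f q'"
      have e_inj: "p = p'" if "e p = e p'" for p p' using that de by metis
      have parity: "snd (small p) \<noteq> 2 * n" for p n by (simp add: small_def) presburger
      show "q = q'"
      proof (rule cases[OF q]; rule cases[OF q'])
        assume "diag q" "f q = (fst q, 2 * snd q)" "diag q'" "f q' = (fst q', 2 * snd q')"
        then show ?thesis using eq by (simp add: prod_eq_iff)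
      next
        fix p' assume "diag q" "f q = (fst q, 2 * snd q)" "p' \<in> ?Big" "f q' = e (f0 p')"
        then have "diag (e (f0 p'))" using eq by (metis diag_def fst_conv)
        then show ?thesis using offB big \<open>p' \<in> ?Big\<close> by blast
      next
        fix p' assume "f q = (fst q, 2 * snd q)" "f q' = small p'"
        then have "snd (small p') = 2 * snd q" using eq by (metis snd_conv)
        then show ?thesis using parity by blast
      next
        fix p assume "diag q'" "f q' = (fst q', 2 * snd q')" "p \<in> ?Big" "f q = e (f0 p)"
        then have "diag (e (f0 p))" using eq by (metis diag_def fst_conv)
        then show ?thesis using offB big \<open>p \<in> ?Big\<close> by blast
      next
        fix p p' assume *: "q = e p" "p \<in> ?Big" "f q = e (f0 p)" "q' = e p'" "p' \<in> ?Big" "f q' = e (f0 p')"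
        then have "f0 p = f0 p'" using eq e_inj by metis
        from inj_onD[OF f0(1) this *(2,5)] have "p = p'" .
        then show ?thesis using * by simp
      next
        fix p p' assume "p \<in> ?Big" "f q = e (f0 p)" "f q' = small p'"
        then have "diag (e (f0 p))" using eq diag_small by metis
        then show ?thesis using offB big \<open>p \<in> ?Big\<close> by blast
      next
        fix p assume "f q' = (fst q', 2 * snd q')" "f q = small p"
        then have "snd (small p) = 2 * snd q'" using eq by (metis snd_conv)
        then show ?thesis using parity by blast
      next
        fix p p' assume "p' \<in> ?Big" "f q' = e (f0 p')" "f q = small p"
        then have "diag (e (f0 p'))" using eq diag_small by metis
        then show ?thesis using offB big \<open>p' \<in> ?Big\<close> by blast
      next
        fix p p' assume *: "q = e p" "p \<in> A.point_copies" "f q = small p"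
          "q' = e p'" "p' \<in> A.point_copies" "f q' = small p'"
        then have "to_nat_on A.point_copies p = to_nat_on A.point_copies p'" using eq by (simp add: small_def)
        then have "p = p'" using *(2,5) A.countable_point_copies by simp
        then show ?thesis using * by simp
      qed
    qed
    fix q assume "q \<in> occurrences (persistence_diagram K k \<phi>)"
    then show "point_dist (fst q) (fst (f q)) \<le> ereal (6 * \<epsilon>)"
    proof (rule cases)
      assume "f q = (fst q, 2 * snd q)"
      then show ?thesis using \<open>0 < \<epsilon>\<close> by simp
    next
      fix p assume p: "q = e p" "p \<in> ?Big" "f q = e (f0 p)"
      obtain u w i where uw: "p = ((u, w), i)" by (metis surj_pair)
      have p': "((u, w), i) \<in> A.point_copies" "6 * \<epsilon> \<le> w - u" using p(2) unfolding uw by auto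
      obtain u' w' i' where *: "f0 p = ((u', w'), i')" "((u', w'), i') \<in> B.point_copies"
        "\<bar>u - u'\<bar> \<le> 3 * \<epsilon>" "\<bar>w - w'\<bar> \<le> 3 * \<epsilon>"
        using f0(2)[OF p'] unfolding uw by blast
      have "w = L \<longleftrightarrow> w' = L"
        using deathA[OF p'(1)] deathB[OF *(2)] *(4) \<open>0 < \<epsilon>\<close> by (auto simp: L_def)
      then show ?thesis using *(3,4) \<open>0 < \<epsilon>\<close> unfolding p(3) *(1) unfolding p(1) uw
        by (auto simp: e_def point_dist_def)
    next
      fix p assume p: "q = e p" "p \<in> A.point_copies" "p \<notin> ?Big" "f q = small p"
      obtain u w i where uw: "p = ((u, w), i)" by (metis surj_pair)
      have w: "u < w" "w - u < 6 * \<epsilon>" using p(2,3) unfolding uw by (auto simp: A.point_copies_def)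
      have "w \<noteq> L"
      proof
        assume "w = L"
        then have "u \<le> M" using birthA p(2) unfolding uw by blast
        then show False using w \<open>w = L\<close> \<open>0 < \<epsilon>\<close> by (simp add: L_def)
      qed
      \<comment> \<open>The birth is kept and the death moves by the lifetime, which is less than
        \<open>6 * \<epsilon>\<close>.\<close>
      then show ?thesis using w \<open>0 < \<epsilon>\<close> unfolding p(4) unfolding p(1) uw
        by (simp add: e_def small_def point_dist_def)
    qed
  qed
qed

lemma d_match_le:
  assumes "persistence_finite K k \<phi>" "persistence_finite K k \<psi>" "dist \<phi> \<psi> < \<epsilon>"
  shows "d_match K k \<phi> \<psi> \<le> ereal (6 * \<epsilon>)"
proof -
  have "dist \<psi> \<phi> < \<epsilon>" using assms(3) by (simp add: dist_commute)
  obtain f where f: "inj_on f (occurrences (persistence_diagram K k \<phi>))"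
    "f ` occurrences (persistence_diagram K k \<phi>) \<subseteq> occurrences (persistence_diagram K k \<psi>)"
    "\<And>q. q \<in> occurrences (persistence_diagram K k \<phi>) \<Longrightarrow> point_dist (fst q) (fst (f q)) \<le> ereal (6 * \<epsilon>)"
    using diagram_injection[OF assms] by blast
  obtain g where g: "inj_on g (occurrences (persistence_diagram K k \<psi>))"
    "g ` occurrences (persistence_diagram K k \<psi>) \<subseteq> occurrences (persistence_diagram K k \<phi>)"
    "\<And>q. q \<in> occurrences (persistence_diagram K k \<psi>) \<Longrightarrow> point_dist (fst q) (fst (g q)) \<le> ereal (6 * \<epsilon>)"
    using diagram_injection[OF assms(2,1) \<open>dist \<psi> \<phi> < \<epsilon>\<close>] by blast
  show ?thesis
    unfolding d_match_def by (rule bottleneck_dist_le_of_injections[OF f(1,2) g(1,2) f(3) g(3)])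
qed

text \<open>The map \<open>g\<close> restricts to homeomorphisms from the sublevel sets of the
  composition onto those of \<open>\<phi>\<close>, compatible with inclusions. So the cut ranks
  coincide for every \<open>L\<close>, and they determine all multiplicities.\<close>

lemma persistence_diagram_homeomorphism:
  assumes g: "homeomorphic_map euclidean euclidean g"
    and fin: "persistence_finite K k \<phi>" "persistence_finite K k (\<phi> \<circ>\<^sub>C g)"
  shows "persistence_diagram K k (\<phi> \<circ>\<^sub>C g) = persistence_diagram K k \<phi>"
proof -
  have "continuous_on UNIV g" using homeomorphic_imp_continuous_map[OF g] by simp
  then have sub: "sublevel_set (\<phi> \<circ>\<^sub>C g) t = g -` sublevel_set \<phi> t" for t by (rule sublevel_set_comp)
  have rank: "cut_rank K k L (\<phi> \<circ>\<^sub>C g) = cut_rank K k L \<phi>" for L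
  proof (intro ext)
    fix u v
    show "cut_rank K k L (\<phi> \<circ>\<^sub>C g) u v = cut_rank K k L \<phi> u v"
      using fin inclusion_rank_homeomorphic[OF g, of K k "sublevel_set \<phi> u" "sublevel_set \<phi> v"]
      by (simp add: cut_rank_def persistence_finite_def sub)
  qed
  have "finite_multiplicity K k (\<phi> \<circ>\<^sub>C g) u v = finite_multiplicity K k \<phi> u v" if "u < v" for u v
    using finite_multiplicity_eq_mult[OF fin(1) that, of "v + 1"]
      finite_multiplicity_eq_mult[OF fin(2) that, of "v + 1"] by (simp add: rank)
  moreover have "infinite_multiplicity K k (\<phi> \<circ>\<^sub>C g) u = infinite_multiplicity K k \<phi> u" for u
  proof -
    \<comment> \<open>One cut that is admissible for both functions and lies above
      \<open>u\<close>.\<close>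
    define L where "L = Max {u, SUP x. apply_bcontfun \<phi> x, SUP x. apply_bcontfun (\<phi> \<circ>\<^sub>C g) x} + 1"
    have "u < L" "(SUP x. apply_bcontfun \<phi> x) < L" "(SUP x. apply_bcontfun (\<phi> \<circ>\<^sub>C g) x) < L"
      by (auto simp: L_def)
    then show ?thesis
      using infinite_multiplicity_eq_mult[OF fin(1)] infinite_multiplicity_eq_mult[OF fin(2)] by (simp add: rank)
  qed
  ultimately have "persistence_diagram K k (\<phi> \<circ>\<^sub>C g) (u, v) = persistence_diagram K k \<phi> (u, v)" for u v
    by (cases v) (simp_all add: persistence_diagram_def)
  then show ?thesis by (simp add: fun_eq_iff)
qed

lemma occurrences_persistence_diagram_nonempty: "occurrences (persistence_diagram K k \<phi>) \<noteq> {}"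
proof -
  have "((0, ereal 0), 0) \<in> occurrences (persistence_diagram K k \<phi>)"
    by (simp add: occurrences_def persistence_diagram_def)
  then show ?thesis by blast
qed

theorem proposition12:
  fixes K :: "'k::field itself"
    and k :: nat
    and T :: "'e::euclidean_space set set"
    and \<Phi> :: "('a::metric_space \<Rightarrow>\<^sub>C real) set"
    and G :: "('a \<Rightarrow> 'a) set"
    and \<F> :: "(('a \<Rightarrow>\<^sub>C real) \<Rightarrow> ('a \<Rightarrow>\<^sub>C real)) set"
  assumes "simplicial_complex T" and "(UNIV :: 'a set) homeomorphic \<Union>T"
    and "carrier (homology_space k (euclidean :: 'a topology) :: ('k, ('a, 'k) field_chain set) module)
           \<noteq> {\<zero>\<^bsub>homology_space k (euclidean :: 'a topology)\<^esub>}"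
    and "\<And>c. const_bcontfun c \<in> \<Phi>"
    and "subgroup G homeo_group"
    and "\<And>\<phi> g. \<phi> \<in> \<Phi> \<Longrightarrow> g \<in> G \<Longrightarrow> \<phi> \<circ>\<^sub>C g \<in> \<Phi>"
    and "\<F> \<noteq> {}" and "\<F> \<subseteq> nonexpansive_operators \<Phi> G"
  shows "pseudo_metric_on \<Phi> (D_match K k \<F>) \<and> strongly_invariant \<Phi> G (D_match K k \<F>)"
proof
  have fin: "persistence_finite K k \<phi>" for \<phi> :: "'a \<Rightarrow>\<^sub>C real"
    unfolding persistence_finite_def inclusion_finite_def sublevel_eq[symmetric]
    using rel_finite_sublevel[OF assms(1,2)] by blast
  note nonempty = occurrences_persistence_diagram_nonempty
  have F: "dist (F \<phi>) (F \<psi>) \<le> dist \<phi> \<psi>" "F (\<phi> \<circ>\<^sub>C g) = F \<phi> \<circ>\<^sub>C g"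
    if "F \<in> \<F>" "\<phi> \<in> \<Phi>" "\<psi> \<in> \<Phi>" "g \<in> G" for F \<phi> \<psi> g
    using assms(8) that unfolding nonexpansive_operators_def by blast+
  \<comment> \<open>Needed only to instantiate the joint fact \<open>F\<close> where no group
    element is at hand.\<close>
  have "id \<in> G" using subgroup.one_closed[OF assms(5)] by (simp add: homeo_group_def)
  obtain F0 where "F0 \<in> \<F>" using assms(7) by blast
  show "pseudo_metric_on \<Phi> (D_match K k \<F>)"
    unfolding pseudo_metric_on_def
  proof (intro conjI ballI)
    fix \<phi> \<psi> assume *: "\<phi> \<in> \<Phi>" "\<psi> \<in> \<Phi>"
    show "0 \<le> D_match K k \<F> \<phi> \<psi>"
      unfolding D_match_def d_match_def
      using \<open>F0 \<in> \<F>\<close> by (rule SUP_upper2) (rule bottleneck_dist_nonneg[OF nonempty])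
    \<comment> \<open>The summand 1 provides the strict inequality that \<open>d_match_le\<close>
      asks for; the bound does not depend on \<open>F\<close>.\<close>
    have "d_match K k (F \<phi>) (F \<psi>) \<le> ereal (6 * (dist \<phi> \<psi> + 1))" if "F \<in> \<F>" for F
      using F(1)[OF that * \<open>id \<in> G\<close>] by (intro d_match_le fin) linarith
    then have "D_match K k \<F> \<phi> \<psi> \<le> ereal (6 * (dist \<phi> \<psi> + 1))"
      unfolding D_match_def by (rule SUP_least)
    then show "D_match K k \<F> \<phi> \<psi> < \<infinity>" by (rule le_less_trans) simp
    show "D_match K k \<F> \<phi> \<psi> = D_match K k \<F> \<psi> \<phi>"
      unfolding D_match_def d_match_def by (simp only: bottleneck_dist_commute)
  next
    fix \<phi> show "D_match K k \<F> \<phi> \<phi> = 0"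
      unfolding D_match_def d_match_def using assms(7) by (simp add: bottleneck_dist_self[OF nonempty])
  next
    fix \<phi> \<psi> \<xi>
    show "D_match K k \<F> \<phi> \<xi> \<le> D_match K k \<F> \<phi> \<psi> + D_match K k \<F> \<psi> \<xi>"
      unfolding D_match_def
    proof (rule SUP_least)
      fix F assume F: "F \<in> \<F>"
      have "d_match K k (F \<phi>) (F \<xi>) \<le> d_match K k (F \<phi>) (F \<psi>) + d_match K k (F \<psi>) (F \<xi>)"
        unfolding d_match_def by (rule bottleneck_dist_triangle[OF nonempty nonempty])
      also have "\<dots> \<le> (SUP F\<in>\<F>. d_match K k (F \<phi>) (F \<psi>)) + (SUP F\<in>\<F>. d_match K k (F \<psi>) (F \<xi>))"
        using F by (intro add_mono SUP_upper)
      finally show "d_match K k (F \<phi>) (F \<xi>)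
        \<le> (SUP F\<in>\<F>. d_match K k (F \<phi>) (F \<psi>)) + (SUP F\<in>\<F>. d_match K k (F \<psi>) (F \<xi>))" .
    qed
  qed
  show "strongly_invariant \<Phi> G (D_match K k \<F>)"
  proof -
    have inv: "persistence_diagram K k (F (\<phi> \<circ>\<^sub>C g)) = persistence_diagram K k (F \<phi>)"
      if "F \<in> \<F>" "\<phi> \<in> \<Phi>" "g \<in> G" for F \<phi> g
    proof -
      have "homeomorphic_map euclidean euclidean g"
        using subgroup.subset[OF assms(5)] that(3) by (auto simp: homeo_group_def)
      then show ?thesis
        using F(2)[OF that(1,2,2,3)] persistence_diagram_homeomorphism fin by metis
    qed
    show ?thesis
      unfolding strongly_invariant_def D_match_def d_match_def
      by (intro ballI conjI SUP_cong refl) (simp_all add: inv)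
  qed
qed

end
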